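(* Let $G$ be a finite connected graph without loops and multiple edges, all of whose vertices have degree at least $3$, and let $G(P)$ be a framework in $\mathbb{R}P^2$ in general position. Then $G(P)$ admits a non-parallelizable tensegrity if and only if there exists a consistent generic quantization $G_{\mathcal T}(\mathcal L,P)$ of $G(P)$.
   Context: **Forces.** A force in $\mathbb{R}P^2$ is an exterior 2-form in $\Lambda^2(\mathbb{R}^3)$ (all such forms are decomposable). For $p=(a_1,a_2,a_3)$ put $dp=a_1dx_1+a_2dx_2+a_3dx_3$. A nonzero force equals $dp\wedge dq$ with $p,q$ linearly independent; its line of force is the projective line through the points represented by $p$ and $q$. The zero force is allowed wherever a force with a prescribed line of force is required. **Frameworks and tensegrities.** A framework $G(P)$ assigns to the vertices $v_1,\dots,v_n$ of $G$ points $P=(p_1,\dots,p_n)$ of $\mathbb{R}P^2$, with straight edges $p_ip_j$ for the edges $v_iv_j$. Lines $m_1,\dots,m_k$ are in general position if their pairwise intersections form a discrete set of exactly $k(k-1)/2$ distinct points. A realization of a cycle is in general position if the lines through its edges are in general position. A simple cycle of $G$ is a subgraph homeomorphic to a circle. $G(P)$ is in general position if every simple cycle of $G$ with at most $n-1$ vertices is realized in general position. A force-load $F$ on $G(P)$ assigns to each edge forces $F_{i,j},F_{j,i}$ with line of force $p_ip_j$ and $F_{i,j}+F_{j,i}=0$ (and $F_{i,j}=0$ for non-edges); it is an equilibrium force-load if $\sum_{j\ne i}F_{i,j}=0$ for every $i$; then $(G(P),F)$ is a tensegrity. It is non-parallelizable if at each vertex, with $F_1,\dots,F_s$ the forces at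 the edges adjacent to that vertex: (1) for $a_i\in\{0,1\}$, $\sum a_iF_i=0$ implies $a_1=\dots=a_s$; (2) the $2^{s-1}-1$ lines of force of $F_1+\sum_{i=2}^sa_iF_i$, $(a_2,\dots,a_s)\in\{0,1\}^{s-1}\setminus\{(1,\dots,1)\}$, are pairwise distinct. **Resolution schemes.** Let $T$ be an unrooted full binary tree (every vertex has degree 1 or 3). An edge is a leaf if one of its vertices has degree 1; other edges are interior. A resolution scheme $(T,\mathcal L)_p$ at $p\in\mathbb{R}P^2$ is such a $T$ with a map $\mathcal L$ from the edges of $T$ to lines of $\mathbb{R}P^2$ with $p\in\mathcal L(e)$ for all $e$. An equilibrium force-load on it assigns to each edge $v_iv_j$ forces $F_{i,j}=-F_{j,i}$ with line of force $\mathcal L(v_iv_j)$ such that $\sum_jF_{i,j}=0$ at each vertex $v_i$ of degree 3. The scheme is weakly generic if $\mathcal L$ takes different values on any two adjacent edges (then a nonzero equilibrium force-load exists and is unique up to proportionality). It is strongly generic if it is weakly generic and the forces $F_1,\dots,F_s$ at the leaves of a nonzero equilibrium force-load ($F_r=F_{i,j}$ with $v_j$ the degree-1 vertex of the leaf) satisfy (1) and (2) above. **$\mathrm{H}\Phi$-surgery.** Let $(T,\mathcal L)_p$ be strongly generic with nonzero equilibrium force-load $F$, let $v_1v_2$ be an interior edge, $v_3,v_4$ the other neighbours of $v_1$ and $v_5,v_6$ the other neighbours of $v_2$. The surgery at $v_1v_2$ replaces $v_1,v_2$ and the edges $v_1v_2,v_1v_3,v_1v_4,v_2v_5,v_2v_6$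 by new vertices $v_1',v_2'$ and edges $v_1'v_2',v_1'v_3,v_1'v_5,v_2'v_4,v_2'v_6$; the last four carry the lines $\mathcal L(v_1v_3),\mathcal L(v_2v_5),\mathcal L(v_1v_4),\mathcal L(v_2v_6)$ respectively, all other old edges keep their lines, and $v_1'v_2'$ carries the line of force of $F_{1,3}+F_{2,5}$. Two strongly generic schemes are equivalent if a sequence of $\mathrm{H}\Phi$-surgeries takes one to the other. **Quantizations.** Let $\mathcal T=(T_1,\dots,T_n)$ be disjoint unrooted full binary trees, the leaves of $T_i$ being in bijection with the edges of $G$ at $v_i$. The resolution graph $G_{\mathcal T}$ is obtained by gluing, for each edge $v_iv_j$ of $G$, the corresponding leaves of $T_i$ and $T_j$ into one edge (a leaf of $G_{\mathcal T}$); other edges are interior. A quantization $G_{\mathcal T}(\mathcal L,P)$ is $G_{\mathcal T}$ with a map $\mathcal L$ from its edges to lines in $\mathbb{R}P^2$ such that $\mathcal L(e)=p_ip_j$ for the leaf $e$ corresponding to $p_ip_j$ and $p_i\in\mathcal L(e)$ for every interior edge $e$ of $T_i$. It is generic if each resolution scheme $(T_i,\mathcal L|_{T_i})_{p_i}$ is strongly generic. **Framing.** Given a generic quantization and edges $p_ip_j,p_ip_k$, take a resolution scheme $(T_i',\mathcal L')_{p_i}$ equivalent to $(T_i,\mathcal L|_{T_i})_{p_i}$ in which the leaves corresponding to these two edges share a vertex $v$, let $e$ be the third edge at $v$, and set $\ell_{jik}=\mathcal L'(e)$ (this does not depend on the choice). For a simple cycle $C=q_1\dots q_s$ of $G(P)$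 not containing all vertices, $C(G,\mathcal T,P,\mathcal L)$ is the cycle $C$ with each vertex $p_i$ (with neighbours $p_j,p_k$ in $C$) equipped with the line $\ell_{jik}$. **Monodromy and consistency.** Let $(q_1,\dots,q_s)$ with lines $\ell_r\ni q_r$ be a framed cycle (indices mod $s$) in general position: the lines $q_rq_{r+1}$ are in general position and $\ell_r$ contains neither $q_{r-1}$ nor $q_{r+1}$. For a line $\ell$ containing no intersection point of the lines of two distinct edges, the shift operator $\ell_r\to\ell_{r+1}$ sends $p$ to the intersection of $\ell_{r+1}$ with the line through $p$ and $q_rq_{r+1}\cap\ell$. The monodromy at $\ell_r$ is the composition $\ell_r\to\ell_r$ of the shifts once around the cycle. The framed cycle satisfies the monodromy cycle condition if a monodromy is the identity (this depends neither on $r$ nor on $\ell$). A generic quantization of $G(P)$ is consistent if for every simple cycle $C$ not containing all vertices, $C(G,\mathcal T,P,\mathcal L)$ satisfies the monodromy cycle condition. *)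

theory Defs
  imports "HOL-Analysis.Analysis" "Graph_Theory.Pair_Digraph" "Graph_Theory.Digraph_Component"
begin

section \<open>The real projective plane\<close>

typedef rp2_point = "{S :: (real^3) set. subspace S \<and> dim S = 1}"
  by (rule exI[of _ "span {axis 1 1}"]) (simp add: dim_span axis_eq_axis)

typedef rp2_line = "{S :: (real^3) set. subspace S \<and> dim S = 2}"
  using choose_subspace_of_subspace[of 2 "UNIV :: (real^3) set"]
  by (auto simp: dim_UNIV)

definition proj_point :: "real^3 \<Rightarrow> rp2_point" where
  "proj_point p = Abs_rp2_point (span {p})"

definition lies_on :: "rp2_point \<Rightarrow> rp2_line \<Rightarrow> bool" where
  "lies_on p l \<longleftrightarrow> Rep_rp2_point p \<subseteq> Rep_rp2_line l"

definition join :: "rp2_point \<Rightarrow> rp2_point \<Rightarrow> rp2_line" where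
  "join p q = (THE l. lies_on p l \<and> lies_on q l)"

definition meet :: "rp2_line \<Rightarrow> rp2_line \<Rightarrow> rp2_point" where
  "meet l m = (THE p. lies_on p l \<and> lies_on p m)"

definition lines_general_position :: "rp2_line list \<Rightarrow> bool" where
  "lines_general_position ms \<longleftrightarrow>
     (let X = {x. \<exists>i j. i < j \<and> j < length ms \<and> lies_on x (ms ! i) \<and> lies_on x (ms ! j)}
      in finite X \<and> card X = length ms * (length ms - 1) div 2)"


section \<open>Forces\<close>

text \<open>Exterior 2-forms on \<open>\<real>\<^sup>3\<close>, as alternating bilinear forms.\<close>

typedef force = "{w :: real^3 \<Rightarrow> real^3 \<Rightarrow> real. bilinear w \<and> (\<forall>u. w u u = 0)}"
  by (rule exI[of _ "\<lambda>u v. 0"]) (simp add: bilinear_def linear_zero)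

setup_lifting type_definition_force

instantiation force :: real_vector
begin

lift_definition zero_force :: force is "\<lambda>u v. 0"
  by (simp add: bilinear_def linear_zero)

lift_definition plus_force :: "force \<Rightarrow> force \<Rightarrow> force" is "\<lambda>w w' u v. w u v + w' u v"
  by (auto simp: bilinear_def intro: linear_compose_add)

lift_definition uminus_force :: "force \<Rightarrow> force" is "\<lambda>w u v. - w u v"
  by (auto simp: bilinear_def intro: linear_compose_neg)

lift_definition minus_force :: "force \<Rightarrow> force \<Rightarrow> force" is "\<lambda>w w' u v. w u v - w' u v"
  by (auto simp: bilinear_def intro: linear_compose_sub)

lift_definition scaleR_force :: "real \<Rightarrow> force \<Rightarrow> force" is "\<lambda>c w u v. c * w u v"
  by (auto simp: bilinear_def linear_iff algebra_simps)

instance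
  by standard (transfer; auto simp: fun_eq_iff algebra_simps)+

end

text \<open>\<open>d_wedge p q\<close> is \<open>dp \<and> dq\<close>, where \<open>dp\<close> is the linear functional \<open>u \<mapsto> p \<bullet> u\<close>.\<close>

lift_definition d_wedge :: "real^3 \<Rightarrow> real^3 \<Rightarrow> force"
  is "\<lambda>p q u v. (p \<bullet> u) * (q \<bullet> v) - (p \<bullet> v) * (q \<bullet> u)"
  by (auto simp: bilinear_def linear_iff inner_add_right algebra_simps)

definition line_of_force :: "force \<Rightarrow> rp2_line" where
  "line_of_force F = (THE l. \<exists>p q. p \<noteq> q \<and> independent {p, q} \<and> F = d_wedge p q \<and>
                                   l = join (proj_point p) (proj_point q))"

definition force_along :: "force \<Rightarrow> rp2_line \<Rightarrow> bool" where
  "force_along F l \<longleftrightarrow> F = 0 \<or> line_of_force F = l"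

text \<open>
  Conditions (1) and (2) for a family of forces \<open>F\<^sub>r\<close>, \<open>r \<in> I\<close>. A coefficient vector in
  \<open>{0,1}\<^sup>I\<close> is given by its support. In (2), the family may be numbered so that any index
  \<open>r\<close> comes first.
\<close>

definition non_parallel :: "'i set \<Rightarrow> ('i \<Rightarrow> force) \<Rightarrow> bool" where
  "non_parallel I F \<longleftrightarrow>
     (\<forall>A \<subseteq> I. sum F A = 0 \<longrightarrow> A = {} \<or> A = I) \<and>
     (\<forall>r \<in> I. inj_on (\<lambda>A. line_of_force (sum F A)) {A. r \<in> A \<and> A \<subset> I})"


section \<open>Graphs\<close>

definition nbrs :: "'a pair_pre_digraph \<Rightarrow> 'a \<Rightarrow> 'a set" where
  "nbrs G x = {y. (x, y) \<in> parcs G}"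

definition uedges :: "'a pair_pre_digraph \<Rightarrow> 'a set set" where
  "uedges G = {{x, y} | x y. (x, y) \<in> parcs G}"

text \<open>
  Undirected cycles. The \<open>cycle\<close> of \<^theory>\<open>Graph_Theory.Arc_Walk\<close> (and hence \<open>forest\<close> and \<open>tree\<close>) is for directed
  graphs, where every edge of a symmetric digraph already gives a cycle of length 2.
\<close>

definition simple_cycle :: "'a pair_pre_digraph \<Rightarrow> 'a list \<Rightarrow> bool" where
  "simple_cycle G q \<longleftrightarrow> 3 \<le> length q \<and> distinct q \<and>
     (\<forall>r < length q. (q ! r, q ! (Suc r mod length q)) \<in> parcs G)"


section \<open>Frameworks and tensegrities\<close>

text \<open>The line \<open>p\<^sub>ip\<^sub>j\<close> of an edge is only defined for \<open>p\<^sub>i \<noteq> p\<^sub>j\<close>.\<close>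

definition framework :: "'v pair_pre_digraph \<Rightarrow> ('v \<Rightarrow> rp2_point) \<Rightarrow> bool" where
  "framework G P \<longleftrightarrow> (\<forall>(i, j) \<in> parcs G. P i \<noteq> P j)"

text \<open>For a closed polygon, given by its vertices in cyclic order.\<close>

definition edge_line :: "rp2_point list \<Rightarrow> nat \<Rightarrow> rp2_line" where
  "edge_line qs r = join (qs ! (r mod length qs)) (qs ! (Suc r mod length qs))"

definition edge_lines :: "rp2_point list \<Rightarrow> rp2_line list" where
  "edge_lines qs = map (edge_line qs) [0..<length qs]"

definition framework_general_position ::
    "'v pair_pre_digraph \<Rightarrow> ('v \<Rightarrow> rp2_point) \<Rightarrow> bool" where
  "framework_general_position G P \<longleftrightarrow>
     (\<forall>q. simple_cycle G q \<and> length q \<le> card (pverts G) - 1 \<longrightarrow>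
          lines_general_position (edge_lines (map P q)))"

definition force_load ::
    "'v pair_pre_digraph \<Rightarrow> ('v \<Rightarrow> rp2_point) \<Rightarrow> ('v \<Rightarrow> 'v \<Rightarrow> force) \<Rightarrow> bool" where
  "force_load G P F \<longleftrightarrow>
     (\<forall>i j. (i, j) \<in> parcs G \<longrightarrow> force_along (F i j) (join (P i) (P j)) \<and> F i j + F j i = 0) \<and>
     (\<forall>i j. (i, j) \<notin> parcs G \<longrightarrow> F i j = 0)"

definition tensegrity ::
    "'v pair_pre_digraph \<Rightarrow> ('v \<Rightarrow> rp2_point) \<Rightarrow> ('v \<Rightarrow> 'v \<Rightarrow> force) \<Rightarrow> bool" where
  "tensegrity G P F \<longleftrightarrow>
     framework G P \<and> force_load G P F \<and> (\<forall>i \<in> pverts G. (\<Sum>j \<in> pverts G - {i}. F i j) = 0)"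

definition non_parallelizable :: "'v pair_pre_digraph \<Rightarrow> ('v \<Rightarrow> 'v \<Rightarrow> force) \<Rightarrow> bool" where
  "non_parallelizable G F \<longleftrightarrow> (\<forall>i \<in> pverts G. non_parallel (nbrs G i) (F i))"


section \<open>Resolution schemes\<close>

definition full_binary_tree :: "'t pair_pre_digraph \<Rightarrow> bool" where
  "full_binary_tree T \<longleftrightarrow>
     pair_graph T \<and> Digraph_Component.connected (with_proj T) \<and> (\<nexists>q. simple_cycle T q) \<and>
     (\<forall>x \<in> pverts T. out_degree (with_proj T) x \<in> {1, 3})"

text \<open>
  In a full binary tree with a vertex of degree 3, a leaf (which is an edge) is determined by its
  vertex of degree 1, and \<open>stem\<close> is the other vertex of the leaf.
\<close>

definition leaf_verts :: "'t pair_pre_digraph \<Rightarrow> 't set" where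
  "leaf_verts T = {x \<in> pverts T. out_degree (with_proj T) x = 1}"

definition inner_verts :: "'t pair_pre_digraph \<Rightarrow> 't set" where
  "inner_verts T = {x \<in> pverts T. out_degree (with_proj T) x = 3}"

definition stem :: "'t pair_pre_digraph \<Rightarrow> 't \<Rightarrow> 't" where
  "stem T x = (THE y. (x, y) \<in> parcs T)"

definition interior_arcs :: "'t pair_pre_digraph \<Rightarrow> ('t \<times> 't) set" where
  "interior_arcs T = {(x, y) \<in> parcs T. x \<notin> leaf_verts T \<and> y \<notin> leaf_verts T}"

definition resolution_scheme ::
    "rp2_point \<Rightarrow> 't pair_pre_digraph \<Rightarrow> ('t set \<Rightarrow> rp2_line) \<Rightarrow> bool" where
  "resolution_scheme p T L \<longleftrightarrow> full_binary_tree T \<and> (\<forall>e \<in> uedges T. lies_on p (L e))"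

definition scheme_equilibrium ::
    "'t pair_pre_digraph \<Rightarrow> ('t set \<Rightarrow> rp2_line) \<Rightarrow> ('t \<Rightarrow> 't \<Rightarrow> force) \<Rightarrow> bool" where
  "scheme_equilibrium T L F \<longleftrightarrow>
     (\<forall>(x, y) \<in> parcs T. force_along (F x y) (L {x, y}) \<and> F x y = - F y x) \<and>
     (\<forall>x \<in> inner_verts T. (\<Sum>y \<in> nbrs T x. F x y) = 0)"

definition nonzero_load :: "'t pair_pre_digraph \<Rightarrow> ('t \<Rightarrow> 't \<Rightarrow> force) \<Rightarrow> bool" where
  "nonzero_load T F \<longleftrightarrow> (\<exists>(x, y) \<in> parcs T. F x y \<noteq> 0)"

definition weakly_generic ::
    "rp2_point \<Rightarrow> 't pair_pre_digraph \<Rightarrow> ('t set \<Rightarrow> rp2_line) \<Rightarrow> bool" where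
  "weakly_generic p T L \<longleftrightarrow> resolution_scheme p T L \<and>
     (\<forall>x y z. (x, y) \<in> parcs T \<and> (x, z) \<in> parcs T \<and> y \<noteq> z \<longrightarrow> L {x, y} \<noteq> L {x, z})"

definition strongly_generic ::
    "rp2_point \<Rightarrow> 't pair_pre_digraph \<Rightarrow> ('t set \<Rightarrow> rp2_line) \<Rightarrow> bool" where
  "strongly_generic p T L \<longleftrightarrow> weakly_generic p T L \<and>
     (\<exists>F. scheme_equilibrium T L F \<and> nonzero_load T F \<and>
          non_parallel (leaf_verts T) (\<lambda>x. F (stem T x) x))"


section \<open>Surgeries\<close>

text \<open>
  The new vertices are \<open>w1\<close> and \<open>w2\<close>. Vertices of degree 1 are never replaced by a surgery, so
  they identify the corresponding leaves of equivalent schemes.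
\<close>

definition surgery ::
    "rp2_point \<Rightarrow> 't pair_pre_digraph \<Rightarrow> ('t set \<Rightarrow> rp2_line) \<Rightarrow>
     't pair_pre_digraph \<Rightarrow> ('t set \<Rightarrow> rp2_line) \<Rightarrow> bool" where
  "surgery p T L T' L' \<longleftrightarrow> strongly_generic p T L \<and>
     (\<exists>F v1 v2 v3 v4 v5 v6 w1 w2.
        scheme_equilibrium T L F \<and> nonzero_load T F \<and>
        v1 \<in> pverts T \<and> v2 \<in> pverts T \<and>
        distinct [v2, v3, v4] \<and> nbrs T v1 = {v2, v3, v4} \<and>
        distinct [v1, v5, v6] \<and> nbrs T v2 = {v1, v5, v6} \<and>
        w1 \<notin> pverts T \<and> w2 \<notin> pverts T \<and> w1 \<noteq> w2 \<and>
        pverts T' = pverts T - {v1, v2} \<union> {w1, w2} \<and>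
        parcs T' = {(x, y). {x, y} \<in>
           uedges T - {{v1, v2}, {v1, v3}, {v1, v4}, {v2, v5}, {v2, v6}}
             \<union> {{w1, w2}, {w1, v3}, {w1, v5}, {w2, v4}, {w2, v6}}} \<and>
        L' {w1, v3} = L {v1, v3} \<and> L' {w1, v5} = L {v2, v5} \<and>
        L' {w2, v4} = L {v1, v4} \<and> L' {w2, v6} = L {v2, v6} \<and>
        L' {w1, w2} = line_of_force (F v1 v3 + F v2 v5) \<and>
        (\<forall>e \<in> uedges T \<inter> uedges T'. L' e = L e))"

definition scheme_equivalent ::
    "rp2_point \<Rightarrow> 't pair_pre_digraph \<Rightarrow> ('t set \<Rightarrow> rp2_line) \<Rightarrow>
     't pair_pre_digraph \<Rightarrow> ('t set \<Rightarrow> rp2_line) \<Rightarrow> bool" where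
  "scheme_equivalent p T L T' L' \<longleftrightarrow> strongly_generic p T L \<and> strongly_generic p T' L' \<and>
     (\<lambda>(S, M) (S', M'). surgery p S M S' M')\<^sup>*\<^sup>* (T, L) (T', L')"

text \<open>The framing line for the leaves with the degree-1 vertices \<open>a\<close> and \<open>b\<close>.\<close>

definition framing_line ::
    "rp2_point \<Rightarrow> 't pair_pre_digraph \<Rightarrow> ('t set \<Rightarrow> rp2_line) \<Rightarrow> 't \<Rightarrow> 't \<Rightarrow> rp2_line" where
  "framing_line p T L a b =
     (THE l. \<exists>T' L' v w. scheme_equivalent p T L T' L' \<and>
               distinct [a, b, w] \<and> nbrs T' v = {a, b, w} \<and> l = L' {v, w})"


section \<open>Quantizations\<close>

text \<open>
  \<open>T i\<close> is the tree at the vertex \<open>i\<close>, and \<open>lf i j\<close> is the degree-1 vertex of the leaf of \<open>T i\<close>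
  that corresponds to the edge \<open>ij\<close> of \<open>G\<close>.
\<close>

definition resolution_trees ::
    "'v pair_pre_digraph \<Rightarrow> ('v \<Rightarrow> 't pair_pre_digraph) \<Rightarrow> ('v \<Rightarrow> 'v \<Rightarrow> 't) \<Rightarrow> bool" where
  "resolution_trees G T lf \<longleftrightarrow>
     (\<forall>i \<in> pverts G. full_binary_tree (T i) \<and> bij_betw (lf i) (nbrs G i) (leaf_verts (T i))) \<and>
     (\<forall>i \<in> pverts G. \<forall>j \<in> pverts G. i \<noteq> j \<longrightarrow> pverts (T i) \<inter> pverts (T j) = {})"

text \<open>
  Gluing the leaf of \<open>T i\<close> and the leaf of \<open>T j\<close> that correspond to \<open>ij\<close> gives one edge between
  the inner vertices of the two leaves. As the trees are disjoint and \<open>G\<close> has neither loops nor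
  multiple edges, the resolution graph is again a simple graph if the degrees are at least 3.
\<close>

definition glued_leaf ::
    "('v \<Rightarrow> 't pair_pre_digraph) \<Rightarrow> ('v \<Rightarrow> 'v \<Rightarrow> 't) \<Rightarrow> 'v \<Rightarrow> 'v \<Rightarrow> 't \<times> 't" where
  "glued_leaf T lf i j = (stem (T i) (lf i j), stem (T j) (lf j i))"

definition resolution_graph ::
    "'v pair_pre_digraph \<Rightarrow> ('v \<Rightarrow> 't pair_pre_digraph) \<Rightarrow> ('v \<Rightarrow> 'v \<Rightarrow> 't)
      \<Rightarrow> 't pair_pre_digraph" where
  "resolution_graph G T lf =
     \<lparr> pverts = (\<Union>i \<in> pverts G. inner_verts (T i)),
       parcs = (\<Union>i \<in> pverts G. interior_arcs (T i)) \<union> {glued_leaf T lf i j | i j. (i, j) \<in> parcs G} \<rparr>"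

definition leaf_edge ::
    "('v \<Rightarrow> 't pair_pre_digraph) \<Rightarrow> ('v \<Rightarrow> 'v \<Rightarrow> 't) \<Rightarrow> 'v \<Rightarrow> 'v \<Rightarrow> 't set" where
  "leaf_edge T lf i j = {fst (glued_leaf T lf i j), snd (glued_leaf T lf i j)}"

text \<open>The edge of the resolution graph that an edge of \<open>T i\<close> becomes part of.\<close>

definition glue ::
    "'v pair_pre_digraph \<Rightarrow> ('v \<Rightarrow> 't pair_pre_digraph) \<Rightarrow> ('v \<Rightarrow> 'v \<Rightarrow> 't) \<Rightarrow> 'v
      \<Rightarrow> 't set \<Rightarrow> 't set" where
  "glue G T lf i e =
     (if \<exists>j \<in> nbrs G i. lf i j \<in> e then leaf_edge T lf i (THE j. j \<in> nbrs G i \<and> lf i j \<in> e) else e)"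

definition restrict_to_tree ::
    "'v pair_pre_digraph \<Rightarrow> ('v \<Rightarrow> 't pair_pre_digraph) \<Rightarrow> ('v \<Rightarrow> 'v \<Rightarrow> 't)
      \<Rightarrow> ('t set \<Rightarrow> rp2_line) \<Rightarrow> 'v \<Rightarrow> 't set \<Rightarrow> rp2_line" where
  "restrict_to_tree G T lf L i = L \<circ> glue G T lf i"

definition quantization ::
    "'v pair_pre_digraph \<Rightarrow> ('v \<Rightarrow> rp2_point) \<Rightarrow> ('v \<Rightarrow> 't pair_pre_digraph)
      \<Rightarrow> ('v \<Rightarrow> 'v \<Rightarrow> 't) \<Rightarrow> ('t set \<Rightarrow> rp2_line) \<Rightarrow> bool" where
  "quantization G P T lf L \<longleftrightarrow> resolution_trees G T lf \<and>
     L \<in> uedges (resolution_graph G T lf) \<rightarrow>\<^sub>E UNIV \<and>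
     (\<forall>(i, j) \<in> parcs G. L (leaf_edge T lf i j) = join (P i) (P j)) \<and>
     (\<forall>i \<in> pverts G. \<forall>(x, y) \<in> interior_arcs (T i). lies_on (P i) (L {x, y}))"

definition generic_quantization ::
    "'v pair_pre_digraph \<Rightarrow> ('v \<Rightarrow> rp2_point) \<Rightarrow> ('v \<Rightarrow> 't pair_pre_digraph)
      \<Rightarrow> ('v \<Rightarrow> 'v \<Rightarrow> 't) \<Rightarrow> ('t set \<Rightarrow> rp2_line) \<Rightarrow> bool" where
  "generic_quantization G P T lf L \<longleftrightarrow> quantization G P T lf L \<and>
     (\<forall>i \<in> pverts G. strongly_generic (P i) (T i) (restrict_to_tree G T lf L i))"

text \<open>The line \<open>\<ell>\<^sub>j\<^sub>i\<^sub>k\<close>, with the indices in this order.\<close>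

definition quantization_framing ::
    "'v pair_pre_digraph \<Rightarrow> ('v \<Rightarrow> rp2_point) \<Rightarrow> ('v \<Rightarrow> 't pair_pre_digraph)
      \<Rightarrow> ('v \<Rightarrow> 'v \<Rightarrow> 't) \<Rightarrow> ('t set \<Rightarrow> rp2_line) \<Rightarrow> 'v \<Rightarrow> 'v \<Rightarrow> 'v \<Rightarrow> rp2_line" where
  "quantization_framing G P T lf L j i k =
     framing_line (P i) (T i) (restrict_to_tree G T lf L i) (lf i j) (lf i k)"

definition cycle_framing ::
    "'v pair_pre_digraph \<Rightarrow> ('v \<Rightarrow> rp2_point) \<Rightarrow> ('v \<Rightarrow> 't pair_pre_digraph)
      \<Rightarrow> ('v \<Rightarrow> 'v \<Rightarrow> 't) \<Rightarrow> ('t set \<Rightarrow> rp2_line) \<Rightarrow> 'v list \<Rightarrow> rp2_line list" where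
  "cycle_framing G P T lf L q = (let s = length q in
     map (\<lambda>r. quantization_framing G P T lf L (q ! ((r + s - 1) mod s)) (q ! r) (q ! (Suc r mod s)))
       [0..<s])"


section \<open>Monodromy\<close>

text \<open>A framed cycle is given by its points \<open>qs\<close> and the lines \<open>ls\<close> of the same length.\<close>

definition framed_cycle_general_position :: "rp2_point list \<Rightarrow> rp2_line list \<Rightarrow> bool" where
  "framed_cycle_general_position qs ls \<longleftrightarrow>
     length ls = length qs \<and> lines_general_position (edge_lines qs) \<and>
     (\<forall>r < length qs. lies_on (qs ! r) (ls ! r) \<and>
        \<not> lies_on (qs ! ((r + length qs - 1) mod length qs)) (ls ! r) \<and>
        \<not> lies_on (qs ! (Suc r mod length qs)) (ls ! r))"

definition admissible_line :: "rp2_point list \<Rightarrow> rp2_line \<Rightarrow> bool" where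
  "admissible_line qs l \<longleftrightarrow>
     (\<forall>i j x. i < j \<and> j < length qs \<and> lies_on x (edge_line qs i) \<and> lies_on x (edge_line qs j)
        \<longrightarrow> \<not> lies_on x l)"

definition shift :: "rp2_point list \<Rightarrow> rp2_line list \<Rightarrow> rp2_line \<Rightarrow> nat \<Rightarrow> rp2_point \<Rightarrow> rp2_point" where
  "shift qs ls l r p = meet (ls ! (Suc r mod length qs)) (join p (meet (edge_line qs r) l))"

text \<open>The shifts \<open>\<ell>\<^sub>r \<rightarrow> \<ell>\<^bsub>r+1\<^esub> \<rightarrow> \<dots> \<rightarrow> \<ell>\<^bsub>r+s\<^esub> = \<ell>\<^sub>r\<close>, in this order.\<close>

definition monodromy ::
    "rp2_point list \<Rightarrow> rp2_line list \<Rightarrow> rp2_line \<Rightarrow> nat \<Rightarrow> rp2_point \<Rightarrow> rp2_point" where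
  "monodromy qs ls l r = fold (shift qs ls l) [r..<r + length qs]"

text \<open>
  The condition depends neither on \<open>r\<close> nor on \<open>l\<close>. It is only meant for framed cycles in general
  position, which the framings of a generic quantization are if the polygon is.
\<close>

definition monodromy_cycle_condition :: "rp2_point list \<Rightarrow> rp2_line list \<Rightarrow> bool" where
  "monodromy_cycle_condition qs ls \<longleftrightarrow> framed_cycle_general_position qs ls \<and>
     (\<exists>r < length qs. \<exists>l. admissible_line qs l \<and>
        (\<forall>p. lies_on p (ls ! r) \<longrightarrow> monodromy qs ls l r p = p))"

definition consistent_quantization ::
    "'v pair_pre_digraph \<Rightarrow> ('v \<Rightarrow> rp2_point) \<Rightarrow> ('v \<Rightarrow> 't pair_pre_digraph)
      \<Rightarrow> ('v \<Rightarrow> 'v \<Rightarrow> 't) \<Rightarrow> ('t set \<Rightarrow> rp2_line) \<Rightarrow> bool" where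
  "consistent_quantization G P T lf L \<longleftrightarrow> generic_quantization G P T lf L \<and>
     (\<forall>q. simple_cycle G q \<and> set q \<noteq> pverts G \<longrightarrow>
        monodromy_cycle_condition (map P q) (cycle_framing G P T lf L q))"

end

theory Submission
  imports Defs
begin

text \<open>
  A force is identified with the normal vector of its line of force. In a weakly generic scheme the
  force at an edge is the sum of the leaf forces on one side of the edge, so that up to scaling a
  strongly generic scheme amounts to non-parallel leaf forces with sum zero. Surgeries do not change
  the leaf forces and can bring any two leaves together; hence \<open>\<ell>\<^sub>j\<^sub>i\<^sub>k\<close> is the line of force of
  \<open>F\<^sub>i\<^sub>j + F\<^sub>i\<^sub>k\<close>.

  A generic quantization therefore provides forces \<open>\<phi>\<^sub>i\<^sub>j\<close> in equilibrium at each vertex \<open>i\<close>, unique up to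
  a factor \<open>c\<^sub>i\<close>, with \<open>\<phi>\<^sub>j\<^sub>i = - g\<^sub>i\<^sub>j \<phi>\<^sub>i\<^sub>j\<close> for some gains \<open>g\<^sub>i\<^sub>j\<close>. In a suitable coordinate the monodromy of a
  framed cycle is the multiplication by the product of the gains along the cycle. The factors \<open>c\<^sub>i\<close>
  can be chosen to give a tensegrity iff the gains have product 1 along all cycles, and a Hamiltonian
  cycle is split by a chord into two cycles to which the monodromy condition applies.
\<close>

section \<open>Cuts and connectedness\<close>

text \<open>A full binary tree is handled through the two vertex sets into which each edge splits
  it, not through paths. Acyclicity means that every arc \<open>(x, y)\<close> has a cut: a set
  containing \<open>y\<close> but not \<open>x\<close> that is left only along the arc from
  \<open>y\<close> to \<open>x\<close>. In a tree the cut is unique, the force at an edge becomes a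
  sum over the leaves in a cut, and a surgery is verified by naming one set for each new edge.

  Under the identification of forces with vectors the wedge product becomes the cross product, so
  that joins, meets and lines of force are all computed by cross products.

  General position provides an auxiliary line for the monodromy of the shorter cycles. Neither it
  nor consistency says anything about Hamiltonian cycles, which is why these have to be split.
  Degree at least 3 yields the chord, and it makes a sum of two forces at a vertex a proper partial
  sum, to which non-parallelizability applies. The trees have natural numbers as vertices, since
  surgeries need an unlimited supply of new vertices.\<close>

definition cut :: "'a pair_pre_digraph \<Rightarrow> 'a \<Rightarrow> 'a \<Rightarrow> 'a set \<Rightarrow> bool" where
  "cut G x y B \<longleftrightarrow> B \<subseteq> pverts G \<and> y \<in> B \<and> x \<notin> B \<and>
     (\<forall>u v. (u, v) \<in> parcs G \<and> u \<in> B \<and> v \<notin> B \<longrightarrow> u = y \<and> v = x)"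

text \<open>Connectedness in the form of an induction principle: a property of vertices that holds
  somewhere and spreads along arcs holds everywhere.\<close>

definition closed_connected :: "'a pair_pre_digraph \<Rightarrow> bool" where
  "closed_connected G \<longleftrightarrow> pverts G \<noteq> {} \<and>
     (\<forall>B. B \<subseteq> pverts G \<and> B \<noteq> {} \<and> (\<forall>u v. (u, v) \<in> parcs G \<and> u \<in> B \<longrightarrow> v \<in> B) \<longrightarrow> B = pverts G)"

lemma pair_graph_iff:
  "pair_graph G \<longleftrightarrow> finite (pverts G) \<and> parcs G \<subseteq> pverts G \<times> pverts G \<and>
     (\<forall>x y. (x, y) \<in> parcs G \<longrightarrow> (y, x) \<in> parcs G) \<and> (\<forall>x. (x, x) \<notin> parcs G)"
proof
  assume "pair_graph G"
  then interpret pair_graph G .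
  show "finite (pverts G) \<and> parcs G \<subseteq> pverts G \<times> pverts G \<and>
     (\<forall>x y. (x, y) \<in> parcs G \<longrightarrow> (y, x) \<in> parcs G) \<and> (\<forall>x. (x, x) \<notin> parcs G)"
    using pair_finite_verts wellformed' no_loops' sym_arcs
    by (auto simp: symmetric_def sym_def) blast
next
  assume a: "finite (pverts G) \<and> parcs G \<subseteq> pverts G \<times> pverts G \<and>
     (\<forall>x y. (x, y) \<in> parcs G \<longrightarrow> (y, x) \<in> parcs G) \<and> (\<forall>x. (x, x) \<notin> parcs G)"
  hence "finite (parcs G)" by (meson finite_SigmaI finite_subset)
  thus "pair_graph G"
    using a by unfold_locales (auto simp: symmetric_def sym_def)
qed

lemma parcs_sym: "pair_graph G \<Longrightarrow> (x, y) \<in> parcs G \<longleftrightarrow> (y, x) \<in> parcs G"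
  by (auto simp: pair_graph_iff)

lemma parcs_irrefl: "pair_graph G \<Longrightarrow> (x, x) \<notin> parcs G"
  by (auto simp: pair_graph_iff)

lemma parcs_pverts: "pair_graph G \<Longrightarrow> (x, y) \<in> parcs G \<Longrightarrow> x \<in> pverts G \<and> y \<in> pverts G"
  by (auto simp: pair_graph_iff)

lemma finite_nbrs: "pair_graph G \<Longrightarrow> finite (nbrs G x)"
  by (rule finite_subset[of _ "pverts G"]) (auto simp: pair_graph_iff nbrs_def)

lemma out_degree_card_nbrs: "out_degree (with_proj G) x = card (nbrs G x)"
proof -
  have "out_arcs (with_proj G) x = Pair x ` nbrs G x"
    by (auto simp: out_arcs_def nbrs_def)
  thus ?thesis by (simp add: out_degree_def card_image inj_on_def)
qed

lemma mk_symmetric_pair_graph: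
  assumes "pair_graph G" shows "mk_symmetric (with_proj G) = G"
proof -
  have "parcs (mk_symmetric (with_proj G)) = parcs G"
    using parcs_sym[OF assms] by (auto simp: parcs_mk_symmetric)
  thus ?thesis by (intro pair_pre_digraph.equality) auto
qed

text \<open>A pair graph is its own symmetric closure, so \<open>connected\<close> means that every
  vertex reaches every other. The set of vertices reachable from a given one is closed under
  arcs.\<close>

lemma connected_iff_closed:
  assumes G: "pair_graph G"
  shows "Digraph_Component.connected (with_proj G) \<longleftrightarrow> closed_connected G"
proof -
  have "Digraph_Component.connected (with_proj G) \<longleftrightarrow> pverts G \<noteq> {} \<and>
      (\<forall>u \<in> pverts G. \<forall>v \<in> pverts G. (u, v) \<in> rtrancl_on (pverts G) (parcs G))"
    by (simp add: connected_def strongly_connected_def mk_symmetric_pair_graph[OF G] reachable_def)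
  also have "\<dots> \<longleftrightarrow> closed_connected G"
  proof (intro iffI conjI ballI)
    assume c: "pverts G \<noteq> {} \<and> (\<forall>u \<in> pverts G. \<forall>v \<in> pverts G. (u, v) \<in> rtrancl_on (pverts G) (parcs G))"
    show "closed_connected G" unfolding closed_connected_def
    proof (intro conjI allI impI)
      fix B assume B: "B \<subseteq> pverts G \<and> B \<noteq> {} \<and> (\<forall>u v. (u, v) \<in> parcs G \<and> u \<in> B \<longrightarrow> v \<in> B)"
      then obtain u where u: "u \<in> B" by blast
      have "v \<in> B" if "(u, v) \<in> rtrancl_on (pverts G) (parcs G)" for v
        using that by (induct rule: rtrancl_on_induct) (use u B in blast)+
      thus "B = pverts G" using c B u by blast
    qed (use c in auto)
  next
    assume c: "closed_connected G"
    fix u v assume u: "u \<in> pverts G" and v: "v \<in> pverts G"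
    let ?B = "{w. (u, w) \<in> rtrancl_on (pverts G) (parcs G)}"
    have "u \<in> ?B" using u by simp
    moreover have "?B \<subseteq> pverts G" by (auto dest: in_rtrancl_on_in_F)
    moreover have "w \<in> ?B" if "(w', w) \<in> parcs G" "w' \<in> ?B" for w w'
      using that parcs_pverts[OF G] by (auto intro: rtrancl_on_into_rtrancl_on)
    ultimately have "?B = pverts G" using c unfolding closed_connected_def by (metis (no_types, lifting) empty_iff)
    thus "(u, v) \<in> rtrancl_on (pverts G) (parcs G)" using v by blast
  qed (auto simp: closed_connected_def)
  finally show ?thesis .
qed

lemma distinct_path:
  assumes "(x, y) \<in> R\<^sup>*"
  obtains xs where "xs \<noteq> []" "hd xs = x" "last xs = y" "distinct xs" "successively (\<lambda>a b. (a, b) \<in> R) xs"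
proof -
  from assms have "\<exists>xs. xs \<noteq> [] \<and> hd xs = x \<and> last xs = y \<and> distinct xs \<and> successively (\<lambda>a b. (a, b) \<in> R) xs"
  proof induct
    case base
    show ?case by (rule exI[of _ "[x]"]) auto
  next
    case (step y z)
    then obtain xs where xs: "xs \<noteq> []" "hd xs = x" "last xs = y" "distinct xs"
      "successively (\<lambda>a b. (a, b) \<in> R) xs" by blast
    show ?case
    proof (cases "z \<in> set xs")
      case False
      have "successively (\<lambda>a b. (a, b) \<in> R) (xs @ [z])"
        using xs step by (auto simp: successively_append_iff)
      thus ?thesis using xs False by (intro exI[of _ "xs @ [z]"]) auto
    next
      \<comment> \<open>The extended path returns to \<open>z\<close>: keep only the initial segment
        that ends at the earlier visit.\<close>
      case True
      then obtain ys zs where s: "xs = ys @ z # zs" by (auto simp: in_set_conv_decomp)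
      have "successively (\<lambda>a b. (a, b) \<in> R) (ys @ [z])"
        using xs(5) unfolding s by (auto simp: successively_append_iff)
      thus ?thesis using xs s by (intro exI[of _ "ys @ [z]"]) (auto simp: hd_append)
    qed
  qed
  thus ?thesis using that by blast
qed

text \<open>Delete the edge and let \<open>B\<close> consist of the vertices still reachable from
  \<open>y\<close>. A path from \<open>y\<close> to \<open>x\<close> that avoids the edge would
  close up with it to a simple cycle.\<close>

lemma acyclic_cut:
  assumes G: "pair_graph G" and ac: "\<nexists>q. simple_cycle G q" and xy: "(x, y) \<in> parcs G"
  obtains B where "cut G x y B"
proof -
  define R where "R = parcs G - {(x, y), (y, x)}"
  define B where "B = {v \<in> pverts G. (y, v) \<in> R\<^sup>*}"
  have "x \<notin> B"
  proof
    assume "x \<in> B"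
    then obtain xs where xs: "xs \<noteq> []" "hd xs = y" "last xs = x" "distinct xs"
      "successively (\<lambda>a b. (a, b) \<in> R) xs"
      using distinct_path[of y x R] unfolding B_def by auto
    have ne: "x \<noteq> y" using xy parcs_irrefl[OF G] by auto
    \<comment> \<open>With one or two vertices the path would give \<open>x = y\<close> or use the
      deleted arc.\<close>
    have len: "3 \<le> length xs"
    proof (rule ccontr)
      assume "\<not> 3 \<le> length xs"
      then consider a where "xs = [a]" | a b where "xs = [a, b]"
        using xs(1) by (cases xs; cases "tl xs"; cases "tl (tl xs)") auto
      thus False using xs ne by cases (auto simp: R_def)
    qed
    have "(xs ! r, xs ! (Suc r mod length xs)) \<in> parcs G" if r: "r < length xs" for r
    proof (cases "Suc r < length xs")
      case True
      thus ?thesis using xs(5) unfolding successively_conv_nth by (auto simp: R_def)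
    next
      case False
      hence "Suc r = length xs" using r by simp
      moreover from this have "xs ! r = x" using xs by (metis last_conv_nth diff_Suc_1)
      ultimately show ?thesis using xs xy by (simp add: hd_conv_nth)
    qed
    thus False using ac len xs(4) unfolding simple_cycle_def by blast
  qed
  moreover have "y \<in> B" using xy parcs_pverts[OF G] by (auto simp: B_def)
  moreover have "u = y \<and> v = x" if "(u, v) \<in> parcs G" "u \<in> B" "v \<notin> B" for u v
  proof -
    have "(u, v) \<notin> R"
      using that parcs_pverts[OF G] unfolding B_def by (auto intro: rtrancl_into_rtrancl)
    thus ?thesis using that \<open>x \<notin> B\<close> unfolding R_def by auto
  qed
  ultimately have "cut G x y B" unfolding cut_def B_def by auto
  thus ?thesis by (rule that)
qed

text \<open>A cycle that enters \<open>B\<close> along its first arc can return to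
  \<open>q ! 0\<close> only from \<open>q ! 1\<close>. But it returns from its last vertex, which
  differs from \<open>q ! 1\<close> because the length is at least 3.\<close>

lemma cut_acyclic:
  assumes cuts: "\<And>x y. (x, y) \<in> parcs G \<Longrightarrow> \<exists>B. cut G x y B" and q: "simple_cycle G q"
  shows False
proof -
  have len: "3 \<le> length q" and d: "distinct q"
    and arc: "\<And>r. r < length q \<Longrightarrow> (q ! r, q ! (Suc r mod length q)) \<in> parcs G"
    using q by (auto simp: simple_cycle_def)
  have "(q ! 0, q ! 1) \<in> parcs G"
    using arc[of 0] len by (cases "length q") auto
  then obtain B where B: "cut G (q ! 0) (q ! 1) B" using cuts by blast
  have "q ! r \<in> B" if "1 \<le> r" "r < length q" for r
    using that
  proof (induct r rule: dec_induct)
    case base show ?case using B by (simp add: cut_def)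
  next
    case (step r)
    have "(q ! r, q ! Suc r) \<in> parcs G" using arc[of r] step by simp
    moreover have "q ! Suc r \<noteq> q ! 0"
      using d step len nth_eq_iff_index_eq[OF d, of "Suc r" 0] by linarith
    ultimately show ?case using B step unfolding cut_def by (metis Suc_lessD)
  qed
  hence "q ! (length q - 1) \<in> B" using len by simp
  moreover have "(q ! (length q - 1), q ! 0) \<in> parcs G"
    using arc[of "length q - 1"] len by (cases "length q") auto
  moreover have "q ! 0 \<notin> B" using B by (simp add: cut_def)
  ultimately have "q ! (length q - 1) = q ! 1" using B unfolding cut_def by blast
  thus False using d len by (simp add: nth_eq_iff_index_eq)
qed

lemma full_binary_tree_iff:
  "full_binary_tree T \<longleftrightarrow> pair_graph T \<and> closed_connected T \<and>
     (\<forall>x y. (x, y) \<in> parcs T \<longrightarrow> (\<exists>B. cut T x y B)) \<and> (\<forall>x \<in> pverts T. card (nbrs T x) \<in> {1, 3})"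
  unfolding full_binary_tree_def out_degree_card_nbrs
  using connected_iff_closed acyclic_cut cut_acyclic by metis


lemma cut_compl:
  assumes "pair_graph G" "(x, y) \<in> parcs G" "cut G x y B" shows "cut G y x (pverts G - B)"
  unfolding cut_def
proof (intro conjI allI impI)
  show "x \<in> pverts G - B" "y \<notin> pverts G - B"
    using assms parcs_pverts[OF assms(1,2)] by (auto simp: cut_def)
  fix u v assume a: "(u, v) \<in> parcs G \<and> u \<in> pverts G - B \<and> v \<notin> pverts G - B"
  hence "(v, u) \<in> parcs G \<and> v \<in> B \<and> u \<notin> B"
    using parcs_sym[OF assms(1), of u v] parcs_pverts[OF assms(1), of u v] by auto
  thus "u = x" "v = y" using assms(3) unfolding cut_def by auto
qed auto

lemma closed_connectedD:
  assumes "closed_connected G" "B \<subseteq> pverts G" "b \<in> B"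
    and "\<And>u v. (u, v) \<in> parcs G \<Longrightarrow> u \<in> B \<Longrightarrow> v \<in> B"
  shows "B = pverts G"
  using assms unfolding closed_connected_def by blast

section \<open>Full binary trees\<close>

locale binary_tree =
  fixes T :: "'t pair_pre_digraph"
  assumes full_binary_tree: "full_binary_tree T"
begin

lemma pair_graph_T: "pair_graph T" and closed_connected_T: "closed_connected T"
  and ex_cut: "(x, y) \<in> parcs T \<Longrightarrow> \<exists>B. cut T x y B"
  and card_nbrs: "x \<in> pverts T \<Longrightarrow> card (nbrs T x) \<in> {1, 3}"
  using full_binary_tree by (auto simp: full_binary_tree_iff)

lemmas arc_sym = parcs_sym[OF pair_graph_T]
lemmas arc_irrefl = parcs_irrefl[OF pair_graph_T]
lemmas arc_pverts = parcs_pverts[OF pair_graph_T]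
lemmas finite_nbrs_T [simp] = finite_nbrs[OF pair_graph_T]

lemma finite_pverts [simp]: "finite (pverts T)"
  using pair_graph_T by (simp add: pair_graph_iff)

lemma leaf_verts_iff: "l \<in> leaf_verts T \<longleftrightarrow> l \<in> pverts T \<and> card (nbrs T l) = 1"
  and inner_verts_iff: "l \<in> inner_verts T \<longleftrightarrow> l \<in> pverts T \<and> card (nbrs T l) = 3"
  by (auto simp: leaf_verts_def inner_verts_def out_degree_card_nbrs)

lemma leaf_verts_subset: "leaf_verts T \<subseteq> pverts T"
  by (auto simp: leaf_verts_iff)

lemma finite_leaf_verts [simp]: "finite (leaf_verts T)"
  using leaf_verts_subset finite_pverts finite_subset by blast

lemma inner_verts_eq: "inner_verts T = pverts T - leaf_verts T"
proof (rule set_eqI)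
  fix x show "x \<in> inner_verts T \<longleftrightarrow> x \<in> pverts T - leaf_verts T"
    using card_nbrs[of x] by (auto simp: leaf_verts_iff inner_verts_iff)
qed

lemma nbrs_leaf:
  assumes "l \<in> leaf_verts T" shows "nbrs T l = {stem T l}"
proof -
  obtain y where y: "nbrs T l = {y}" using assms by (auto simp: leaf_verts_iff card_1_singleton_iff)
  hence "stem T l = y" unfolding stem_def nbrs_def by auto
  thus ?thesis using y by simp
qed

lemma leaf_arc: "l \<in> leaf_verts T \<Longrightarrow> (l, v) \<in> parcs T \<Longrightarrow> v = stem T l"
  using nbrs_leaf unfolding nbrs_def by blast

lemma stem_arc: "l \<in> leaf_verts T \<Longrightarrow> (l, stem T l) \<in> parcs T"
  using nbrs_leaf by (auto simp: nbrs_def)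

text \<open>The difference of two cuts is closed under arcs: an arc out of \<open>B\<close> starts
  at \<open>y\<close>, which lies in \<open>C\<close>, and an arc into \<open>C\<close> starts at
  \<open>x\<close>, which does not lie in \<open>B\<close>. As the difference misses
  \<open>y\<close>, connectedness makes it empty.\<close>

lemma cut_unique:
  assumes "(x, y) \<in> parcs T" "cut T x y B" "cut T x y C"
  shows "B = C"
proof -
  have "B \<subseteq> C" if B: "cut T x y B" and C: "cut T x y C" for B C
  proof (rule ccontr)
    assume "\<not> B \<subseteq> C"
    then obtain b where b: "b \<in> B - C" by blast
    have "v \<in> B - C" if "(u, v) \<in> parcs T" "u \<in> B - C" for u v
      using that B C arc_sym[of u v] unfolding cut_def by blast
    hence "B - C = pverts T"

      using B by (intro closed_connectedD[OF closed_connected_T _ b]) (auto simp: cut_def)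
    thus False using B C unfolding cut_def by blast
  qed
  thus ?thesis using assms by blast
qed

text \<open>The component of \<open>y\<close> after deletion of the edge. By
  \<open>cut_unique\<close> the choice is determined whenever \<open>(x, y)\<close> is an
  arc.\<close>

definition side :: "'t \<Rightarrow> 't \<Rightarrow> 't set" where
  "side x y = (SOME B. cut T x y B)"

lemma cut_side: "(x, y) \<in> parcs T \<Longrightarrow> cut T x y (side x y)"
  unfolding side_def using ex_cut by (rule someI_ex)

lemma side_eq: "(x, y) \<in> parcs T \<Longrightarrow> cut T x y B \<Longrightarrow> side x y = B"
  using cut_side cut_unique by blast

lemma side_compl: "(x, y) \<in> parcs T \<Longrightarrow> side y x = pverts T - side x y"
  by (intro side_eq cut_compl[OF pair_graph_T] cut_side) (simp_all add: arc_sym)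

lemma
  assumes "(x, y) \<in> parcs T"
  shows side_subset: "side x y \<subseteq> pverts T" and side_mem: "y \<in> side x y" and side_not_mem: "x \<notin> side x y"
    and side_arc: "(u, v) \<in> parcs T \<Longrightarrow> u \<in> side x y \<Longrightarrow> v \<notin> side x y \<Longrightarrow> u = y \<and> v = x"
  using cut_side[OF assms] unfolding cut_def by blast+

lemma side_leaf:
  assumes "l \<in> leaf_verts T" shows "side (stem T l) l = {l}"
proof -
  have a: "(l, stem T l) \<in> parcs T" by (rule stem_arc[OF assms])
  hence b: "(stem T l, l) \<in> parcs T" by (subst arc_sym)
  have c: "v = stem T l" if "(l, v) \<in> parcs T" for v
    using that nbrs_leaf[OF assms] unfolding nbrs_def by blast
  have "stem T l \<noteq> l" using a arc_irrefl by metis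
  hence "cut T (stem T l) l {l}"
    unfolding cut_def using arc_pverts[OF a] c by blast
  thus ?thesis by (rule side_eq[OF b])
qed

text \<open>An arc out of \<open>side x y\<close> runs from \<open>y\<close> to \<open>x\<close>,
  and \<open>y\<close> is not in \<open>side x z\<close>, since otherwise the same arc would leave
  that side at a vertex other than \<open>z\<close>. By symmetry the intersection is closed under
  arcs, but it misses \<open>x\<close>.\<close>

lemma side_disjoint:
  assumes xy: "(x, y) \<in> parcs T" and xz: "(x, z) \<in> parcs T" and "y \<noteq> z"
  shows "side x y \<inter> side x z = {}"
proof (rule ccontr)
  assume "side x y \<inter> side x z \<noteq> {}"
  then obtain b where b: "b \<in> side x y \<inter> side x z" by blast
  have n: "y \<notin> side x z" "z \<notin> side x y"
    using side_arc[OF xz, of y x] side_arc[OF xy, of z x] side_not_mem assms arc_sym by blast+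
  have "side x y \<inter> side x z = pverts T"
  proof (rule closed_connectedD[OF closed_connected_T _ b])
    fix u v assume uv: "(u, v) \<in> parcs T" and "u \<in> side x y \<inter> side x z"
    thus "v \<in> side x y \<inter> side x z" using side_arc[OF xy uv] side_arc[OF xz uv] n by blast
  qed (use side_subset[OF xy] in blast)
  thus False using side_not_mem[OF xy] arc_pverts[OF xy] by blast
qed

text \<open>Connectedness: an arc that leaves one of the sides leads back to \<open>x\<close>, and
  an arc from \<open>x\<close> leads into a side.\<close>

lemma side_cover:
  assumes "x \<in> pverts T" shows "insert x (\<Union>y \<in> nbrs T x. side x y) = pverts T"
proof (rule closed_connectedD[OF closed_connected_T])
  show "insert x (\<Union>y \<in> nbrs T x. side x y) \<subseteq> pverts T"
    using assms side_subset by (auto simp: nbrs_def)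
  show "x \<in> insert x (\<Union>y \<in> nbrs T x. side x y)" by simp
  fix u v assume uv: "(u, v) \<in> parcs T" and u: "u \<in> insert x (\<Union>y \<in> nbrs T x. side x y)"
  show "v \<in> insert x (\<Union>y \<in> nbrs T x. side x y)"
  proof (cases "u = x")
    case True
    thus ?thesis using uv side_mem[OF uv] by (auto simp: nbrs_def)
  next
    case False
    then obtain y where y: "(x, y) \<in> parcs T" "u \<in> side x y" using u by (auto simp: nbrs_def)
    thus ?thesis using side_arc[OF y(1) uv y(2)] by (auto simp: nbrs_def)
  qed
qed

text \<open>Walk away from \<open>x\<close>: as long as \<open>y\<close> is not a leaf, it has a
  neighbour \<open>z\<close> other than \<open>x\<close>, and \<open>side y z\<close> is smaller
  than \<open>side x y\<close>. So a sum of leaf forces over a side is never empty.\<close>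

lemma side_contains_leaf:
  assumes "(x, y) \<in> parcs T" shows "side x y \<inter> leaf_verts T \<noteq> {}"
  using assms
proof (induct "card (side x y)" arbitrary: x y rule: less_induct)
  case less
  have yV: "y \<in> pverts T" using less arc_pverts by blast
  show ?case
  proof (cases "y \<in> leaf_verts T")
    case True
    thus ?thesis using side_mem[OF less.prems] by blast
  next
    case False
    hence "card (nbrs T y) = 3" using yV card_nbrs leaf_verts_iff by auto
    hence "card (nbrs T y - {x}) \<noteq> 0" by (simp add: card_Diff_singleton_if)
    then obtain z where z: "(y, z) \<in> parcs T" "z \<noteq> x" by (auto simp: nbrs_def card_eq_0_iff)
    have yx: "(y, x) \<in> parcs T" using less arc_sym by blast
    \<comment> \<open>\<open>side y z\<close> is disjoint from \<open>side y x\<close>, which is the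
      complement of \<open>side x y\<close>.\<close>
    have "side y z \<subseteq> side x y"
      using side_disjoint[OF yx z(1)] z(2) side_compl[OF less.prems] side_subset[OF z(1)] by blast
    moreover have "y \<in> side x y - side y z" using side_mem[OF less.prems] side_not_mem[OF z(1)] by blast
    ultimately have "side y z \<subset> side x y" by blast
    hence "card (side y z) < card (side x y)"

      by (rule psubset_card_mono[OF finite_subset[OF side_subset[OF less.prems] finite_pverts]])
    thus ?thesis using less.hyps[OF _ z(1)] \<open>side y z \<subset> side x y\<close> by blast
  qed
qed

lemma third_nbr:
  assumes "(x, y) \<in> parcs T" "(x, z) \<in> parcs T" "y \<noteq> z"
  obtains u where "distinct [y, z, u]" "nbrs T x = {y, z, u}"
proof -
  have x: "x \<in> pverts T" using arc_pverts[OF assms(1)] by blast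
  have yz: "{y, z} \<subseteq> nbrs T x" using assms by (auto simp: nbrs_def)
  hence "card (nbrs T x) \<noteq> 1" using assms(3) by (auto simp: card_1_singleton_iff)
  hence c3: "card (nbrs T x) = 3" using card_nbrs[OF x] by auto
  hence "card (nbrs T x - {y, z}) = 1" using yz assms(3) by (simp add: card_Diff_subset)
  then obtain u where u: "nbrs T x - {y, z} = {u}" by (auto simp: card_1_singleton_iff)
  have "nbrs T x = {y, z, u}" using u yz by blast
  moreover have "distinct [y, z, u]" using u assms(3) by auto
  ultimately show ?thesis using that by blast
qed

text \<open>Two adjacent leaf vertices have no other neighbours, so they would be the whole
  tree.\<close>

lemma leaf_not_adjacent:
  assumes "3 \<le> card (leaf_verts T)" "a \<in> leaf_verts T" "b \<in> leaf_verts T"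
  shows "(a, b) \<notin> parcs T"
proof
  assume ab: "(a, b) \<in> parcs T"
  have ba: "(b, a) \<in> parcs T" using ab by (subst arc_sym)
  have "v = b" if "(a, v) \<in> parcs T" for v using leaf_arc[OF assms(2)] that ab by metis
  moreover have "v = a" if "(b, v) \<in> parcs T" for v using leaf_arc[OF assms(3)] that ba by metis
  ultimately have "{a, b} = pverts T"
    using arc_pverts[OF ab] by (intro closed_connectedD[OF closed_connected_T, of _ a]) auto
  hence "card (leaf_verts T) \<le> card {a, b}" using leaf_verts_subset by (intro card_mono) auto
  also have "\<dots> \<le> 2" by (simp add: card_insert_if)
  finally show False using assms(1) by simp
qed

section \<open>Conservation of flow on a tree\<close>

lemma sum_internal_arcs:
  fixes F :: "'t \<Rightarrow> 't \<Rightarrow> 'c::real_vector"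
  assumes "finite B" and anti: "\<And>u v. (u, v) \<in> parcs T \<Longrightarrow> F u v = - F v u"
  shows "(\<Sum>u\<in>B. \<Sum>v\<in>nbrs T u \<inter> B. F u v) = 0" (is "?S = 0")
proof -
  define A where "A = (SIGMA u:B. nbrs T u \<inter> B)"
  have S: "?S = (\<Sum>(u, v)\<in>A. F u v)"
    unfolding A_def by (rule sum.Sigma) (use assms(1) in auto)
  \<comment> \<open>The set of arcs within \<open>B\<close> is symmetric, and reversing all of them
    changes the sign of the sum.\<close>
  have A: "prod.swap ` A = A"
    using arc_sym by (force simp: A_def nbrs_def image_iff)
  have "?S = (\<Sum>p\<in>prod.swap ` A. case p of (u, v) \<Rightarrow> F u v)" using S A by simp
  also have "\<dots> = (\<Sum>(u, v)\<in>A. F v u)"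
    by (subst sum.reindex) (auto simp: inj_on_def intro!: sum.cong)
  also have "\<dots> = (\<Sum>(u, v)\<in>A. - F u v)"
    by (rule sum.cong) (auto simp: A_def nbrs_def arc_sym dest: anti)
  also have "\<dots> = - ?S" unfolding S by (simp add: sum_negf case_prod_unfold)
  finally have "2 *\<^sub>R ?S = 0" by (simp add: scaleR_2 eq_neg_iff_add_eq_0)
  thus ?thesis by simp
qed

text \<open>A discrete divergence theorem: add up the outgoing flow over all vertices of
  \<open>B\<close>. Arcs inside \<open>B\<close> cancel in pairs and inner vertices are in
  equilibrium, so what crosses the boundary comes from the leaves alone.\<close>

lemma sum_boundary:
  fixes F :: "'t \<Rightarrow> 't \<Rightarrow> 'c::real_vector"
  assumes B: "B \<subseteq> pverts T" and anti: "\<And>u v. (u, v) \<in> parcs T \<Longrightarrow> F u v = - F v u"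
    and eq: "\<And>x. x \<in> inner_verts T \<Longrightarrow> (\<Sum>y\<in>nbrs T x. F x y) = 0"
  shows "(\<Sum>u\<in>B. \<Sum>v\<in>nbrs T u - B. F u v) = (\<Sum>l\<in>B \<inter> leaf_verts T. F l (stem T l))"
proof -
  have f: "finite B" using B finite_pverts finite_subset by blast
  have "(\<Sum>u\<in>B. \<Sum>v\<in>nbrs T u. F u v)
      = (\<Sum>u\<in>B. \<Sum>v\<in>nbrs T u \<inter> B. F u v) + (\<Sum>u\<in>B. \<Sum>v\<in>nbrs T u - B. F u v)"
    by (simp flip: sum.distrib add: sum.Int_Diff[of "nbrs T _" _ B])
  also have "\<dots> = (\<Sum>u\<in>B. \<Sum>v\<in>nbrs T u - B. F u v)"
    using sum_internal_arcs[OF f, of F] anti by simp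
  finally have "(\<Sum>u\<in>B. \<Sum>v\<in>nbrs T u - B. F u v) = (\<Sum>u\<in>B. \<Sum>v\<in>nbrs T u. F u v)" by simp
  also have "\<dots> = (\<Sum>u\<in>B \<inter> leaf_verts T. \<Sum>v\<in>nbrs T u. F u v)"
    using B eq by (intro sum.mono_neutral_right) (auto simp: f inner_verts_eq)
  also have "\<dots> = (\<Sum>l\<in>B \<inter> leaf_verts T. F l (stem T l))"
    by (rule sum.cong) (auto simp: nbrs_leaf)
  finally show ?thesis .
qed

text \<open>Take \<open>B = side x y\<close>, whose only boundary arc runs from \<open>y\<close> to
  \<open>x\<close>. An equilibrium load is thus determined by its leaf forces, and each edge force
  is one of the partial sums that conditions (1) and (2) speak about.\<close>

lemma flow:
  fixes F :: "'t \<Rightarrow> 't \<Rightarrow> 'c::real_vector"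
  assumes xy: "(x, y) \<in> parcs T" and anti: "\<And>u v. (u, v) \<in> parcs T \<Longrightarrow> F u v = - F v u"
    and eq: "\<And>x. x \<in> inner_verts T \<Longrightarrow> (\<Sum>y\<in>nbrs T x. F x y) = 0"
  shows "F x y = (\<Sum>l\<in>side x y \<inter> leaf_verts T. F (stem T l) l)"
proof -
  have nb: "nbrs T u - side x y = (if u = y then {x} else {})" if "u \<in> side x y" for u
    using that side_arc[OF xy] side_not_mem[OF xy] side_mem[OF xy] xy arc_sym by (auto simp: nbrs_def)
  have fin: "finite (side x y)" using side_subset[OF xy] finite_pverts finite_subset by blast
  have "(\<Sum>u\<in>side x y. \<Sum>v\<in>nbrs T u - side x y. F u v) = (\<Sum>u\<in>side x y. if u = y then F y x else 0)"
    by (rule sum.cong) (auto simp: nb)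
  also have "\<dots> = F y x" using fin side_mem[OF xy] by simp
  finally have "F y x = (\<Sum>l\<in>side x y \<inter> leaf_verts T. F l (stem T l))"
    using sum_boundary[OF side_subset[OF xy] anti eq] by simp
  also have "\<dots> = (\<Sum>l\<in>side x y \<inter> leaf_verts T. - F (stem T l) l)"
    by (rule sum.cong) (auto dest: stem_arc anti)
  finally show ?thesis using anti[OF xy] by (simp add: sum_negf)
qed

lemma sum_leaf_flow:
  fixes F :: "'t \<Rightarrow> 't \<Rightarrow> 'c::real_vector"
  assumes anti: "\<And>u v. (u, v) \<in> parcs T \<Longrightarrow> F u v = - F v u"
    and eq: "\<And>x. x \<in> inner_verts T \<Longrightarrow> (\<Sum>y\<in>nbrs T x. F x y) = 0"
  shows "(\<Sum>l\<in>leaf_verts T. F (stem T l) l) = 0"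
proof -
  have "(\<Sum>u\<in>pverts T. \<Sum>v\<in>nbrs T u - pverts T. F u v) = 0"
    by (intro sum.neutral ballI) (auto simp: nbrs_def dest: arc_pverts)
  hence "(\<Sum>l\<in>leaf_verts T. F l (stem T l)) = 0"
    using sum_boundary[OF subset_refl anti eq] leaf_verts_subset by (simp add: Int_absorb1)
  moreover have "(\<Sum>l\<in>leaf_verts T. F (stem T l) l) = (\<Sum>l\<in>leaf_verts T. - F l (stem T l))"
    using stem_arc arc_sym anti by (intro sum.cong) blast+
  ultimately show ?thesis by (simp add: sum_negf)
qed

end

section \<open>Gains along walks\<close>

fun walk_gain :: "('v \<Rightarrow> 'v \<Rightarrow> real) \<Rightarrow> 'v list \<Rightarrow> real" where
  "walk_gain g (x # y # xs) = g x y * walk_gain g (y # xs)"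
| "walk_gain g xs = 1"

lemma walk_gain_append: "walk_gain g (xs @ y # zs) = walk_gain g (xs @ [y]) * walk_gain g (y # zs)"
proof (induct xs)
  case (Cons x xs)
  show ?case
  proof (cases xs)
    case (Cons x' xs')
    show ?thesis using Cons.hyps Cons by simp
  qed simp
qed simp

lemma walk_gain_prod: "walk_gain g xs = (\<Prod>r<length xs - 1. g (xs ! r) (xs ! Suc r))"
proof (induct xs rule: induct_list012)
  case (3 x y zs)
  thus ?case by (simp add: prod.lessThan_Suc_shift del: prod.lessThan_Suc)
qed simp_all

lemma walk_gain_cycle:
  assumes "q \<noteq> []"
  shows "walk_gain g (q @ [hd q]) = (\<Prod>r<length q. g (q ! r) (q ! (Suc r mod length q)))"
  unfolding walk_gain_prod
proof (rule prod.cong)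
  fix r assume r: "r \<in> {..<length q}"
  show "g ((q @ [hd q]) ! r) ((q @ [hd q]) ! Suc r) = g (q ! r) (q ! (Suc r mod length q))"
    using r assms by (cases "Suc r = length q") (auto simp: nth_append hd_conv_nth)
qed simp

lemma successively_split:
  "successively P (xs @ y # zs) \<longleftrightarrow> successively P (xs @ [y]) \<and> successively P (y # zs)"
  by (auto simp: successively_append_iff)

lemma simple_cycle_iff:
  "simple_cycle G q \<longleftrightarrow> 3 \<le> length q \<and> distinct q \<and> successively (\<lambda>x y. (x, y) \<in> parcs G) (q @ [hd q])"
proof (cases "q = []")
  case False
  have "((q @ [hd q]) ! r, (q @ [hd q]) ! Suc r) = (q ! r, q ! (Suc r mod length q))" if "r < length q" for r
    using that False by (cases "Suc r = length q") (auto simp: nth_append hd_conv_nth)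
  thus ?thesis unfolding simple_cycle_def successively_conv_nth by auto
qed (simp add: simple_cycle_def)

locale gain_graph =
  fixes G :: "'v pair_pre_digraph" and g :: "'v \<Rightarrow> 'v \<Rightarrow> real"
  assumes pair_graph_G: "pair_graph G"
    and gain_inverse: "(i, j) \<in> parcs G \<Longrightarrow> g i j * g j i = 1"
begin

abbreviation walk :: "'v list \<Rightarrow> bool" where
  "walk \<equiv> successively (\<lambda>x y. (x, y) \<in> parcs G)"

text \<open>A Hamiltonian cycle has a chord, which splits it into two shorter cycles.\<close>

lemma cycle_gain:
  assumes deg: "\<And>i. i \<in> pverts G \<Longrightarrow> 3 \<le> card (nbrs G i)"
    and short: "\<And>q. simple_cycle G q \<Longrightarrow> set q \<noteq> pverts G \<Longrightarrow> walk_gain g (q @ [hd q]) = 1"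
    and q: "simple_cycle G q"
  shows "walk_gain g (q @ [hd q]) = 1"
proof (cases "set q = pverts G")
  case True
  obtain x q' where xq: "q = x # q'" using q by (cases q) (auto simp: simple_cycle_iff)
  have q'0: "q' \<noteq> []" using q xq by (auto simp: simple_cycle_iff)
  have "x \<in> pverts G" using True xq by auto
  \<comment> \<open>At most two neighbours of \<open>x\<close> are next to it on the cycle, so a
    third one is the end of a chord.\<close>
  hence "\<not> nbrs G x \<subseteq> {hd q', last q'}"
    using deg[of x] card_mono[of "{hd q', last q'}" "nbrs G x"] card_insert_le_m1[of 2 "{last q'}" "hd q'"] by auto
  then obtain y where y: "(x, y) \<in> parcs G" "y \<noteq> hd q'" "y \<noteq> last q'" by (auto simp: nbrs_def)
  have "y \<in> set q" using True parcs_pverts[OF pair_graph_G y(1)] by simp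
  moreover have "y \<noteq> x" using y(1) parcs_irrefl[OF pair_graph_G] by metis
  ultimately have "y \<in> set q'" using xq by simp
  then obtain as bs where s: "q' = as @ y # bs" by (auto simp: in_set_conv_decomp)
  have as: "as \<noteq> []" and bs: "bs \<noteq> []" using y s by auto
  have yx: "(y, x) \<in> parcs G" using y(1) parcs_sym[OF pair_graph_G] by blast
  have w: "walk (x # as @ y # bs @ [x])" and d: "distinct (x # as @ y # bs)"
    using q unfolding simple_cycle_iff xq s by auto
  have w2: "walk ((x # as) @ [y])" "walk (y # bs @ [x])"
    using w successively_split[of _ "x # as" y "bs @ [x]"] by auto
  have "walk ((x # as) @ y # [x])" using w2(1) yx successively_split[of _ "x # as" y "[x]"] by simp
  hence w3: "walk ((x # as @ [y]) @ [x])" by simp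
  have "simple_cycle G (x # as @ [y])"
    using w3 d as unfolding simple_cycle_iff by (cases as) auto
  \<comment> \<open>Each of the two shorter cycles omits a vertex of the other part, so the
    hypothesis on cycles that miss a vertex applies to it.\<close>
  moreover have "last bs \<notin> set (x # as @ [y])" using d bs by (metis Un_iff disjoint_iff distinct.simps(2) distinct_append last_in_set list.set_intros(1,2) set_append set_ConsD append_Cons append.assoc append_Nil)
  hence "set (x # as @ [y]) \<noteq> pverts G" using True bs unfolding xq s by (metis last_in_set list.set_intros(2) Un_iff set_append)
  ultimately have A: "walk_gain g ((x # as @ [y]) @ [x]) = 1" using short by fastforce
  have "simple_cycle G (x # y # bs)"
    using w2(2) d bs y(1) unfolding simple_cycle_iff by (cases bs) auto
  moreover have "hd as \<notin> set (x # y # bs)" using d as by (cases as) auto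
  hence "set (x # y # bs) \<noteq> pverts G" using True as unfolding xq s by (metis hd_in_set list.set_intros(2) Un_iff set_append)
  ultimately have B: "walk_gain g ((x # y # bs) @ [x]) = 1" using short by fastforce
  have "walk_gain g (q @ [hd q]) = walk_gain g ((x # as) @ y # (bs @ [x]))" by (simp add: xq s)
  also have "\<dots> = walk_gain g (x # as @ [y]) * walk_gain g (y # bs @ [x])"
    using walk_gain_append[of g "x # as" y "bs @ [x]"] by simp
  finally have C: "walk_gain g (q @ [hd q]) = walk_gain g (x # as @ [y]) * walk_gain g (y # bs @ [x])" .
  have A': "walk_gain g (x # as @ [y]) * g y x = 1"
    using A walk_gain_append[of g "x # as" y "[x]"] by simp
  have B': "g x y * walk_gain g (y # bs @ [x]) = 1" using B by simp
  \<comment> \<open>The two shorter cycles traverse the chord in opposite directions, so its two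
    gains cancel.\<close>
  have "walk_gain g (q @ [hd q]) = walk_gain g (x # as @ [y]) * walk_gain g (y # bs @ [x]) * (g x y * g y x)"
    using C gain_inverse[OF y(1)] by simp
  also have "\<dots> = (walk_gain g (x # as @ [y]) * g y x) * (g x y * walk_gain g (y # bs @ [x]))" by (simp only: mult_ac)
  also have "\<dots> = 1" unfolding A' B' by simp
  finally show ?thesis .
qed (use short q in blast)

text \<open>Induction on the length: a repeated vertex splits a closed walk into two shorter ones
  whose gains multiply to the gain of the whole. Without repetition the walk is a simple cycle or
  degenerate.\<close>

lemma closed_walk_gain:
  assumes cyc: "\<And>q. simple_cycle G q \<Longrightarrow> walk_gain g (q @ [hd q]) = 1"
    and "walk xs" "xs \<noteq> []" "hd xs = last xs"
  shows "walk_gain g xs = 1"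
  using assms(2-)
proof (induct "length xs" arbitrary: xs rule: less_induct)
  case less
  define ys where "ys = butlast xs"
  have xs: "xs = ys @ [last xs]" using less.prems by (simp add: ys_def)
  show ?case
  proof (cases "ys = []")
    case True
    hence "xs = [last xs]" using xs by simp
    thus ?thesis by (metis walk_gain.simps(3))
  next
    case False
    hence "hd ys = hd xs" by (metis xs hd_append2)
    hence xs': "xs = ys @ [hd ys]" using xs less.prems(3) by simp
    show ?thesis
    proof (cases "distinct ys")
      case True
      \<comment> \<open>The degenerate cases: one vertex would require a loop, and two vertices give
        an edge traversed forth and back, whose gain is 1 by \<open>gain_inverse\<close>.\<close>
      consider x where "ys = [x]" | x y where "ys = [x, y]" | "3 \<le> length ys"
        using False by (cases ys; cases "tl ys"; cases "tl (tl ys)") auto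
      thus ?thesis
      proof cases
        case 1
        hence "(x, x) \<in> parcs G" using less.prems(1) xs' by simp
        thus ?thesis using parcs_irrefl[OF pair_graph_G] by blast
      next
        case 2
        thus ?thesis using less.prems(1) xs' gain_inverse[of x y] by simp
      next
        case 3
        hence "simple_cycle G ys" using True less.prems(1) xs' unfolding simple_cycle_iff by simp
        thus ?thesis using cyc xs' by metis
      qed
    next
      case nd: False
      obtain as bs cs y where s: "ys = as @ [y] @ bs @ [y] @ cs" using not_distinct_decomp[OF nd] by blast
      define x where "x = hd ys"
      have w: "walk (as @ y # bs @ y # cs @ [x])" using less.prems(1) xs' s by (simp add: x_def)
      have x: "hd (as @ [y]) = x" unfolding x_def s by (cases as) auto
      have len: "length (y # bs @ [y]) < length xs" "length (as @ y # cs @ [x]) < length xs"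
        unfolding xs' s by auto
      have "walk (y # bs @ [y])" "walk (as @ y # cs @ [x])"
        using w successively_split[of _ as y "bs @ y # cs @ [x]"] successively_split[of _ "y # bs" y "cs @ [x]"]
          successively_split[of _ as y "cs @ [x]"] by auto
      hence "walk_gain g (y # bs @ [y]) = 1" "walk_gain g (as @ y # cs @ [x]) = 1"
        using less.hyps[OF len(1)] less.hyps[OF len(2)] x by (auto simp: hd_append split: if_splits)
      moreover have "walk_gain g xs = walk_gain g (as @ [y]) * (walk_gain g (y # bs @ [y]) * walk_gain g (y # cs @ [x]))"
        using walk_gain_append[of g as y "bs @ y # cs @ [x]"] walk_gain_append[of g "y # bs" y "cs @ [x]"]
        by (simp add: xs' s x_def)
      moreover have "walk_gain g (as @ y # cs @ [x]) = walk_gain g (as @ [y]) * walk_gain g (y # cs @ [x])"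
        by (rule walk_gain_append)
      ultimately show ?thesis by simp
    qed
  qed
qed

text \<open>The potential at \<open>i\<close> is the inverse of the gain of a walk to
  \<open>i\<close> from a fixed vertex. As closed walks have gain 1, it does not depend on the walk
  chosen.\<close>

lemma ex_potential:
  assumes conn: "closed_connected G"
    and cyc: "\<And>q. simple_cycle G q \<Longrightarrow> walk_gain g (q @ [hd q]) = 1"
  obtains c where "\<And>i. i \<in> pverts G \<Longrightarrow> c i \<noteq> 0" "\<And>i j. (i, j) \<in> parcs G \<Longrightarrow> c j * g i j = c i"
proof -
  obtain v0 where v0: "v0 \<in> pverts G" using conn by (auto simp: closed_connected_def)
  define joined where "joined i j xs \<longleftrightarrow> xs \<noteq> [] \<and> hd xs = i \<and> last xs = j \<and> walk xs" for i j xs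
  have path: "\<exists>xs. joined i j xs" if i: "i \<in> pverts G" and j: "j \<in> pverts G" for i j
  proof -
    have "{u \<in> pverts G. (i, u) \<in> (parcs G)\<^sup>*} = pverts G"
      by (rule closed_connectedD[OF conn, of _ i])
        (use i parcs_pverts[OF pair_graph_G] in \<open>auto intro: rtrancl_into_rtrancl\<close>)
    hence "(i, j) \<in> (parcs G)\<^sup>*" using j by blast
    then obtain xs where "xs \<noteq> []" "hd xs = i" "last xs = j" "distinct xs" "walk xs" by (rule distinct_path)
    thus ?thesis unfolding joined_def by blast
  qed
  define p where "p i = (SOME xs. joined v0 i xs)" for i
  have p: "joined v0 i (p i)" if "i \<in> pverts G" for i
    unfolding p_def using path[OF v0 that] by (rule someI_ex)
  have closed: "walk_gain g (xs @ tl ys) = 1" and split: "walk_gain g (xs @ tl ys) = walk_gain g xs * walk_gain g ys"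
    if "joined i j xs" "joined j i ys" for i j xs ys
  proof -
    have xs: "xs = butlast xs @ [j]" using that(1) by (metis joined_def append_butlast_last_id)
    have ys: "ys = j # tl ys" using that(2) by (metis joined_def list.collapse)
    have e: "xs @ tl ys = butlast xs @ j # tl ys" using xs by (metis append.assoc append_Cons append_Nil)
    show "walk_gain g (xs @ tl ys) = walk_gain g xs * walk_gain g ys"
      unfolding e using walk_gain_append[of g "butlast xs" j "tl ys"] xs ys by simp
    have "walk (butlast xs @ [j])" "walk (j # tl ys)" using that xs ys by (metis joined_def)+
    hence "walk (butlast xs @ j # tl ys)" by (auto simp: successively_append_iff)
    moreover have "hd (xs @ tl ys) = i" using that(1) by (auto simp: joined_def)
    moreover have "last (xs @ tl ys) = i"
      unfolding e using that(2) ys by (metis joined_def last_appendR list.distinct(1))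
    moreover have "xs @ tl ys \<noteq> []" using that(1) by (auto simp: joined_def)
    ultimately show "walk_gain g (xs @ tl ys) = 1" using closed_walk_gain[OF cyc] e by metis
  qed
  have nz: "walk_gain g (p i) \<noteq> 0" if i: "i \<in> pverts G" for i
  proof -
    obtain ys where "joined i v0 ys" using path[OF i v0] by blast
    hence "walk_gain g (p i) * walk_gain g ys = 1" using closed[OF p[OF i]] split[OF p[OF i]] by metis
    thus ?thesis by auto
  qed
  \<comment> \<open>Return from \<open>j\<close> to the base vertex along \<open>ys\<close>, once
    after \<open>p j\<close> and once after \<open>p i\<close> followed by the arc. Both closed
    walks have gain 1.\<close>
  have step: "walk_gain g (p j) = walk_gain g (p i) * g i j" if ij: "(i, j) \<in> parcs G" for i j
  proof -
    have i: "i \<in> pverts G" and j: "j \<in> pverts G" using parcs_pverts[OF pair_graph_G ij] by auto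
    obtain ys where ys: "joined j v0 ys" using path[OF j v0] by blast
    have 1: "walk_gain g (p j) * walk_gain g ys = 1" using closed[OF p[OF j] ys] split[OF p[OF j] ys] by simp
    have y: "ys = j # tl ys" using ys by (metis joined_def list.collapse)
    have "joined i v0 (i # ys)" using ys ij unfolding joined_def by (auto simp: successively_Cons)
    hence "walk_gain g (p i) * walk_gain g (i # ys) = 1" using closed[OF p[OF i]] split[OF p[OF i]] by metis
    moreover have "walk_gain g (i # ys) = g i j * walk_gain g ys" by (metis y walk_gain.simps(1))
    ultimately have "(walk_gain g (p i) * g i j) * walk_gain g ys = walk_gain g (p j) * walk_gain g ys"
      using 1 by (simp only: mult.assoc)
    moreover have "walk_gain g ys \<noteq> 0" using 1 by auto
    ultimately show ?thesis by simp
  qed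
  show ?thesis
  proof (rule that[of "\<lambda>i. 1 / walk_gain g (p i)"])
    show "1 / walk_gain g (p i) \<noteq> 0" if "i \<in> pverts G" for i using nz[OF that] by simp
    fix i j assume ij: "(i, j) \<in> parcs G"
    have "walk_gain g (p i) \<noteq> 0" "walk_gain g (p j) \<noteq> 0" using nz parcs_pverts[OF pair_graph_G ij] by auto
    thus "1 / walk_gain g (p j) * g i j = 1 / walk_gain g (p i)" using step[OF ij] by (simp add: field_simps)
  qed
qed

end

section \<open>Surgery on trees\<close>

lemma insert5_swap: "{a, b, c, d, e} = {a, c, b, e, d}" and insert5_flip: "{a, b, c, d, e} = {a, d, e, b, c}"
  by blast+

locale tree_surgery = binary_tree T for T :: "'t pair_pre_digraph" +
  fixes v1 v2 v3 v4 v5 v6 w1 w2 :: 't and T' :: "'t pair_pre_digraph"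
  assumes distinct_v1: "distinct [v2, v3, v4]" and nbrs_v1: "nbrs T v1 = {v2, v3, v4}"
    and distinct_v2: "distinct [v1, v5, v6]" and nbrs_v2: "nbrs T v2 = {v1, v5, v6}"
    and fresh: "w1 \<notin> pverts T" "w2 \<notin> pverts T" "w1 \<noteq> w2"
    and pverts_T': "pverts T' = pverts T - {v1, v2} \<union> {w1, w2}"
    and parcs_T': "parcs T' = {(x, y). {x, y} \<in>
           uedges T - {{v1, v2}, {v1, v3}, {v1, v4}, {v2, v5}, {v2, v6}}
             \<union> {{w1, w2}, {w1, v3}, {w1, v5}, {w2, v4}, {w2, v6}}}"
begin

text \<open>Together with \<open>tree_surgery_flip\<close> this generates four symmetries of a
  surgery, under which \<open>v3\<close> is moved to each of \<open>v3\<close>, \<open>v4\<close>,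
  \<open>v5\<close>, \<open>v6\<close>. It is therefore enough to study the branch at
  \<open>v3\<close>.\<close>

lemma tree_surgery_swap: "tree_surgery T v1 v2 v4 v3 v6 v5 w2 w1 T'"
proof (rule tree_surgery.intro[OF binary_tree_axioms], rule tree_surgery_axioms.intro)
  show "distinct [v2, v4, v3]" using distinct_v1 by auto
  show "distinct [v1, v6, v5]" using distinct_v2 by auto
  show "nbrs T v1 = {v2, v4, v3}" "nbrs T v2 = {v1, v6, v5}" unfolding nbrs_v1 nbrs_v2 by blast+
  show "w2 \<notin> pverts T" "w1 \<notin> pverts T" "w2 \<noteq> w1" using fresh by auto
  show "pverts T' = pverts T - {v1, v2} \<union> {w2, w1}" unfolding pverts_T' by blast
  have w: "{w2, w1} = {w1, w2}" by blast
  show "parcs T' = {(x, y). {x, y} \<in> uedges T - {{v1, v2}, {v1, v4}, {v1, v3}, {v2, v6}, {v2, v5}}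
      \<union> {{w2, w1}, {w2, v4}, {w2, v6}, {w1, v3}, {w1, v5}}}"
    unfolding parcs_T' w insert5_swap[of "{v1, v2}" "{v1, v3}" "{v1, v4}" "{v2, v5}" "{v2, v6}"]
      insert5_flip[of "{w1, w2}" "{w1, v3}" "{w1, v5}" "{w2, v4}" "{w2, v6}"] ..
qed

lemma tree_surgery_flip: "tree_surgery T v2 v1 v5 v6 v3 v4 w1 w2 T'"
proof (rule tree_surgery.intro[OF binary_tree_axioms], rule tree_surgery_axioms.intro)
  show "pverts T' = pverts T - {v2, v1} \<union> {w1, w2}" unfolding pverts_T' by blast
  have v: "{v2, v1} = {v1, v2}" by blast
  show "parcs T' = {(x, y). {x, y} \<in> uedges T - {{v2, v1}, {v2, v5}, {v2, v6}, {v1, v3}, {v1, v4}}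
      \<union> {{w1, w2}, {w1, v5}, {w1, v3}, {w2, v6}, {w2, v4}}}"
    unfolding parcs_T' v insert5_flip[of "{v1, v2}" "{v1, v3}" "{v1, v4}" "{v2, v5}" "{v2, v6}"]
      insert5_swap[of "{w1, w2}" "{w1, v3}" "{w1, v5}" "{w2, v4}" "{w2, v6}"] ..
qed (fact distinct_v1 nbrs_v1 distinct_v2 nbrs_v2 fresh)+

lemma arcs_v1: "(v1, v2) \<in> parcs T" "(v1, v3) \<in> parcs T" "(v1, v4) \<in> parcs T"
  and arcs_v2: "(v2, v1) \<in> parcs T" "(v2, v5) \<in> parcs T" "(v2, v6) \<in> parcs T"
  and arc_v1_iff: "(v1, u) \<in> parcs T \<longleftrightarrow> u \<in> {v2, v3, v4}"
  and arc_v2_iff: "(v2, u) \<in> parcs T \<longleftrightarrow> u \<in> {v1, v5, v6}"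
  using nbrs_v1 nbrs_v2 by (auto simp: nbrs_def)

lemma pverts_v: "v1 \<in> pverts T" "v2 \<in> pverts T" "v3 \<in> pverts T" "v4 \<in> pverts T" "v5 \<in> pverts T" "v6 \<in> pverts T"
  using arcs_v1 arcs_v2 arc_pverts by blast+

text \<open>The sides at \<open>a\<close> towards \<open>b\<close> and \<open>c\<close> are
  disjoint, and the arc from \<open>b\<close> to \<open>c\<close> would join them. This separates
  \<open>v3\<close>, \<open>v4\<close> from \<open>v5\<close>, \<open>v6\<close>.\<close>

lemma triangle_free:
  assumes "(a, b) \<in> parcs T" "(b, c) \<in> parcs T" "(a, c) \<in> parcs T"
  shows False
proof -
  have "b \<noteq> c" using assms arc_irrefl by metis
  hence "c \<notin> side a b"
    using side_disjoint[OF assms(1,3)] side_mem[OF assms(3)] by blast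
  hence "c = a" using side_arc[OF assms(1,2)] side_mem[OF assms(1)] by blast
  thus False using assms(3) arc_irrefl by metis
qed

lemma distinct_v: "distinct [v1, v2, v3, v4, v5, v6]"
proof -
  have "v3 \<noteq> v5" "v3 \<noteq> v6" "v4 \<noteq> v5" "v4 \<noteq> v6"
    using triangle_free[OF arcs_v1(1) arcs_v2(2)] triangle_free[OF arcs_v1(1) arcs_v2(3)] arcs_v1 by auto
  moreover have "v1 \<notin> {v2, v3, v4}" "v2 \<notin> {v1, v5, v6}"
    using arc_irrefl arc_v1_iff arc_v2_iff by metis+
  ultimately show ?thesis using distinct_v1 distinct_v2 by auto
qed

lemma distinct_vw: "distinct [v1, v2, v3, v4, v5, v6, w1, w2]"
proof -
  have "w1 \<notin> {v1, v2, v3, v4, v5, v6}" "w2 \<notin> {v1, v2, v3, v4, v5, v6}" using fresh pverts_v by blast+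
  thus ?thesis using distinct_v fresh(3) by simp blast
qed

lemma uedge_iff: "{x, y} \<in> uedges T \<longleftrightarrow> (x, y) \<in> parcs T"
  using arc_sym[of x y] by (auto simp: uedges_def doubleton_eq_iff)

text \<open>The five deleted edges are exactly the edges of \<open>T\<close> at \<open>v1\<close> or
  \<open>v2\<close>, so an old arc survives iff it avoids both vertices. Afterwards no unordered
  pairs have to be compared.\<close>

lemma arc_T'_iff:
  "(x, y) \<in> parcs T' \<longleftrightarrow> ((x, y) \<in> parcs T \<and> x \<notin> {v1, v2} \<and> y \<notin> {v1, v2}) \<or>
     (x = w1 \<and> y \<in> {w2, v3, v5}) \<or> (x = w2 \<and> y \<in> {w1, v4, v6}) \<or>
     (y = w1 \<and> x \<in> {w2, v3, v5}) \<or> (y = w2 \<and> x \<in> {w1, v4, v6})"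
proof -
  let ?old = "{{v1, v2}, {v1, v3}, {v1, v4}, {v2, v5}, {v2, v6}}"
  have comm: "{y, x} = {x, y}" by blast
  have old1: "{v1, u} \<in> ?old" if "(v1, u) \<in> parcs T" for u
    using that arc_v1_iff[of u] by (simp, elim disjE; simp)
  have "{v2, v1} = {v1, v2}" by blast
  hence old2: "{v2, u} \<in> ?old" if "(v2, u) \<in> parcs T" for u
    using that arc_v2_iff[of u] by (simp, elim disjE; simp)
  have "{x, y} \<in> ?old" if "(x, y) \<in> parcs T" "x = v1 \<or> x = v2 \<or> y = v1 \<or> y = v2"
  proof -
    have yx: "(y, x) \<in> parcs T" using that(1) by (subst arc_sym)
    show ?thesis
      using that(2) old1[of x] old1[of y] old2[of x] old2[of y] that(1) yx comm by metis
  qed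
  moreover have "x = v1 \<or> x = v2 \<or> y = v1 \<or> y = v2" if "{x, y} \<in> ?old"
    using that by (simp only: insert_iff empty_iff doubleton_eq_iff) argo
  ultimately have *: "(x, y) \<in> parcs T \<and> {x, y} \<notin> ?old \<longleftrightarrow>
      (x, y) \<in> parcs T \<and> x \<notin> {v1, v2} \<and> y \<notin> {v1, v2}"
    by (simp only: insert_iff empty_iff) argo
  have **: "{x, y} \<in> {{w1, w2}, {w1, v3}, {w1, v5}, {w2, v4}, {w2, v6}} \<longleftrightarrow>
     (x = w1 \<and> y \<in> {w2, v3, v5}) \<or> (x = w2 \<and> y \<in> {w1, v4, v6}) \<or>
     (y = w1 \<and> x \<in> {w2, v3, v5}) \<or> (y = w2 \<and> x \<in> {w1, v4, v6})"
    by (simp only: insert_iff empty_iff doubleton_eq_iff) argo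
  show ?thesis
    unfolding parcs_T' mem_Collect_eq case_prod_conv Un_iff Diff_iff uedge_iff * ** ..
qed

lemma pverts_T'_mem: "{v3, v4, v5, v6, w1, w2} \<subseteq> pverts T'"
  using pverts_v distinct_v unfolding pverts_T' by auto

lemma pair_graph_T': "pair_graph T'"
proof -
  have "(y, x) \<in> parcs T'" if "(x, y) \<in> parcs T'" for x y
    using that unfolding parcs_T' mem_Collect_eq case_prod_conv insert_commute[of y x "{}"] .
  moreover have "x \<in> pverts T' \<and> y \<in> pverts T'" if "(x, y) \<in> parcs T'" for x y
  proof (cases "(x, y) \<in> parcs T \<and> x \<notin> {v1, v2} \<and> y \<notin> {v1, v2}")
    case True
    thus ?thesis using arc_pverts[of x y] unfolding pverts_T' by blast
  next
    case False
    hence "x \<in> {v3, v4, v5, v6, w1, w2} \<and> y \<in> {v3, v4, v5, v6, w1, w2}"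
      using that unfolding arc_T'_iff insert_iff empty_iff by argo
    thus ?thesis using pverts_T'_mem by blast
  qed
  moreover have "(x, x) \<notin> parcs T'" for x
    using arc_irrefl[of x] distinct_vw unfolding arc_T'_iff by auto
  moreover have "finite (pverts T')" unfolding pverts_T' by simp
  ultimately show ?thesis unfolding pair_graph_iff by auto
qed

lemma not_arc_w: "(w1, u) \<notin> parcs T" "(u, w1) \<notin> parcs T" "(w2, u) \<notin> parcs T" "(u, w2) \<notin> parcs T"
  using arc_pverts fresh by blast+

lemma nbrs_T'_w: "nbrs T' w1 = {w2, v3, v5}" "nbrs T' w2 = {w1, v4, v6}"
  using not_arc_w distinct_vw unfolding nbrs_def arc_T'_iff by auto

lemma nbrs_T'_v3: "nbrs T' v3 = insert w1 (nbrs T v3 - {v1})"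
proof -
  have "(v3, v2) \<notin> parcs T" using arc_sym[of v3 v2] arc_v2_iff[of v3] distinct_v by auto
  thus ?thesis using not_arc_w distinct_vw unfolding nbrs_def arc_T'_iff by auto
qed

lemma nbrs_T'_other:
  assumes "x \<in> pverts T - {v1, v2, v3, v4, v5, v6}" shows "nbrs T' x = nbrs T x"
  using assms arc_sym[of x v1] arc_sym[of x v2] arc_v1_iff[of x] arc_v2_iff[of x] fresh
  unfolding nbrs_def arc_T'_iff by auto

lemma card_nbrs_v3: "card (nbrs T' v3) = card (nbrs T v3)"
proof -
  have "v1 \<in> nbrs T v3" using arcs_v1(2) arc_sym[of v1 v3] by (simp add: nbrs_def)
  moreover have "w1 \<notin> nbrs T v3" using fresh arc_pverts by (auto simp: nbrs_def)
  ultimately show ?thesis unfolding nbrs_T'_v3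
    by (metis Diff_iff card_insert_disjoint card_Suc_Diff1 finite_Diff finite_nbrs_T)
qed

lemma card_nbrs_T':
  assumes "x \<in> pverts T - {v1, v2}" shows "card (nbrs T' x) = card (nbrs T x)"
proof -
  interpret s: tree_surgery T v1 v2 v4 v3 v6 v5 w2 w1 T' by (rule tree_surgery_swap)
  interpret f: tree_surgery T v2 v1 v5 v6 v3 v4 w1 w2 T' by (rule tree_surgery_flip)
  interpret sf: tree_surgery T v2 v1 v6 v5 v4 v3 w2 w1 T' by (rule f.tree_surgery_swap)
  show ?thesis
    using assms nbrs_T'_other[of x] card_nbrs_v3 s.card_nbrs_v3 f.card_nbrs_v3 sf.card_nbrs_v3
    by (cases "x \<in> {v3, v4, v5, v6}") auto
qed

lemma card_nbrs_w: "card (nbrs T' w1) = 3" "card (nbrs T' w2) = 3"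
  using distinct_vw unfolding nbrs_T'_w by auto

text \<open>A closed set of the new tree contains all of \<open>v3\<close>, \<open>v4\<close>,
  \<open>v5\<close>, \<open>v6\<close>, \<open>w1\<close>, \<open>w2\<close> or none of them.
  Putting \<open>v1\<close>, \<open>v2\<close> in the place of \<open>w1\<close>, \<open>w2\<close>
  turns it into a closed set of \<open>T\<close>.\<close>

lemma closed_connected_T': "closed_connected T'"
  unfolding closed_connected_def
proof (intro conjI allI impI)
  show "pverts T' \<noteq> {}" by (simp add: pverts_T')
  fix B assume B: "B \<subseteq> pverts T' \<and> B \<noteq> {} \<and> (\<forall>u v. (u, v) \<in> parcs T' \<and> u \<in> B \<longrightarrow> v \<in> B)"
  have iff: "u \<in> B \<longleftrightarrow> v \<in> B" if "(u, v) \<in> parcs T'" for u v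
    using B that parcs_sym[OF pair_graph_T', of u v] by blast
  have w: "w2 \<in> B \<longleftrightarrow> w1 \<in> B" "v3 \<in> B \<longleftrightarrow> w1 \<in> B" "v4 \<in> B \<longleftrightarrow> w1 \<in> B" "v5 \<in> B \<longleftrightarrow> w1 \<in> B" "v6 \<in> B \<longleftrightarrow> w1 \<in> B"
    using iff[of w1 w2] iff[of w1 v3] iff[of w1 v5] iff[of w2 v4] iff[of w2 v6] by (auto simp: arc_T'_iff)
  define C where "C = (B - {w1, w2}) \<union> (if w1 \<in> B then {v1, v2} else {})"
  have CV: "C \<subseteq> pverts T" using B pverts_v by (auto simp: C_def pverts_T')
  have C1: "u \<in> C \<longleftrightarrow> w1 \<in> B" if "u \<in> {v1, v2, v3, v4, v5, v6}" for u
  proof -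
    have "v1 \<notin> B" "v2 \<notin> B" using B fresh pverts_v by (auto simp: pverts_T')
    thus ?thesis using that w distinct_v fresh pverts_v by (auto simp: C_def)
  qed
  have C2: "u \<in> C \<longleftrightarrow> u \<in> B" if "u \<in> pverts T - {v1, v2}" for u
    using that fresh by (auto simp: C_def)
  have "\<exists>b. b \<in> C"
  proof (cases "w1 \<in> B")
    case True thus ?thesis by (auto simp: C_def)
  next
    case False
    hence "C = B" using w(1) by (auto simp: C_def)
    thus ?thesis using B by blast
  qed
  then obtain b where "b \<in> C" by blast
  moreover have "v \<in> C" if uv: "(u, v) \<in> parcs T" "u \<in> C" for u v
  proof (cases "u \<in> {v1, v2} \<or> v \<in> {v1, v2}")
    case True
    hence "u \<in> {v1, v2, v3, v4, v5, v6}" "v \<in> {v1, v2, v3, v4, v5, v6}"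
      using uv arc_v1_iff[of u] arc_v1_iff[of v] arc_v2_iff[of u] arc_v2_iff[of v] arc_sym[of u v] by auto
    thus ?thesis using C1 uv by blast
  next
    case False
    thus ?thesis using iff[of u v] C2 uv arc_pverts[OF uv(1)] by (auto simp: arc_T'_iff)
  qed
  ultimately have "C = pverts T" using closed_connectedD[OF closed_connected_T CV] by blast
  thus "B = pverts T'" using B C1[of v1] w(1) pverts_v C2 unfolding pverts_T' by blast
qed

text \<open>None of the deleted edges crosses the cut, so \<open>v1\<close> to \<open>v6\<close> lie
  on the same side of the old edge, and the new vertices are placed on that side.\<close>

lemma cut_T'_old:
  assumes xy: "(x, y) \<in> parcs T" and x: "x \<notin> {v1, v2}" and y: "y \<notin> {v1, v2}"
  shows "cut T' x y (side x y - {v1, v2} \<union> (if v1 \<in> side x y then {w1, w2} else {}))" (is "cut T' x y ?B")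
proof -
  have iff: "u \<in> side x y \<longleftrightarrow> v \<in> side x y" if "(u, v) \<in> parcs T" "u \<in> {v1, v2}" for u v
    using that x y side_arc[OF xy that(1)] side_arc[OF xy, of v u] arc_sym[of u v] by blast
  have s: "v3 \<in> side x y \<longleftrightarrow> v1 \<in> side x y" "v4 \<in> side x y \<longleftrightarrow> v1 \<in> side x y" "v5 \<in> side x y \<longleftrightarrow> v1 \<in> side x y"
    "v6 \<in> side x y \<longleftrightarrow> v1 \<in> side x y"
    using iff[OF arcs_v1(1)] iff[OF arcs_v1(2)] iff[OF arcs_v1(3)] iff[OF arcs_v2(2)] iff[OF arcs_v2(3)] by auto
  have V: "side x y \<subseteq> pverts T" by (rule side_subset[OF xy])
  show ?thesis unfolding cut_def
  proof (intro conjI allI impI)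
    show "?B \<subseteq> pverts T'" using V by (auto simp: pverts_T')
    show "y \<in> ?B" using y side_mem[OF xy] by simp
    show "x \<notin> ?B" using side_not_mem[OF xy] arc_pverts[OF xy] fresh by auto
    fix u v assume a: "(u, v) \<in> parcs T' \<and> u \<in> ?B \<and> v \<notin> ?B"
    have v: "v \<in> ?B \<longleftrightarrow> v1 \<in> side x y" if "v \<in> {v3, v4, v5, v6, w1, w2}" for v
      using that s V fresh distinct_v by (cases "v1 \<in> side x y") auto
    have "(u, v) \<in> parcs T \<and> u \<notin> {v1, v2} \<and> v \<notin> {v1, v2}"
    proof (rule ccontr)
      assume "\<not> ?thesis"
      hence "u \<in> {v3, v4, v5, v6, w1, w2} \<and> v \<in> {v3, v4, v5, v6, w1, w2}"
        using a unfolding arc_T'_iff by blast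
      thus False using a v by blast
    qed
    moreover from this have "u \<in> side x y" using a fresh arc_pverts by (auto split: if_splits)
    moreover have "v \<notin> side x y" using a calculation by auto
    ultimately show "u = y" "v = x" using side_arc[OF xy] by blast+
  qed
qed

lemma side_v13:
  "v1 \<notin> side v1 v3" "v2 \<notin> side v1 v3" "v4 \<notin> side v1 v3" "v5 \<notin> side v1 v3" "v6 \<notin> side v1 v3"
  "w1 \<notin> side v1 v3" "w2 \<notin> side v1 v3"
proof -
  show 1: "v1 \<notin> side v1 v3" by (rule side_not_mem[OF arcs_v1(2)])
  have sa: "u \<notin> side v1 v3" if "(u, v) \<in> parcs T" "v \<notin> side v1 v3" "u \<noteq> v3" for u v
    using side_arc[OF arcs_v1(2) that(1)] that by blast
  show 2: "v2 \<notin> side v1 v3" using sa[OF arcs_v2(1) 1] distinct_v by auto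
  show "v4 \<notin> side v1 v3" using sa[of v4 v1] 1 arcs_v1(3) distinct_v arc_sym[of v4 v1] by auto
  show "v5 \<notin> side v1 v3" using sa[of v5 v2] 2 arcs_v2(2) distinct_v arc_sym[of v5 v2] by auto
  show "v6 \<notin> side v1 v3" using sa[of v6 v2] 2 arcs_v2(3) distinct_v arc_sym[of v6 v2] by auto
  show "w1 \<notin> side v1 v3" "w2 \<notin> side v1 v3" using side_subset[OF arcs_v1(2)] fresh by auto
qed

lemma side_v13_arc:
  assumes "(u, v) \<in> parcs T'" "u \<in> side v1 v3" "v \<notin> side v1 v3" shows "u = v3 \<and> v = w1"
proof (cases "(u, v) \<in> parcs T \<and> u \<notin> {v1, v2} \<and> v \<notin> {v1, v2}")
  case True
  thus ?thesis using side_arc[OF arcs_v1(2)] assms by blast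
next
  case False
  thus ?thesis using assms side_v13 unfolding arc_T'_iff by blast
qed

text \<open>The branch behind \<open>v3\<close> is untouched; only the vertex to which it is
  attached changes from \<open>v1\<close> to \<open>w1\<close>.\<close>

lemma cut_T'_v3: "cut T' w1 v3 (side v1 v3)"
  using side_v13 side_v13_arc side_mem[OF arcs_v1(2)] side_subset[OF arcs_v1(2)]
  unfolding cut_def pverts_T' by blast

text \<open>The side of \<open>w1\<close> is made of the branches of \<open>v3\<close> and
  \<open>v5\<close>. This is what makes \<open>F v1 v3 + F v2 v5\<close> the force at the new
  interior edge.\<close>

lemma cut_T'_middle: "cut T' w2 w1 (insert w1 (side v1 v3 \<union> side v2 v5))" (is "cut T' w2 w1 ?B")
proof -
  interpret f: tree_surgery T v2 v1 v5 v6 v3 v4 w1 w2 T' by (rule tree_surgery_flip)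
  show ?thesis unfolding cut_def
  proof (intro conjI allI impI)
    show "?B \<subseteq> pverts T'"
      using side_v13 f.side_v13 side_subset[OF arcs_v1(2)] side_subset[OF arcs_v2(2)] unfolding pverts_T' by blast
    show "w1 \<in> ?B" by simp
    show "w2 \<notin> ?B" using side_v13 f.side_v13 fresh by blast
    fix u v assume a: "(u, v) \<in> parcs T' \<and> u \<in> ?B \<and> v \<notin> ?B"
    have "u \<notin> side v1 v3" using side_v13_arc[of u v] a by blast
    moreover have "u \<notin> side v2 v5" using f.side_v13_arc[of u v] a by blast
    ultimately have "u = w1" using a by blast
    moreover from this have "v = w2"
      using a nbrs_T'_w(1) side_mem[OF arcs_v1(2)] side_mem[OF arcs_v2(2)] unfolding nbrs_def by blast
    ultimately show "u = w1" "v = w2" by auto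
  qed
qed

text \<open>The new edges are listed in the orientation for which a cut is at hand: that of
  \<open>cut_T'_v3\<close> and its images under the symmetries, and that of
  \<open>cut_T'_middle\<close> for \<open>(w2, w1)\<close>.\<close>

lemma arc_T'_cases:
  assumes "(x, y) \<in> parcs T'"
  obtains "(x, y) \<in> parcs T" "x \<notin> {v1, v2}" "y \<notin> {v1, v2}"
  | a b where "(a, b) \<in> {(w1, v3), (w1, v5), (w2, v4), (w2, v6), (w2, w1)}" "(x, y) = (a, b) \<or> (x, y) = (b, a)"
proof (cases "(x, y) \<in> parcs T \<and> x \<notin> {v1, v2} \<and> y \<notin> {v1, v2}")
  case True thus ?thesis using that(1) by blast
next
  case False
  hence "(x = w1 \<and> y \<in> {w2, v3, v5}) \<or> (x = w2 \<and> y \<in> {w1, v4, v6}) \<or>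
     (y = w1 \<and> x \<in> {w2, v3, v5}) \<or> (y = w2 \<and> x \<in> {w1, v4, v6})"
    using assms unfolding arc_T'_iff by argo
  hence "(x, y) \<in> {(w1, v3), (w1, v5), (w2, v4), (w2, v6), (w2, w1)} \<or>
      (y, x) \<in> {(w1, v3), (w1, v5), (w2, v4), (w2, v6), (w2, w1)}"
    by (elim disjE conjE insertE emptyE) simp_all
  thus ?thesis
  proof
    assume "(x, y) \<in> {(w1, v3), (w1, v5), (w2, v4), (w2, v6), (w2, w1)}"
    thus ?thesis by (rule that(2)) simp
  next
    assume "(y, x) \<in> {(w1, v3), (w1, v5), (w2, v4), (w2, v6), (w2, w1)}"
    thus ?thesis by (rule that(2)) simp
  qed
qed

lemma ex_cut_T':
  assumes "(x, y) \<in> parcs T'" shows "\<exists>B. cut T' x y B"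
proof -
  interpret s: tree_surgery T v1 v2 v4 v3 v6 v5 w2 w1 T' by (rule tree_surgery_swap)
  interpret f: tree_surgery T v2 v1 v5 v6 v3 v4 w1 w2 T' by (rule tree_surgery_flip)
  interpret sf: tree_surgery T v2 v1 v6 v5 v4 v3 w2 w1 T' by (rule f.tree_surgery_swap)
  from assms show ?thesis
  proof (cases rule: arc_T'_cases)
    case 1
    show ?thesis by (rule exI, rule cut_T'_old[OF 1])
  next
    case (2 a b)
    note cuts = exI[of "cut T' w1 v3", OF cut_T'_v3] exI[of "cut T' w2 v4", OF s.cut_T'_v3]
      exI[of "cut T' w1 v5", OF f.cut_T'_v3] exI[of "cut T' w2 v6", OF sf.cut_T'_v3]
      exI[of "cut T' w2 w1", OF cut_T'_middle]
    have "\<exists>B. cut T' a b B"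
      using 2(1) by (elim insertE emptyE) (simp_all only: prod.inject cuts simp_thms)
    then obtain B where "cut T' a b B" ..
    show ?thesis
    proof (cases "(x, y) = (a, b)")
      case True
      thus ?thesis using \<open>cut T' a b B\<close> by auto
    next
      case False
      hence xy: "x = b" "y = a" using 2(2) by auto
      have "(a, b) \<in> parcs T'" using assms parcs_sym[OF pair_graph_T'] xy by blast
      thus ?thesis using cut_compl[OF pair_graph_T' _ \<open>cut T' a b B\<close>] xy by blast
    qed
  qed
qed

lemma full_binary_tree_T': "full_binary_tree T'"
  unfolding full_binary_tree_iff
proof (intro conjI allI impI ballI)
  fix x assume x: "x \<in> pverts T'"
  show "card (nbrs T' x) \<in> {1, 3}"
  proof (cases "x \<in> {w1, w2}")
    case True thus ?thesis using card_nbrs_w by auto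
  next
    case False thus ?thesis using x card_nbrs_T' card_nbrs by (auto simp: pverts_T')
  qed
qed (use pair_graph_T' closed_connected_T' ex_cut_T' in auto)

lemma leaf_verts_T': "leaf_verts T' = leaf_verts T"
proof -
  interpret t: binary_tree T' by unfold_locales (rule full_binary_tree_T')
  have v: "card (nbrs T v1) = 3" "card (nbrs T v2) = 3" unfolding nbrs_v1 nbrs_v2 using distinct_v by auto
  show ?thesis
  proof (rule set_eqI)
    fix x
    show "x \<in> leaf_verts T' \<longleftrightarrow> x \<in> leaf_verts T"
    proof (cases "x \<in> {v1, v2, w1, w2}")
      case True
      thus ?thesis using v card_nbrs_w fresh distinct_vw
        by (auto simp: leaf_verts_iff t.leaf_verts_iff pverts_T')
    next
      case False
      thus ?thesis using card_nbrs_T'[of x] by (auto simp: leaf_verts_iff t.leaf_verts_iff pverts_T')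
    qed
  qed
qed

end

section \<open>Homogeneous coordinates\<close>

unbundle cross3_syntax

text \<open>Meaningful for nonzero \<open>n\<close> only: otherwise the set is the whole space,
  which is not in the type of lines.\<close>

definition normal_line :: "real^3 \<Rightarrow> rp2_line" where
  "normal_line n = Abs_rp2_line {x. n \<bullet> x = 0}"

lemma cross_eq_0_parallel:
  fixes x y :: "real^3"
  assumes "x \<times> y = 0" "x \<noteq> 0"
  obtains c where "y = c *\<^sub>R x"
proof -
  have "x \<times> (x \<times> y) = 0" using assms by simp
  hence "(x \<bullet> x) *\<^sub>R y = (x \<bullet> y) *\<^sub>R x" by (simp add: Lagrange)
  hence "(1 / (x \<bullet> x)) *\<^sub>R ((x \<bullet> x) *\<^sub>R y) = (1 / (x \<bullet> x)) *\<^sub>R ((x \<bullet> y) *\<^sub>R x)" by simp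
  hence "y = ((x \<bullet> y) / (x \<bullet> x)) *\<^sub>R x" using assms(2) by simp
  thus ?thesis using that by blast
qed

lemma orthogonal_to_independent:
  fixes x y z :: "real^3"
  assumes "x \<times> y \<noteq> 0" "z \<bullet> x = 0" "z \<bullet> y = 0"
  obtains c where "z = c *\<^sub>R (x \<times> y)"
proof -
  have "(x \<times> y) \<times> z = 0"
    using Lagrange[of z x y] assms(2,3) cross_skew[of "x \<times> y" z] by simp
  thus ?thesis using cross_eq_0_parallel assms(1) that by blast
qed

lemma Rep_proj_point: "x \<noteq> 0 \<Longrightarrow> Rep_rp2_point (proj_point x) = span {x}"
  unfolding proj_point_def by (rule Abs_rp2_point_inverse) (simp add: dim_span)

lemma Rep_normal_line: "n \<noteq> 0 \<Longrightarrow> Rep_rp2_line (normal_line n) = {x. n \<bullet> x = 0}"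
  unfolding normal_line_def
  by (rule Abs_rp2_line_inverse) (simp add: dim_hyperplane subspace_hyperplane)

lemma proj_point_cases:
  obtains x where "x \<noteq> 0" "p = proj_point x"
proof -
  have s: "subspace (Rep_rp2_point p)" "dim (Rep_rp2_point p) = 1"
    using Rep_rp2_point[of p] by auto
  obtain B where B: "B \<subseteq> Rep_rp2_point p" "independent B" "Rep_rp2_point p \<subseteq> span B" "card B = 1"
    using basis_exists[of "Rep_rp2_point p"] s(2) by metis
  obtain x where x: "B = {x}" using B(4) by (auto simp: card_1_singleton_iff)
  have "x \<noteq> 0" using B(2) x dependent_zero by auto
  moreover have "Rep_rp2_point p = span {x}"
    using B(1,3) x s(1) span_minimal by blast
  hence "p = proj_point x" unfolding proj_point_def by (metis Rep_rp2_point_inverse)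
  ultimately show ?thesis using that by blast
qed

lemma normal_line_cases:
  obtains n where "n \<noteq> 0" "l = normal_line n"
proof -
  have s: "subspace (Rep_rp2_line l)" "dim (Rep_rp2_line l) = 2"
    using Rep_rp2_line[of l] by auto
  obtain n where n: "n \<noteq> 0" "span (Rep_rp2_line l) \<subseteq> {x. n \<bullet> x = 0}"
    using lowdim_subset_hyperplane[of "Rep_rp2_line l"] s(2) by auto
  have "Rep_rp2_line l = {x. n \<bullet> x = 0}"
    using n s span_superset[of "Rep_rp2_line l"]
    by (intro subspace_dim_equal) (auto simp: subspace_hyperplane dim_hyperplane)
  thus ?thesis using that[OF n(1)] unfolding normal_line_def by (metis Rep_rp2_line_inverse)
qed

lemma lies_on_iff: "x \<noteq> 0 \<Longrightarrow> n \<noteq> 0 \<Longrightarrow> lies_on (proj_point x) (normal_line n) \<longleftrightarrow> n \<bullet> x = 0"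
  using span_base[of x "{x}"]
  by (auto simp: lies_on_def Rep_proj_point Rep_normal_line span_singleton)

lemma normal_line_scaleR: "c \<noteq> 0 \<Longrightarrow> normal_line (c *\<^sub>R n) = normal_line n"
  by (simp add: normal_line_def)

lemma normal_line_minus: "normal_line (- n) = normal_line n"
  by (simp add: normal_line_def)

lemma proj_point_scaleR: "c \<noteq> 0 \<Longrightarrow> proj_point (c *\<^sub>R x) = proj_point x"
proof -
  assume c: "c \<noteq> 0"
  have "k *\<^sub>R x = (k / c) *\<^sub>R c *\<^sub>R x" for k using c by simp
  hence "span {x} \<subseteq> span {c *\<^sub>R x}" unfolding span_singleton by blast
  moreover have "span {c *\<^sub>R x} \<subseteq> span {x}" by (auto simp: span_singleton)
  ultimately show ?thesis unfolding proj_point_def by (metis subset_antisym)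
qed

lemma normal_line_eq_iff:
  assumes "n \<noteq> 0" "m \<noteq> 0"
  shows "normal_line n = normal_line m \<longleftrightarrow> n \<times> m = 0"
proof
  assume "normal_line n = normal_line m"
  hence e: "{x. n \<bullet> x = 0} = {x. m \<bullet> x = 0}"
    using Rep_normal_line[OF assms(1)] Rep_normal_line[OF assms(2)] by simp
  \<comment> \<open>The vector \<open>n \<times> (n \<times> m)\<close> is orthogonal to
    \<open>n\<close>, hence to \<open>m\<close>. Up to sign its inner product with \<open>m\<close>
    is the squared length of \<open>n \<times> m\<close>.\<close>
  have "m \<bullet> (n \<times> (n \<times> m)) = 0"
    using e by (metis (mono_tags, lifting) dot_cross_self(1) mem_Collect_eq)
  hence "(n \<times> m) \<bullet> (n \<times> m) = 0"

    using cross_triple[of n "n \<times> m" m] cross_triple[of "n \<times> m" m n] cross_skew[of m n]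
    by (simp add: inner_commute)
  thus "n \<times> m = 0" by simp
next
  assume "n \<times> m = 0"
  then obtain c where "m = c *\<^sub>R n" using cross_eq_0_parallel assms by blast
  thus "normal_line n = normal_line m" using assms normal_line_scaleR[of c n] by auto
qed

lemma proj_point_eq_iff:
  assumes "x \<noteq> 0" "y \<noteq> 0"
  shows "proj_point x = proj_point y \<longleftrightarrow> x \<times> y = 0"
proof
  assume "proj_point x = proj_point y"
  hence "span {x} = span {y}"
    using Rep_proj_point[OF assms(1)] Rep_proj_point[OF assms(2)] by simp
  hence "y \<in> span {x}" by (simp add: span_base)
  then obtain c where "y = c *\<^sub>R x" by (auto simp: span_singleton)
  thus "x \<times> y = 0" by (simp add: cross_mult_right)
next
  assume "x \<times> y = 0"
  then obtain c where "y = c *\<^sub>R x" using cross_eq_0_parallel assms by blast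
  thus "proj_point x = proj_point y" using assms proj_point_scaleR[of c x] by auto
qed

text \<open>The normal vector of a line through both points is orthogonal to the independent
  representatives \<open>x\<close> and \<open>y\<close>, hence a multiple of their cross product.
  This evaluates the definite description in \<open>join\<close>.\<close>

lemma join_eq:
  assumes "p \<noteq> q" "lies_on p l" "lies_on q l"
  shows "join p q = l"
  unfolding join_def
proof (rule the_equality)
  show "lies_on p l \<and> lies_on q l" using assms by simp
next
  fix k assume k: "lies_on p k \<and> lies_on q k"
  obtain x where x: "x \<noteq> 0" "p = proj_point x" by (rule proj_point_cases)
  obtain y where y: "y \<noteq> 0" "q = proj_point y" by (rule proj_point_cases)
  obtain n where n: "n \<noteq> 0" "l = normal_line n" by (rule normal_line_cases)
  obtain m where m: "m \<noteq> 0" "k = normal_line m" by (rule normal_line_cases)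
  have xy: "x \<times> y \<noteq> 0" using assms(1) x y proj_point_eq_iff by blast
  have "n \<bullet> x = 0" "n \<bullet> y = 0" "m \<bullet> x = 0" "m \<bullet> y = 0"
    using assms k x y n m lies_on_iff by auto
  then obtain c d where "n = c *\<^sub>R (x \<times> y)" "m = d *\<^sub>R (x \<times> y)"
    using orthogonal_to_independent[OF xy] by metis
  thus "k = l" using n m by (simp add: normal_line_eq_iff cross_mult_left cross_mult_right)
qed

lemma join_proj_point: "x \<times> y \<noteq> 0 \<Longrightarrow> join (proj_point x) (proj_point y) = normal_line (x \<times> y)"
proof (rule join_eq)
  assume xy: "x \<times> y \<noteq> 0"
  hence n: "x \<noteq> 0" "y \<noteq> 0" by auto
  show "proj_point x \<noteq> proj_point y" using xy n proj_point_eq_iff by blast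
  show "lies_on (proj_point x) (normal_line (x \<times> y))" "lies_on (proj_point y) (normal_line (x \<times> y))"
    using xy n lies_on_iff by (auto simp: dot_cross_self inner_commute)
qed

lemma meet_normal_line:
  assumes "n \<times> m \<noteq> 0"
  shows "meet (normal_line n) (normal_line m) = proj_point (n \<times> m)"
  unfolding meet_def
proof (rule the_equality)
  have nm: "n \<noteq> 0" "m \<noteq> 0" using assms by auto
  show "lies_on (proj_point (n \<times> m)) (normal_line n) \<and> lies_on (proj_point (n \<times> m)) (normal_line m)"
    using assms nm lies_on_iff by (auto simp: dot_cross_self)
  fix p assume p: "lies_on p (normal_line n) \<and> lies_on p (normal_line m)"
  obtain x where x: "x \<noteq> 0" "p = proj_point x" by (rule proj_point_cases)
  have "n \<bullet> x = 0" "m \<bullet> x = 0" using p x nm lies_on_iff by auto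
  then obtain c where c: "x = c *\<^sub>R (n \<times> m)"
    using orthogonal_to_independent[OF assms, of x] by (auto simp: inner_commute)
  thus "p = proj_point (n \<times> m)" using x proj_point_scaleR[of c] by auto
qed

lemma join_commute: "join p q = join q p"
  by (simp add: join_def conj_commute)

lemma lies_on_join:
  assumes "p \<noteq> q" shows "lies_on p (join p q)" "lies_on q (join p q)"
proof -
  obtain x where x: "x \<noteq> 0" "p = proj_point x" by (rule proj_point_cases)
  obtain y where y: "y \<noteq> 0" "q = proj_point y" by (rule proj_point_cases)
  have xy: "x \<times> y \<noteq> 0" using assms x y proj_point_eq_iff by blast
  show "lies_on p (join p q)" "lies_on q (join p q)"
    using x y xy join_proj_point lies_on_iff by (auto simp: dot_cross_self inner_commute)
qed

section \<open>Forces as normal vectors\<close>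

text \<open>The Hodge dual of the form: \<open>w u v\<close> is the inner product of this vector
  with \<open>u \<times> v\<close>, and \<open>d_wedge p q\<close> becomes
  \<open>p \<times> q\<close>.\<close>

lift_definition force_vec :: "force \<Rightarrow> real^3"
  is "\<lambda>w. vector [w (axis 2 1) (axis 3 1), w (axis 3 1) (axis 1 1), w (axis 1 1) (axis 2 1)]" .

text \<open>Expanding both arguments in the standard basis leaves three values of the form. This
  gives the injectivity of \<open>force_vec\<close>.\<close>

lemma alternating_bilinear_cross:
  fixes w :: "real^3 \<Rightarrow> real^3 \<Rightarrow> real"
  assumes w: "bilinear w" "\<And>u. w u u = 0"
  shows "w u v = vector [w (axis 2 1) (axis 3 1), w (axis 3 1) (axis 1 1), w (axis 1 1) (axis 2 1)] \<bullet> (u \<times> v)"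
proof -
  have skew: "w x y = - w y x" for x y
  proof -
    have "w (x + y) (x + y) = w x x + w x y + w y x + w y y"
      by (simp add: bilinear_ladd[OF w(1)] bilinear_radd[OF w(1)])
    thus ?thesis by (simp add: w(2))
  qed
  have dec: "x = x$1 *\<^sub>R axis 1 1 + x$2 *\<^sub>R axis 2 1 + x$3 *\<^sub>R axis 3 1" for x :: "real^3"
    by (simp add: vec_eq_iff forall_3 axis_def)
  have "w u v = w (u$1 *\<^sub>R axis 1 1 + u$2 *\<^sub>R axis 2 1 + u$3 *\<^sub>R axis 3 1)
      (v$1 *\<^sub>R axis 1 1 + v$2 *\<^sub>R axis 2 1 + v$3 *\<^sub>R axis 3 1)"
    using dec[of u] dec[of v] by simp
  also have "\<dots> = (u$2 * v$3 - u$3 * v$2) * w (axis 2 1) (axis 3 1)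
      + (u$3 * v$1 - u$1 * v$3) * w (axis 3 1) (axis 1 1) + (u$1 * v$2 - u$2 * v$1) * w (axis 1 1) (axis 2 1)"
    by (simp add: bilinear_ladd[OF w(1)] bilinear_radd[OF w(1)] bilinear_lmul[OF w(1)]
        bilinear_rmul[OF w(1)] w(2) skew[of "axis 3 1" "axis 2 1"] skew[of "axis 1 1" "axis 3 1"]
        skew[of "axis 2 1" "axis 1 1"] algebra_simps)
  finally show ?thesis
    by (simp add: inner_vec_def sum_3 cross_components algebra_simps)
qed

lemma force_vec_add [simp]: "force_vec (F + G) = force_vec F + force_vec G"
  by transfer (simp add: vec_eq_iff forall_3)

lemma force_vec_0 [simp]: "force_vec 0 = 0"
  by transfer (simp add: vec_eq_iff forall_3)

lemma force_vec_scaleR [simp]: "force_vec (c *\<^sub>R F) = c *\<^sub>R force_vec F"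
  by transfer (simp add: vec_eq_iff forall_3)

lemma force_vec_minus [simp]: "force_vec (- F) = - force_vec F"
  by transfer (simp add: vec_eq_iff forall_3)

lemma force_vec_diff [simp]: "force_vec (F - G) = force_vec F - force_vec G"
  by transfer (simp add: vec_eq_iff forall_3)

lemma force_vec_eq_iff [simp]: "force_vec F = force_vec G \<longleftrightarrow> F = G"
proof
  show "force_vec F = force_vec G \<Longrightarrow> F = G"
  proof transfer
    fix F G :: "real^3 \<Rightarrow> real^3 \<Rightarrow> real"
    assume F: "bilinear F \<and> (\<forall>u. F u u = 0)" and G: "bilinear G \<and> (\<forall>u. G u u = 0)"
      and e: "(vector [F (axis 2 1) (axis 3 1), F (axis 3 1) (axis 1 1), F (axis 1 1) (axis 2 1)] :: real^3)
        = vector [G (axis 2 1) (axis 3 1), G (axis 3 1) (axis 1 1), G (axis 1 1) (axis 2 1)]"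
    show "F = G"
    proof (intro ext)
      fix u v
      show "F u v = G u v"
        using alternating_bilinear_cross[of F u v] alternating_bilinear_cross[of G u v] F G e by simp
    qed
  qed
qed simp

lemma force_vec_eq_0_iff [simp]: "force_vec F = 0 \<longleftrightarrow> F = 0"
  using force_vec_eq_iff[of F 0] by simp

lemma force_vec_d_wedge: "force_vec (d_wedge p q) = p \<times> q"
  by transfer (simp add: vec_eq_iff forall_3 cross_components inner_axis algebra_simps)

text \<open>Decomposability of forces: two suitable vectors of the plane orthogonal to
  \<open>n\<close> have the cross product \<open>n\<close>.\<close>

lemma cross_surj:
  fixes n :: "real^3" assumes "n \<noteq> 0"
  obtains p q where "p \<times> q = n"
proof -
  have "\<exists>i. n \<times> axis i 1 \<noteq> 0" using cross_basis_nonzero[OF assms] by blast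
  then obtain i where "n \<times> axis i 1 \<noteq> 0" by blast
  define p where "p = n \<times> axis i 1"
  have p: "p \<bullet> p \<noteq> 0" "p \<bullet> n = 0"
    using \<open>n \<times> axis i 1 \<noteq> 0\<close> by (auto simp: p_def dot_cross_self inner_commute)
  \<comment> \<open>By Lagrange's formula \<open>p \<times> (n \<times> p)\<close> is
    \<open>(p \<bullet> p) *\<^sub>R n\<close>, because \<open>p\<close> is orthogonal to
    \<open>n\<close>.\<close>
  have "p \<times> ((1 / (p \<bullet> p)) *\<^sub>R (n \<times> p)) = n"
    using p by (simp add: cross_mult_right Lagrange)
  thus ?thesis using that by blast
qed

lemma independent_pair_cross:
  fixes p q :: "real^3" assumes "p \<noteq> q" "independent {p, q}" shows "p \<times> q \<noteq> 0"
proof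
  assume a: "p \<times> q = 0"
  have "p \<noteq> 0" using assms(2) dependent_zero by blast
  then obtain c where "q = c *\<^sub>R p" using cross_eq_0_parallel[OF a] by blast
  hence "q \<in> span ({p, q} - {q})" using assms(1) by (auto simp: span_singleton insert_Diff_if)
  thus False using assms(2) by (auto simp: dependent_def)
qed

lemma cross_independent_pair:
  fixes p q :: "real^3" assumes "p \<times> q \<noteq> 0" shows "p \<noteq> q" "independent {p, q}"
proof -
  have n: "p \<noteq> 0" "q \<noteq> 0" using assms by auto
  show "p \<noteq> q" using assms by auto
  have "p \<notin> span {q}"
    using assms by (auto simp: span_singleton cross_mult_left)
  thus "independent {p, q}" using n by (simp add: independent_insert)
qed

text \<open>All decompositions of \<open>F\<close> have the same cross product
  \<open>force_vec F\<close>, a normal vector of the line through the two points. So the definite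
  description is unique.\<close>

lemma line_of_force_eq:
  assumes "F \<noteq> 0" shows "line_of_force F = normal_line (force_vec F)"
  unfolding line_of_force_def
proof (rule the_equality)
  obtain p q where pq: "p \<times> q = force_vec F" using cross_surj[of "force_vec F"] assms by auto
  hence "F = d_wedge p q" by (simp flip: force_vec_eq_iff add: force_vec_d_wedge)
  moreover have "p \<times> q \<noteq> 0" using pq assms by simp
  ultimately show "\<exists>p q. p \<noteq> q \<and> independent {p, q} \<and> F = d_wedge p q \<and>
      normal_line (force_vec F) = join (proj_point p) (proj_point q)"
    using cross_independent_pair[of p q] join_proj_point[of p q] pq
    by (intro exI[of _ p] exI[of _ q]) simp
next
  fix l assume "\<exists>p q. p \<noteq> q \<and> independent {p, q} \<and> F = d_wedge p q \<and> l = join (proj_point p) (proj_point q)"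
  then obtain p q where "p \<noteq> q" "independent {p, q}" "F = d_wedge p q"
    "l = join (proj_point p) (proj_point q)" by blast
  thus "l = normal_line (force_vec F)"
    by (simp add: independent_pair_cross join_proj_point force_vec_d_wedge)
qed

lemma line_of_force_scaleR: "c \<noteq> 0 \<Longrightarrow> F \<noteq> 0 \<Longrightarrow> line_of_force (c *\<^sub>R F) = line_of_force F"
  by (simp add: line_of_force_eq normal_line_scaleR)

lemma line_of_force_minus: "F \<noteq> 0 \<Longrightarrow> line_of_force (- F) = line_of_force F"
  by (simp add: line_of_force_eq normal_line_minus)

lemma line_of_force_eq_iff:
  assumes "F \<noteq> 0" "H \<noteq> 0"
  shows "line_of_force F = line_of_force H \<longleftrightarrow> (\<exists>c. H = c *\<^sub>R F)"
proof -
  have "line_of_force F = line_of_force H \<longleftrightarrow> force_vec F \<times> force_vec H = 0"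
    using assms by (simp add: line_of_force_eq normal_line_eq_iff)
  also have "\<dots> \<longleftrightarrow> (\<exists>c. force_vec H = c *\<^sub>R force_vec F)"
    using cross_eq_0_parallel[of "force_vec F" "force_vec H"] assms
    by (auto simp: cross_mult_right)
  also have "\<dots> \<longleftrightarrow> (\<exists>c. H = c *\<^sub>R F)"
    by (simp flip: force_vec_scaleR)
  finally show ?thesis .
qed

lemma force_along_proportional:
  assumes "force_along F l" "force_along H l" "F \<noteq> 0"
  obtains c where "H = c *\<^sub>R F"
proof (cases "H = 0")
  case True thus ?thesis using that[of 0] by simp
next
  case False
  hence "line_of_force F = line_of_force H" using assms by (auto simp: force_along_def)
  thus ?thesis using line_of_force_eq_iff[OF assms(3) False] that by blast
qed

lemma force_along_scaleR: "force_along F l \<Longrightarrow> force_along (c *\<^sub>R F) l"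
  by (cases "c = 0 \<or> F = 0") (auto simp: force_along_def line_of_force_scaleR)

section \<open>Schemes determined by leaf forces\<close>

text \<open>With the zero force included this is a linear equation for the vector of the force
  (\<open>passes_iff\<close>), so it is inherited by sums.\<close>

definition passes :: "rp2_point \<Rightarrow> force \<Rightarrow> bool" where
  "passes p F \<longleftrightarrow> F = 0 \<or> lies_on p (line_of_force F)"

lemma passes_iff: "x \<noteq> 0 \<Longrightarrow> passes (proj_point x) F \<longleftrightarrow> force_vec F \<bullet> x = 0"
  by (cases "F = 0") (auto simp: passes_def line_of_force_eq lies_on_iff)

lemma passes_add: "passes p F \<Longrightarrow> passes p H \<Longrightarrow> passes p (F + H)"
  by (cases rule: proj_point_cases[of p]) (simp add: passes_iff inner_add_left)

lemma passes_sum: "(\<And>i. i \<in> A \<Longrightarrow> passes p (f i)) \<Longrightarrow> passes p (sum f A)"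
  by (induct A rule: infinite_finite_induct) (auto intro: passes_add simp: passes_def[of p 0])

lemma non_parallel_cong:
  assumes "\<And>i. i \<in> I \<Longrightarrow> F i = F' i" shows "non_parallel I F \<longleftrightarrow> non_parallel I F'"
proof -
  have "sum F A = sum F' A" if "A \<subseteq> I" for A using that assms by (intro sum.cong) auto
  thus ?thesis unfolding non_parallel_def inj_on_def by (auto simp: psubset_eq)
qed

lemma non_parallel_nonzero:
  assumes "non_parallel I F" "A \<subseteq> I" "A \<noteq> {}" "A \<noteq> I" shows "sum F A \<noteq> 0"
  using assms unfolding non_parallel_def by blast

lemma non_parallel_member_nonzero:
  assumes "non_parallel I F" "2 \<le> card I" "i \<in> I" shows "F i \<noteq> 0"
proof -
  have "I \<noteq> {i}" using assms(2) by auto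
  thus ?thesis using non_parallel_nonzero[OF assms(1), of "{i}"] assms(3) by simp
qed

lemma non_parallel_scaleR:
  assumes "c \<noteq> 0" "non_parallel I F" shows "non_parallel I (\<lambda>i. c *\<^sub>R F i)"
proof -
  have s: "(\<Sum>i\<in>A. c *\<^sub>R F i) = c *\<^sub>R sum F A" for A by (simp add: scaleR_sum_right)
  have line: "line_of_force (c *\<^sub>R sum F A) = line_of_force (sum F A)" if "A \<subset> I" "A \<noteq> {}" for A
    using non_parallel_nonzero[OF assms(2), of A] that by (intro line_of_force_scaleR[OF assms(1)]) blast
  show ?thesis unfolding non_parallel_def s
  proof (intro conjI ballI)
    show "\<forall>A\<subseteq>I. c *\<^sub>R sum F A = 0 \<longrightarrow> A = {} \<or> A = I"
      using assms non_parallel_nonzero[OF assms(2)] by auto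
    fix r assume "r \<in> I"
    hence "inj_on (\<lambda>A. line_of_force (sum F A)) {A. r \<in> A \<and> A \<subset> I}"
      using assms(2) by (simp add: non_parallel_def)
    thus "inj_on (\<lambda>A. line_of_force (c *\<^sub>R sum F A)) {A. r \<in> A \<and> A \<subset> I}"
      using line inj_on_cong[of "{A. r \<in> A \<and> A \<subset> I}" "\<lambda>A. line_of_force (c *\<^sub>R sum F A)"
          "\<lambda>A. line_of_force (sum F A)"] by blast
  qed
qed

text \<open>Condition (2), with a common index of \<open>A\<close> and \<open>B\<close> in the role
  of the first one.\<close>

lemma non_parallel_line_neq:
  assumes "non_parallel I F" "A \<subset> I" "B \<subset> I" "A \<noteq> B" "A \<inter> B \<noteq> {}"
  shows "line_of_force (sum F A) \<noteq> line_of_force (sum F B)"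
  using assms unfolding non_parallel_def inj_on_def by blast

section \<open>The forces at all edges from those at the leaves\<close>

locale load_tree = binary_tree T for T :: "'t pair_pre_digraph" +
  fixes \<phi> :: "'t \<Rightarrow> force"
  assumes non_parallel: "non_parallel (leaf_verts T) \<phi>" and sum_zero: "sum \<phi> (leaf_verts T) = 0"
begin

text \<open>By \<open>flow\<close> this is on arcs the only candidate for an equilibrium load with
  the leaf forces \<open>\<phi>\<close>.\<close>

definition flux :: "'t \<Rightarrow> 't \<Rightarrow> force" where
  "flux x y = sum \<phi> (side x y \<inter> leaf_verts T)"

lemma flux_cut: "(x, y) \<in> parcs T \<Longrightarrow> cut T x y B \<Longrightarrow> flux x y = sum \<phi> (B \<inter> leaf_verts T)"
  using side_eq by (simp add: flux_def)

lemma flux_anti: "(x, y) \<in> parcs T \<Longrightarrow> flux x y = - flux y x"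
proof -
  assume xy: "(x, y) \<in> parcs T"
  have "sum \<phi> (side x y \<inter> leaf_verts T) + sum \<phi> (side y x \<inter> leaf_verts T)
      = sum \<phi> (side x y \<inter> leaf_verts T \<union> side y x \<inter> leaf_verts T)"
    unfolding side_compl[OF xy] by (rule sum.union_disjoint[symmetric]) auto
  also have "side x y \<inter> leaf_verts T \<union> side y x \<inter> leaf_verts T = leaf_verts T"
    unfolding side_compl[OF xy] using leaf_verts_subset by blast
  finally show ?thesis using sum_zero by (simp add: flux_def eq_neg_iff_add_eq_0)
qed

lemma side_leaves_psubset:
  assumes "(x, y) \<in> parcs T" shows "side x y \<inter> leaf_verts T \<subset> leaf_verts T"
proof -
  have "(y, x) \<in> parcs T" using assms by (subst arc_sym)
  thus ?thesis using side_contains_leaf[of y x] side_compl[OF assms] by blast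
qed

text \<open>Both sides of an edge contain a leaf, so the sum runs over a nonempty proper set of
  leaves and condition (1) applies.\<close>

lemma flux_nonzero: "(x, y) \<in> parcs T \<Longrightarrow> flux x y \<noteq> 0"
  unfolding flux_def using side_contains_leaf side_leaves_psubset
  by (intro non_parallel_nonzero[OF non_parallel]) blast+

lemma flux_leaf: "l \<in> leaf_verts T \<Longrightarrow> flux (stem T l) l = \<phi> l"
  by (simp add: flux_def side_leaf)

lemma flux_inner:
  assumes "x \<in> inner_verts T" shows "(\<Sum>y\<in>nbrs T x. flux x y) = 0"
proof -
  have x: "x \<in> pverts T" "x \<notin> leaf_verts T" using assms by (auto simp: inner_verts_eq)
  have "(\<Sum>y\<in>nbrs T x. flux x y) = sum \<phi> (\<Union>y\<in>nbrs T x. side x y \<inter> leaf_verts T)"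
    unfolding flux_def
  proof (rule sum.UNION_disjoint[symmetric])
    show "\<forall>y\<in>nbrs T x. \<forall>z\<in>nbrs T x. y \<noteq> z \<longrightarrow> side x y \<inter> leaf_verts T \<inter> (side x z \<inter> leaf_verts T) = {}"
    proof (intro ballI impI)
      fix y z assume "y \<in> nbrs T x" "z \<in> nbrs T x" "y \<noteq> z"
      hence "side x y \<inter> side x z = {}" by (intro side_disjoint) (auto simp: nbrs_def)
      thus "side x y \<inter> leaf_verts T \<inter> (side x z \<inter> leaf_verts T) = {}" by blast
    qed
  qed auto
  also have "(\<Union>y\<in>nbrs T x. side x y \<inter> leaf_verts T) = insert x (\<Union>y\<in>nbrs T x. side x y) \<inter> leaf_verts T"
    using x(2) by auto
  also have "\<dots> = leaf_verts T"
    unfolding side_cover[OF x(1)] using leaf_verts_subset by blast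
  finally show ?thesis using sum_zero by simp
qed

text \<open>The leaves behind \<open>y\<close> are a proper subset of those not behind
  \<open>z\<close>, because the third branch at \<open>x\<close> has leaves too. So condition (2)
  separates \<open>flux x y\<close> from \<open>flux z x\<close>, whose line is that of
  \<open>flux x z\<close>.\<close>

lemma flux_line_neq:
  assumes xy: "(x, y) \<in> parcs T" and xz: "(x, z) \<in> parcs T" and "y \<noteq> z"
  shows "line_of_force (flux x y) \<noteq> line_of_force (flux x z)"
proof -
  let ?l = "leaf_verts T"
  have zx: "(z, x) \<in> parcs T" using xz by (subst arc_sym)
  obtain u where "distinct [y, z, u]" "nbrs T x = {y, z, u}" by (rule third_nbr[OF xy xz \<open>y \<noteq> z\<close>])
  hence u: "(x, u) \<in> parcs T" "u \<noteq> y" "u \<noteq> z" by (auto simp: nbrs_def)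
  have "side x y \<inter> ?l \<subset> side z x \<inter> ?l"
    using side_disjoint[OF xy xz \<open>y \<noteq> z\<close>] side_disjoint[OF xy u(1)] side_disjoint[OF u(1) xz] u(2,3)
      side_contains_leaf[OF u(1)] side_compl[OF xz] leaf_verts_subset by blast
  hence "line_of_force (flux x y) \<noteq> line_of_force (flux z x)"
    unfolding flux_def using side_contains_leaf[OF xy] side_leaves_psubset[OF xy] side_leaves_psubset[OF zx]
    by (intro non_parallel_line_neq[OF non_parallel]) blast+
  thus ?thesis using flux_anti[OF xz] line_of_force_minus[OF flux_nonzero[OF zx]] by simp
qed

end

locale loaded_scheme = load_tree T \<phi> for T :: "'t pair_pre_digraph" and \<phi> +
  fixes p :: rp2_point and L :: "'t set \<Rightarrow> rp2_line"
  assumes passes: "l \<in> leaf_verts T \<Longrightarrow> passes p (\<phi> l)"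
    and line_flux: "(x, y) \<in> parcs T \<Longrightarrow> L {x, y} = line_of_force (flux x y)"
begin

lemma equilibrium_flux: "scheme_equilibrium T L flux"
  unfolding scheme_equilibrium_def force_along_def
  using line_flux flux_anti flux_inner by auto

lemma weakly_generic: "weakly_generic p T L"
  unfolding weakly_generic_def resolution_scheme_def
proof (intro conjI allI impI ballI)
  show "full_binary_tree T" by (rule full_binary_tree)
  fix e assume "e \<in> uedges T"
  then obtain x y where xy: "e = {x, y}" "(x, y) \<in> parcs T" by (auto simp: uedges_def)
  have "passes p (flux x y)" unfolding flux_def by (rule passes_sum) (auto intro: passes)
  thus "lies_on p (L e)" using xy line_flux flux_nonzero by (auto simp: passes_def)
next
  fix x y z assume a: "(x, y) \<in> parcs T \<and> (x, z) \<in> parcs T \<and> y \<noteq> z"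
  thus "L {x, y} \<noteq> L {x, z}" using flux_line_neq[of x y z] line_flux[of x y] line_flux[of x z] by auto
qed

text \<open>Each \<open>F x y\<close> is a multiple of \<open>flux x y\<close>, as both have the
  line \<open>L {x, y}\<close>. At a vertex of degree 3 the fluxes add up to zero and any two of
  them are independent, so the three factors agree. Connectedness carries the factor through the
  tree.\<close>

lemma equilibrium_proportional:
  assumes F: "scheme_equilibrium T L F" and nz: "nonzero_load T F"
  obtains c where "c \<noteq> 0" "\<And>x y. (x, y) \<in> parcs T \<Longrightarrow> F x y = c *\<^sub>R flux x y"
proof -
  have along: "force_along (F x y) (L {x, y})" and anti: "F x y = - F y x" if "(x, y) \<in> parcs T" for x y
    using F that unfolding scheme_equilibrium_def by auto
  have inner: "(\<Sum>y\<in>nbrs T x. F x y) = 0" if "x \<in> inner_verts T" for x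
    using F that unfolding scheme_equilibrium_def by auto
  have para: "\<exists>c. F x y = c *\<^sub>R flux x y" if xy: "(x, y) \<in> parcs T" for x y
    using force_along_proportional[of "flux x y" "L {x, y}" "F x y"] along[OF xy] line_flux[OF xy] flux_nonzero[OF xy]
    by (auto simp: force_along_def)
  have spread: "F x z = c *\<^sub>R flux x z" if xy: "(x, y) \<in> parcs T" and c: "F x y = c *\<^sub>R flux x y"
    and xz: "(x, z) \<in> parcs T" for x y z c
  proof (cases "y = z")
    case False
    have x: "x \<in> pverts T" using arc_pverts[OF xy] by blast
    obtain u where u: "distinct [y, z, u]" "nbrs T x = {y, z, u}" by (rule third_nbr[OF xy xz False])
    hence n: "nbrs T x = {y, z, u}" "u \<noteq> y" "u \<noteq> z" by auto
    hence xu: "(x, u) \<in> parcs T" by (auto simp: nbrs_def)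
    have i: "x \<in> inner_verts T" using x u by (simp add: inner_verts_iff)
    obtain c1 c2 where c12: "F x z = c1 *\<^sub>R flux x z" "F x u = c2 *\<^sub>R flux x u"
      using para[OF xz] para[OF xu] by blast
    have "flux x y + (flux x z + flux x u) = 0" "F x y + (F x z + F x u) = 0"
      using flux_inner[OF i] inner[OF i] n False by auto
    hence e: "flux x y = - flux x z - flux x u" "c *\<^sub>R flux x y + (c1 *\<^sub>R flux x z + c2 *\<^sub>R flux x u) = 0"
      using c c12 by (simp_all add: eq_neg_iff_add_eq_0 algebra_simps)
    \<comment> \<open>Eliminating \<open>flux x y\<close> leaves a relation between two fluxes with
      different lines.\<close>
    have e2: "(c1 - c) *\<^sub>R flux x z = (c - c2) *\<^sub>R flux x u"
      using e(2) unfolding e(1) by (simp add: algebra_simps)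
    have "c1 = c"
    proof (rule ccontr)
      assume "c1 \<noteq> c"
      hence "flux x z = (1 / (c1 - c)) *\<^sub>R ((c1 - c) *\<^sub>R flux x z)" by simp
      hence "flux x z = ((c - c2) / (c1 - c)) *\<^sub>R flux x u" unfolding e2 by simp
      thus False
        using flux_line_neq[OF xu xz] n(3) line_of_force_eq_iff[OF flux_nonzero[OF xu] flux_nonzero[OF xz]] by blast
    qed
    thus ?thesis using c12 by simp
  qed (use c in simp)
  obtain x y where xy: "(x, y) \<in> parcs T" "F x y \<noteq> 0" using nz unfolding nonzero_load_def by blast
  obtain c where c: "F x y = c *\<^sub>R flux x y" using para[OF xy(1)] by blast
  have "{u \<in> pverts T. \<forall>v. (u, v) \<in> parcs T \<longrightarrow> F u v = c *\<^sub>R flux u v} = pverts T"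
  proof (rule closed_connectedD[OF closed_connected_T])
    show "x \<in> {u \<in> pverts T. \<forall>v. (u, v) \<in> parcs T \<longrightarrow> F u v = c *\<^sub>R flux u v}"
      using spread[OF xy(1) c] arc_pverts[OF xy(1)] by blast
    fix u v assume uv: "(u, v) \<in> parcs T"
      and "u \<in> {u \<in> pverts T. \<forall>v. (u, v) \<in> parcs T \<longrightarrow> F u v = c *\<^sub>R flux u v}"
    hence "F u v = c *\<^sub>R flux u v" by blast
    moreover have vu: "(v, u) \<in> parcs T" using uv by (subst arc_sym)
    ultimately have "F v u = c *\<^sub>R flux v u" using anti[OF vu] flux_anti[OF vu] by simp
    thus "v \<in> {u \<in> pverts T. \<forall>v. (u, v) \<in> parcs T \<longrightarrow> F u v = c *\<^sub>R flux u v}"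
      using spread[OF vu] arc_pverts[OF vu] by blast
  qed blast
  hence "F u v = c *\<^sub>R flux u v" if "(u, v) \<in> parcs T" for u v using that arc_pverts[OF that] by blast
  moreover have "c \<noteq> 0" using c xy by auto
  ultimately show ?thesis using that by blast
qed

end

lemma loaded_scheme_strongly_generic:
  assumes "loaded_scheme T \<phi> p L" "leaf_verts T \<noteq> {}"
  shows "strongly_generic p T L"
proof -
  interpret loaded_scheme T \<phi> p L by fact
  obtain l where l: "l \<in> leaf_verts T" using assms(2) by blast
  have "nonzero_load T flux"
    unfolding nonzero_load_def using stem_arc[OF l] flux_nonzero[OF stem_arc[OF l]] by blast
  moreover have "non_parallel (leaf_verts T) (\<lambda>x. flux (stem T x) x)"
    using non_parallel flux_leaf by (subst non_parallel_cong[of _ _ \<phi>]) auto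
  ultimately show ?thesis
    unfolding strongly_generic_def using weakly_generic equilibrium_flux by blast
qed

text \<open>By \<open>flow\<close> the load of the scheme is the flux of its leaf forces, and as
  this flux vanishes on no edge it determines every line of the scheme.\<close>

lemma strongly_generic_loaded_scheme:
  assumes "strongly_generic p T L"
  obtains \<phi> where "loaded_scheme T \<phi> p L"
proof -
  obtain F where F: "scheme_equilibrium T L F" and np: "non_parallel (leaf_verts T) (\<lambda>x. F (stem T x) x)"
    and wg: "weakly_generic p T L" using assms by (auto simp: strongly_generic_def)
  interpret binary_tree T using wg by unfold_locales (simp add: weakly_generic_def resolution_scheme_def)
  let ?\<phi> = "\<lambda>x. F (stem T x) x"
  have along: "force_along (F x y) (L {x, y})" and anti: "F x y = - F y x" if "(x, y) \<in> parcs T" for x y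
    using F that unfolding scheme_equilibrium_def by auto
  have inner: "(\<Sum>y\<in>nbrs T x. F x y) = 0" if "x \<in> inner_verts T" for x
    using F that unfolding scheme_equilibrium_def by auto
  interpret load_tree T ?\<phi>
    by unfold_locales (use np sum_leaf_flow[of F] anti inner in auto)
  have flux: "F x y = flux x y" if "(x, y) \<in> parcs T" for x y
    unfolding flux_def using flow[OF that, of F] anti inner by blast
  have line: "L {x, y} = line_of_force (flux x y)" if "(x, y) \<in> parcs T" for x y
    using along[OF that] flux[OF that] flux_nonzero[OF that] by (auto simp: force_along_def)
  have "passes p (?\<phi> l)" if "l \<in> leaf_verts T" for l
  proof -
    have a: "(stem T l, l) \<in> parcs T" using stem_arc[OF that] by (subst arc_sym)
    hence "{stem T l, l} \<in> uedges T" by (auto simp: uedges_def)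
    hence "lies_on p (L {stem T l, l})" using wg by (auto simp: weakly_generic_def resolution_scheme_def)
    thus ?thesis using line[OF a] flux[OF a] by (simp add: passes_def)
  qed
  hence "loaded_scheme T ?\<phi> p L" using line by unfold_locales auto
  thus ?thesis by (rule that)
qed

text \<open>One orientation of each edge and any cut will do: cuts are unique, and reversing an arc
  only changes the sign of the flux.\<close>

lemma loaded_schemeI:
  assumes "full_binary_tree T" "non_parallel (leaf_verts T) \<phi>" "sum \<phi> (leaf_verts T) = 0"
    "\<And>l. l \<in> leaf_verts T \<Longrightarrow> passes p (\<phi> l)"
    and lines: "\<And>x y. (x, y) \<in> parcs T \<Longrightarrow> \<exists>a b B. {x, y} = {a, b} \<and> (a, b) \<in> parcs T \<and> cut T a b B \<and>
      L {a, b} = line_of_force (sum \<phi> (B \<inter> leaf_verts T))"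
  shows "loaded_scheme T \<phi> p L"
proof -
  interpret load_tree T \<phi> using assms by unfold_locales
  have "L {x, y} = line_of_force (flux x y)" if xy: "(x, y) \<in> parcs T" for x y
  proof -
    obtain a b B where ab: "{x, y} = {a, b}" "(a, b) \<in> parcs T" "cut T a b B"
      "L {a, b} = line_of_force (sum \<phi> (B \<inter> leaf_verts T))" using lines[OF xy] by blast
    hence "L {x, y} = line_of_force (flux a b)" using flux_cut[OF ab(2,3)] by simp
    moreover have "line_of_force (flux a b) = line_of_force (flux x y)"
      using ab(1) flux_anti[OF xy] line_of_force_minus[OF flux_nonzero[of y x]] xy arc_sym[of x y]
      by (auto simp: doubleton_eq_iff)
    ultimately show ?thesis by simp
  qed
  thus ?thesis using assms(4) by unfold_locales auto
qed

section \<open>Surgeries preserve the leaf forces\<close>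

lemma surgery_tree_surgery:
  assumes "full_binary_tree T" "surgery p T L T' L'"
  obtains F v1 v2 v3 v4 v5 v6 w1 w2 where
    "scheme_equilibrium T L F" "nonzero_load T F" "tree_surgery T v1 v2 v3 v4 v5 v6 w1 w2 T'"
    "L' {w1, v3} = L {v1, v3}" "L' {w1, v5} = L {v2, v5}" "L' {w2, v4} = L {v1, v4}" "L' {w2, v6} = L {v2, v6}"
    "L' {w1, w2} = line_of_force (F v1 v3 + F v2 v5)" "\<forall>e \<in> uedges T \<inter> uedges T'. L' e = L e"
proof -
  obtain F v1 v2 v3 v4 v5 v6 w1 w2 where *:
    "scheme_equilibrium T L F" "nonzero_load T F"
    "distinct [v2, v3, v4]" "nbrs T v1 = {v2, v3, v4}" "distinct [v1, v5, v6]" "nbrs T v2 = {v1, v5, v6}"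
    "w1 \<notin> pverts T" "w2 \<notin> pverts T" "w1 \<noteq> w2"
    "pverts T' = pverts T - {v1, v2} \<union> {w1, w2}"
    "parcs T' = {(x, y). {x, y} \<in>
           uedges T - {{v1, v2}, {v1, v3}, {v1, v4}, {v2, v5}, {v2, v6}}
             \<union> {{w1, w2}, {w1, v3}, {w1, v5}, {w2, v4}, {w2, v6}}}" and **:
    "L' {w1, v3} = L {v1, v3}" "L' {w1, v5} = L {v2, v5}" "L' {w2, v4} = L {v1, v4}" "L' {w2, v6} = L {v2, v6}"
    "L' {w1, w2} = line_of_force (F v1 v3 + F v2 v5)" "\<forall>e \<in> uedges T \<inter> uedges T'. L' e = L e"
    using assms(2) unfolding surgery_def by (elim exE conjE) (rule that; assumption)
  have "tree_surgery T v1 v2 v3 v4 v5 v6 w1 w2 T'"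
    by (rule tree_surgery.intro[OF binary_tree.intro[OF assms(1)] tree_surgery_axioms.intro]) (fact *)+
  thus ?thesis by (rule that[OF *(1,2) _ **])
qed

locale loaded_surgery = loaded_scheme T \<phi> p L + tree_surgery T v1 v2 v3 v4 v5 v6 w1 w2 T'
  for T :: "'t pair_pre_digraph" and \<phi> p L v1 v2 v3 v4 v5 v6 w1 w2 T'
begin

text \<open>The branches of \<open>v3\<close> and \<open>v5\<close> lie on different sides of the
  edge between \<open>v1\<close> and \<open>v2\<close>, so no leaf is counted twice.\<close>

lemma sum_side_union:
  "sum \<phi> (insert w1 (side v1 v3 \<union> side v2 v5) \<inter> leaf_verts T) = flux v1 v3 + flux v2 v5"
proof -
  have "v3 \<noteq> v2" using distinct_v by auto
  hence "side v1 v3 \<inter> side v1 v2 = {}" using side_disjoint[OF arcs_v1(2) arcs_v1(1)] by blast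
  hence 1: "side v1 v3 \<subseteq> side v2 v1" using side_compl[OF arcs_v1(1)] side_subset[OF arcs_v1(2)] by blast
  have "v5 \<noteq> v1" using distinct_v by auto
  hence "side v2 v5 \<inter> side v2 v1 = {}" using side_disjoint[OF arcs_v2(2) arcs_v2(1)] by blast
  hence disj: "side v1 v3 \<inter> side v2 v5 = {}" using 1 by blast
  have "w1 \<notin> leaf_verts T" using fresh leaf_verts_subset by blast
  hence "insert w1 (side v1 v3 \<union> side v2 v5) \<inter> leaf_verts T
      = side v1 v3 \<inter> leaf_verts T \<union> side v2 v5 \<inter> leaf_verts T" by blast
  thus ?thesis unfolding flux_def using disj by (simp add: sum.union_disjoint[symmetric] disjoint_iff)
qed

text \<open>A partial sum of leaf forces that contains the leaves behind \<open>v3\<close> and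
  misses those behind \<open>v4\<close>, so condition (1) applies.\<close>

lemma flux_middle_nonzero: "flux v1 v3 + flux v2 v5 \<noteq> 0"
proof -
  let ?A = "insert w1 (side v1 v3 \<union> side v2 v5) \<inter> leaf_verts T"
  interpret f: tree_surgery T v2 v1 v5 v6 v3 v4 w1 w2 T' by (rule tree_surgery_flip)
  have "side v1 v3 \<inter> side v1 v4 = {}" by (rule side_disjoint[OF arcs_v1(2,3)]) (use distinct_v in auto)
  moreover have "side v2 v5 \<inter> side v1 v4 = {}"
  proof -
    have "side v1 v4 \<inter> side v1 v2 = {}" by (rule side_disjoint[OF arcs_v1(3) arcs_v1(1)]) (use distinct_v in auto)
    hence 1: "side v1 v4 \<subseteq> side v2 v1" using side_compl[OF arcs_v1(1)] side_subset[OF arcs_v1(3)] by blast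
    have "side v2 v5 \<inter> side v2 v1 = {}" by (rule side_disjoint[OF arcs_v2(2) arcs_v2(1)]) (use distinct_v in auto)
    thus ?thesis using 1 by blast
  qed
  moreover have "w1 \<notin> side v1 v4" using side_subset[OF arcs_v1(3)] fresh by blast
  moreover obtain l where "l \<in> side v1 v4" "l \<in> leaf_verts T" using side_contains_leaf[OF arcs_v1(3)] by blast
  ultimately have "l \<notin> ?A" "l \<in> leaf_verts T" by auto
  hence "?A \<noteq> leaf_verts T" by metis
  moreover have "?A \<noteq> {}" using side_contains_leaf[OF arcs_v1(2)] by blast
  ultimately have "sum \<phi> ?A \<noteq> 0" by (intro non_parallel_nonzero[OF non_parallel Int_lower2])
  thus ?thesis unfolding sum_side_union .
qed

text \<open>Every edge of the new tree has a cut with the same leaves as the edge it comes from,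
  except the edge between \<open>w1\<close> and \<open>w2\<close>, whose cut collects the leaves
  behind \<open>v3\<close> and \<open>v5\<close>. So the new lines again come from the flux of the
  same leaf forces.\<close>

lemma loaded_scheme_surgery:
  assumes L': "L' {w1, v3} = L {v1, v3}" "L' {w1, v5} = L {v2, v5}" "L' {w2, v4} = L {v1, v4}" "L' {w2, v6} = L {v2, v6}"
    "L' {w1, w2} = line_of_force (flux v1 v3 + flux v2 v5)" "\<forall>e \<in> uedges T \<inter> uedges T'. L' e = L e"
  shows "loaded_scheme T' \<phi> p L'"
proof (rule loaded_schemeI)
  interpret s: tree_surgery T v1 v2 v4 v3 v6 v5 w2 w1 T' by (rule tree_surgery_swap)
  interpret f: tree_surgery T v2 v1 v5 v6 v3 v4 w1 w2 T' by (rule tree_surgery_flip)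
  interpret sf: tree_surgery T v2 v1 v6 v5 v4 v3 w2 w1 T' by (rule f.tree_surgery_swap)
  show "full_binary_tree T'" by (rule full_binary_tree_T')
  show "non_parallel (leaf_verts T') \<phi>" "sum \<phi> (leaf_verts T') = 0"
    using non_parallel sum_zero by (simp_all add: leaf_verts_T')
  show "passes p (\<phi> l)" if "l \<in> leaf_verts T'" for l using passes that by (simp add: leaf_verts_T')
  fix x y assume xy: "(x, y) \<in> parcs T'"
  let ?P = "\<lambda>a b. (\<exists>B. cut T' a b B \<and> L' {a, b} = line_of_force (sum \<phi> (B \<inter> leaf_verts T')))"
  have v3: "?P w1 v3"
    using cut_T'_v3 L'(1) line_flux[OF arcs_v1(2)] unfolding leaf_verts_T' flux_def by auto
  have v4: "?P w2 v4"
    using s.cut_T'_v3 L'(3) line_flux[OF arcs_v1(3)] unfolding leaf_verts_T' flux_def by auto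
  have v5: "?P w1 v5"
    using f.cut_T'_v3 L'(2) line_flux[OF arcs_v2(2)] unfolding leaf_verts_T' flux_def by auto
  have v6: "?P w2 v6"
    using sf.cut_T'_v3 L'(4) line_flux[OF arcs_v2(3)] unfolding leaf_verts_T' flux_def by auto
  have "L' {w2, w1} = line_of_force (sum \<phi> (insert w1 (side v1 v3 \<union> side v2 v5) \<inter> leaf_verts T'))"
    unfolding leaf_verts_T' sum_side_union using L'(5) by (simp only: insert_commute[of w2 w1 "{}"])
  hence mid: "?P w2 w1" using cut_T'_middle by blast
  from xy show "\<exists>a b B. {x, y} = {a, b} \<and> (a, b) \<in> parcs T' \<and> cut T' a b B \<and>
      L' {a, b} = line_of_force (sum \<phi> (B \<inter> leaf_verts T'))"
  proof (cases rule: arc_T'_cases)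
    case 1
    let ?B = "side x y - {v1, v2} \<union> (if v1 \<in> side x y then {w1, w2} else {})"
    have "{x, y} \<in> uedges T \<inter> uedges T'" using xy 1 by (auto simp: uedges_def)
    hence "L' {x, y} = line_of_force (flux x y)" using L'(6) line_flux[OF 1(1)] by simp
    \<comment> \<open>The old and the new cut differ in inner vertices only, so their leaf sums
      agree.\<close>
    moreover have "v1 \<notin> leaf_verts T" "v2 \<notin> leaf_verts T" "w1 \<notin> leaf_verts T" "w2 \<notin> leaf_verts T"
      using fresh leaf_verts_subset distinct_v nbrs_v1 nbrs_v2 by (auto simp: leaf_verts_iff)
    hence "?B \<inter> leaf_verts T = side x y \<inter> leaf_verts T" by auto
    ultimately show ?thesis
      using xy cut_T'_old[OF 1] unfolding flux_def leaf_verts_T'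
      by (intro exI[of _ x] exI[of _ y] exI[of _ ?B]) simp
  next
    case (2 a b)
    have "?P a b"
      using 2(1) by (elim insertE emptyE) (simp_all only: prod.inject v3 v4 v5 v6 mid)
    then obtain B where B: "cut T' a b B" "L' {a, b} = line_of_force (sum \<phi> (B \<inter> leaf_verts T'))" by blast
    have "{x, y} = {a, b}" "(a, b) \<in> parcs T'"
      using 2(2) xy parcs_sym[OF pair_graph_T', of x y] by auto
    thus ?thesis using B by blast
  qed
qed

end

text \<open>The load used by the surgery is a nonzero multiple of the flux, so it gives the new edge
  the same line as the flux does.\<close>

lemma surgery_loaded_scheme:
  assumes "loaded_scheme T \<phi> p L" "surgery p T L T' L'"
  shows "loaded_scheme T' \<phi> p L'" "leaf_verts T' = leaf_verts T"
proof -
  interpret loaded_scheme T \<phi> p L by fact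
  obtain F v1 v2 v3 v4 v5 v6 w1 w2 where F: "scheme_equilibrium T L F" "nonzero_load T F"
    and s: "tree_surgery T v1 v2 v3 v4 v5 v6 w1 w2 T'"
    and L': "L' {w1, v3} = L {v1, v3}" "L' {w1, v5} = L {v2, v5}" "L' {w2, v4} = L {v1, v4}" "L' {w2, v6} = L {v2, v6}"
    "L' {w1, w2} = line_of_force (F v1 v3 + F v2 v5)" "\<forall>e \<in> uedges T \<inter> uedges T'. L' e = L e"
    by (rule surgery_tree_surgery[OF full_binary_tree assms(2)])
  interpret loaded_surgery T \<phi> p L v1 v2 v3 v4 v5 v6 w1 w2 T'
    using s by (intro loaded_surgery.intro assms(1))
  obtain c where c: "c \<noteq> 0" "\<And>x y. (x, y) \<in> parcs T \<Longrightarrow> F x y = c *\<^sub>R flux x y"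
    using equilibrium_proportional[OF F] by blast
  have "F v1 v3 + F v2 v5 = c *\<^sub>R (flux v1 v3 + flux v2 v5)"
    using c(2)[OF arcs_v1(2)] c(2)[OF arcs_v2(2)] by (simp add: scaleR_add_right)
  hence "L' {w1, w2} = line_of_force (flux v1 v3 + flux v2 v5)"
    using L'(5) line_of_force_scaleR[OF c(1) flux_middle_nonzero] by simp
  thus "loaded_scheme T' \<phi> p L'" using loaded_scheme_surgery L' by blast
  show "leaf_verts T' = leaf_verts T" by (rule leaf_verts_T')
qed

lemma scheme_equivalent_loaded_scheme:
  assumes "scheme_equivalent p T L T' L'" "loaded_scheme T \<phi> p L"
  shows "loaded_scheme T' \<phi> p L' \<and> leaf_verts T' = leaf_verts T"
proof -
  have "(\<lambda>(S, M) (S', M'). surgery p S M S' M')\<^sup>*\<^sup>* (T, L) (T', L')"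
    using assms(1) by (simp add: scheme_equivalent_def)
  thus ?thesis
  proof (induct "(T', L')" arbitrary: T' L' rule: rtranclp_induct)
    case base
    thus ?case using assms(2) by simp
  next
    case (step y)
    obtain S M where y: "y = (S, M)" by (cases y)
    hence "loaded_scheme S \<phi> p M" "leaf_verts S = leaf_verts T" using step by auto
    moreover have "surgery p S M T' L'" using step(2) y by simp
    ultimately show ?case using surgery_loaded_scheme by metis
  qed
qed

section \<open>Bringing two leaves together\<close>

lemma ex_surgery:
  assumes "loaded_scheme T \<phi> p L" "leaf_verts T \<noteq> {}"
    and v1: "distinct [v2, v3, v4]" "nbrs T v1 = {v2, v3, v4}"
    and v2: "distinct [v1, v5, v6]" "nbrs T v2 = {v1, v5, v6}"
    and w: "w1 \<notin> pverts T" "w2 \<notin> pverts T" "w1 \<noteq> w2"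
  obtains T' L' where "surgery p T L T' L'" "tree_surgery T v1 v2 v3 v4 v5 v6 w1 w2 T'"
proof -
  interpret loaded_scheme T \<phi> p L by fact
  define T' where "T' = \<lparr>pverts = pverts T - {v1, v2} \<union> {w1, w2}, parcs = {(x, y). {x, y} \<in>
           uedges T - {{v1, v2}, {v1, v3}, {v1, v4}, {v2, v5}, {v2, v6}}
             \<union> {{w1, w2}, {w1, v3}, {w1, v5}, {w2, v4}, {w2, v6}}}\<rparr>"
  have TT': "pverts T' = pverts T - {v1, v2} \<union> {w1, w2}" "parcs T' = {(x, y). {x, y} \<in>
           uedges T - {{v1, v2}, {v1, v3}, {v1, v4}, {v2, v5}, {v2, v6}}
             \<union> {{w1, w2}, {w1, v3}, {w1, v5}, {w2, v4}, {w2, v6}}}" by (simp_all add: T'_def)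
  interpret tree_surgery T v1 v2 v3 v4 v5 v6 w1 w2 T'
    by (rule tree_surgery.intro[OF binary_tree_axioms tree_surgery_axioms.intro]) (fact v1 v2 w TT')+
  \<comment> \<open>All updates concern pairs with a fresh vertex, so no edge of \<open>T\<close>
    changes its line.\<close>
  define L' where "L' = L({w1, v3} := L {v1, v3}, {w1, v5} := L {v2, v5}, {w2, v4} := L {v1, v4},
    {w2, v6} := L {v2, v6}, {w1, w2} := line_of_force (flux v1 v3 + flux v2 v5))"
  have "L' e = L e" if e: "e \<in> uedges T" for e
  proof -
    have "e \<subseteq> pverts T" using e arc_pverts by (auto simp: uedges_def)
    hence "w1 \<notin> e" "w2 \<notin> e" using w by auto
    thus ?thesis unfolding L'_def by auto
  qed
  moreover have "L' {w1, v3} = L {v1, v3}" "L' {w1, v5} = L {v2, v5}" "L' {w2, v4} = L {v1, v4}"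
    "L' {w2, v6} = L {v2, v6}" "L' {w1, w2} = line_of_force (flux v1 v3 + flux v2 v5)"
    using distinct_vw unfolding L'_def by (simp_all add: doubleton_eq_iff)
  moreover have "nonzero_load T flux"
    using arcs_v1(1) flux_nonzero[OF arcs_v1(1)] unfolding nonzero_load_def by blast
  moreover have "strongly_generic p T L" by (rule loaded_scheme_strongly_generic[OF assms(1,2)])
  ultimately have facts: "\<forall>e \<in> uedges T \<inter> uedges T'. L' e = L e" "L' {w1, v3} = L {v1, v3}"
    "L' {w1, v5} = L {v2, v5}" "L' {w2, v4} = L {v1, v4}" "L' {w2, v6} = L {v2, v6}"
    "L' {w1, w2} = line_of_force (flux v1 v3 + flux v2 v5)" "nonzero_load T flux" "strongly_generic p T L"
    by blast+
  have "surgery p T L T' L'"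
    unfolding surgery_def
    by (rule conjI, fact facts, rule exI[of _ flux], rule exI[of _ v1], rule exI[of _ v2], rule exI[of _ v3],
        rule exI[of _ v4], rule exI[of _ v5], rule exI[of _ v6], rule exI[of _ w1], rule exI[of _ w2], intro conjI)
      (fact facts pverts_v v1 v2 w TT' equilibrium_flux)+
  thus ?thesis using that tree_surgery_axioms by blast
qed

text \<open>Induction on the length of the path from \<open>a\<close> to \<open>b\<close>. A surgery
  at its first interior edge, between \<open>u1\<close> and \<open>u2\<close>, attaches
  \<open>a\<close> and the next vertex \<open>u3\<close> to a common new vertex \<open>w1\<close>,
  so that \<open>a\<close>, \<open>w1\<close>, \<open>u3\<close> begin a path with one vertex
  less.\<close>

lemma join_leaves_path:
  fixes T :: "'t pair_pre_digraph"
  assumes inf: "infinite (UNIV :: 't set)" and "loaded_scheme T \<phi> p L" "3 \<le> card (leaf_verts T)"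
    "a \<in> leaf_verts T" "b \<in> leaf_verts T" "successively (\<lambda>x y. (x, y) \<in> parcs T) xs" "distinct xs"
    "xs \<noteq> []" "hd xs = a" "last xs = b" "a \<noteq> b"
  shows "\<exists>T' L' v w. scheme_equivalent p T L T' L' \<and> distinct [a, b, w] \<and> nbrs T' v = {a, b, w}"
  using assms(2-)
proof (induct "length xs" arbitrary: xs T L rule: less_induct)
  case less
  interpret loaded_scheme T \<phi> p L by fact
  have sg: "strongly_generic p T L"
    using loaded_scheme_strongly_generic[OF less.prems(1)] less.prems(3) by blast
  note na = leaf_not_adjacent[OF less.prems(2)]
  obtain u1 ys where xs: "xs = a # u1 # ys"
    using less.prems(7-10) by (metis last_ConsL list.collapse)
  have au1: "(a, u1) \<in> parcs T" using less.prems(5) xs by simp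
  hence "u1 \<noteq> b" using na[OF less.prems(3,4)] by blast
  then obtain u2 zs where ys: "ys = u2 # zs" using less.prems(9) xs by (cases ys) auto
  have u1a: "(u1, a) \<in> parcs T" using au1 by (subst arc_sym)
  have u1u2: "(u1, u2) \<in> parcs T" using less.prems(5) xs ys by simp
  show ?case
  proof (cases zs)
    \<comment> \<open>The path is \<open>a\<close>, \<open>u1\<close>, \<open>b\<close>: the two
      leaves already share the vertex \<open>u1\<close>.\<close>
    case Nil
    hence "(u1, b) \<in> parcs T" using less.prems(9) xs ys u1u2 by simp
    then obtain w where "distinct [a, b, w]" "nbrs T u1 = {a, b, w}"
      by (rule third_nbr[OF u1a _ less.prems(10)])
    moreover have "scheme_equivalent p T L T L" using sg by (simp add: scheme_equivalent_def)
    ultimately show ?thesis by blast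
  next
    case (Cons u3 rest)
    note xs' = xs[unfolded ys Cons]
    have u2u3: "(u2, u3) \<in> parcs T" and suc: "successively (\<lambda>x y. (x, y) \<in> parcs T) (u3 # rest)"
      using less.prems(5) xs' by auto
    have u2u1: "(u2, u1) \<in> parcs T" using u1u2 by (subst arc_sym)
    have d: "distinct (a # u1 # u2 # u3 # rest)" using less.prems(6) xs' by simp
    have ne: "u2 \<noteq> a" "u1 \<noteq> u3" using d by auto
    obtain v4 where v4: "distinct [u2, a, v4]" "nbrs T u1 = {u2, a, v4}"
      by (rule third_nbr[OF u1u2 u1a ne(1)])
    obtain v6 where v6: "distinct [u1, u3, v6]" "nbrs T u2 = {u1, u3, v6}"
      by (rule third_nbr[OF u2u1 u2u3 ne(2)])
    have "finite (pverts T \<union> set xs)" by simp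
    then obtain w1 where w1: "w1 \<notin> pverts T \<union> set xs" using inf by (metis ex_new_if_finite)
    have "finite (insert w1 (pverts T))" by simp
    then obtain w2 where w2: "w2 \<notin> insert w1 (pverts T)" using inf by (metis ex_new_if_finite)
    have w: "w1 \<notin> pverts T" "w2 \<notin> pverts T" "w1 \<noteq> w2" and ne: "leaf_verts T \<noteq> {}"
      using w1 w2 less.prems(3) by auto
    \<comment> \<open>Here \<open>a\<close> and \<open>u3\<close> take the places of
      \<open>v3\<close> and \<open>v5\<close>, which the surgery brings together.\<close>
    obtain T1 L1 where s: "surgery p T L T1 L1" and t: "tree_surgery T u1 u2 a v4 u3 v6 w1 w2 T1"
      by (rule ex_surgery[OF less.prems(1) ne v4 v6 w])
    interpret tree_surgery T u1 u2 a v4 u3 v6 w1 w2 T1 by (rule t)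
    have l: "loaded_scheme T1 \<phi> p L1" "leaf_verts T1 = leaf_verts T"
      using surgery_loaded_scheme[OF less.prems(1) s] by auto
    have suc1: "successively (\<lambda>x y. (x, y) \<in> parcs T1) (u3 # rest)"
      using suc by (rule successively_mono) (use d in \<open>auto simp: arc_T'_iff\<close>)
    have p1: "successively (\<lambda>x y. (x, y) \<in> parcs T1) (a # w1 # u3 # rest)"
      using suc1 by (simp add: arc_T'_iff)
    have p2: "distinct (a # w1 # u3 # rest)" using d w1 xs' by auto
    have p3: "last (a # w1 # u3 # rest) = b" using less.prems(9) xs' by simp
    have len: "length (a # w1 # u3 # rest) < length xs" unfolding xs' by simp
    have "\<exists>T' L' v w. scheme_equivalent p T1 L1 T' L' \<and> distinct [a, b, w] \<and> nbrs T' v = {a, b, w}"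
      by (rule less.hyps[OF len l(1) _ _ _ p1 p2 _ _ p3 less.prems(10), unfolded l(2), OF less.prems(2-4)]) simp_all
    then obtain T' L' v w where e: "scheme_equivalent p T1 L1 T' L'" "distinct [a, b, w]" "nbrs T' v = {a, b, w}"
      by blast
    have "scheme_equivalent p T L T' L'"
      using e(1) s sg unfolding scheme_equivalent_def
      by (intro conjI converse_rtranclp_into_rtranclp[of _ "(T, L)" "(T1, L1)"]) simp_all
    thus ?thesis using e by blast
  qed
qed

lemma join_leaves:
  fixes T :: "'t pair_pre_digraph"
  assumes inf: "infinite (UNIV :: 't set)" and ls: "loaded_scheme T \<phi> p L" and c: "3 \<le> card (leaf_verts T)"
    and ab: "a \<in> leaf_verts T" "b \<in> leaf_verts T" "a \<noteq> b"
  obtains T' L' v w where "scheme_equivalent p T L T' L'" "distinct [a, b, w]" "nbrs T' v = {a, b, w}"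
proof -
  interpret loaded_scheme T \<phi> p L by fact
  have aV: "a \<in> pverts T" "b \<in> pverts T" using ab leaf_verts_subset by auto
  have "{u \<in> pverts T. (a, u) \<in> (parcs T)\<^sup>*} = pverts T"
    by (rule closed_connectedD[OF closed_connected_T, of _ a])
      (use aV arc_pverts in \<open>auto intro: rtrancl_into_rtrancl\<close>)
  hence "(a, b) \<in> (parcs T)\<^sup>*" using aV by blast
  then obtain xs where "xs \<noteq> []" "hd xs = a" "last xs = b" "distinct xs"
    "successively (\<lambda>x y. (x, y) \<in> parcs T) xs" by (rule distinct_path)
  thus ?thesis using join_leaves_path[OF inf ls c ab(1,2)] ab(3) that by blast
qed

text \<open>If the two leaves meet at \<open>v\<close> in an equivalent scheme, equilibrium at
  \<open>v\<close> makes the third force \<open>- (\<phi> a + \<phi> b)\<close>. The leaf forces are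
  the same in all equivalent schemes, so the line does not depend on the scheme, and
  \<open>join_leaves\<close> provides one.\<close>

lemma framing_line_eq:
  fixes T :: "'t pair_pre_digraph"
  assumes inf: "infinite (UNIV :: 't set)" and ls: "loaded_scheme T \<phi> p L" and c: "3 \<le> card (leaf_verts T)"
    and ab: "a \<in> leaf_verts T" "b \<in> leaf_verts T" "a \<noteq> b"
  shows "framing_line p T L a b = line_of_force (\<phi> a + \<phi> b)"
proof -
  have *: "L' {v, w} = line_of_force (\<phi> a + \<phi> b)"
    if e: "scheme_equivalent p T L T' L'" and d: "distinct [a, b, w]" and n: "nbrs T' v = {a, b, w}" for T' L' v w
  proof -
    have l: "loaded_scheme T' \<phi> p L'" "leaf_verts T' = leaf_verts T"
      using scheme_equivalent_loaded_scheme[OF e ls] by auto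
    interpret loaded_scheme T' \<phi> p L' by (rule l)
    have va: "(v, a) \<in> parcs T'" and vb: "(v, b) \<in> parcs T'" and vw: "(v, w) \<in> parcs T'"
      using n by (auto simp: nbrs_def)
    have "a \<in> leaf_verts T'" "b \<in> leaf_verts T'" using ab l by auto
    moreover from this have "stem T' a = v" "stem T' b = v"
      using leaf_arc[of a v] leaf_arc[of b v] arc_sym[of v a] arc_sym[of v b] va vb by simp_all
    ultimately have fl: "flux v a = \<phi> a" "flux v b = \<phi> b" using flux_leaf[of a] flux_leaf[of b] by auto
    have "v \<in> inner_verts T'" using n d arc_pverts[OF va] by (auto simp: inner_verts_iff)
    hence "\<phi> a + \<phi> b + flux v w = 0" using flux_inner[of v] n d fl by (simp add: add.assoc)
    hence f: "- (\<phi> a + \<phi> b) = flux v w" by (rule minus_unique)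
    have "\<phi> a + \<phi> b \<noteq> 0"
    proof
      assume "\<phi> a + \<phi> b = 0"
      thus False using f flux_nonzero[OF vw] by simp
    qed
    from line_of_force_minus[OF this] show ?thesis unfolding f line_flux[OF vw] .
  qed
  obtain T' L' v w where e: "scheme_equivalent p T L T' L'" "distinct [a, b, w]" "nbrs T' v = {a, b, w}"
    by (rule join_leaves[OF inf ls c ab])
  show ?thesis unfolding framing_line_def
  proof (rule the_equality)
    show "\<exists>T' L' v w. scheme_equivalent p T L T' L' \<and> distinct [a, b, w] \<and> nbrs T' v = {a, b, w} \<and>
        line_of_force (\<phi> a + \<phi> b) = L' {v, w}"
      by (rule exI[of _ T'], rule exI[of _ L'], rule exI[of _ v], rule exI[of _ w])
        (intro conjI e *[OF e, symmetric])
  next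
    fix l assume "\<exists>T' L' v w. scheme_equivalent p T L T' L' \<and> distinct [a, b, w] \<and> nbrs T' v = {a, b, w} \<and> l = L' {v, w}"
    thus "l = line_of_force (\<phi> a + \<phi> b)" using * by blast
  qed
qed

section \<open>Full binary trees with a given number of leaves\<close>

text \<open>The induction step for trees with a prescribed number of leaves. Old cuts take in
  \<open>b\<close> and \<open>c\<close> together with \<open>a\<close>, and the cuts of the new
  edges are singletons.\<close>

lemma grow_leaf:
  assumes T: "full_binary_tree T" and a: "a \<in> leaf_verts T"
    and bc: "b \<notin> pverts T" "c \<notin> pverts T" "b \<noteq> c"
  obtains T' where "full_binary_tree T'" "pverts T' = pverts T \<union> {b, c}"
    "leaf_verts T' = leaf_verts T - {a} \<union> {b, c}"
proof -
  interpret binary_tree T by unfold_locales (rule T)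
  have aV: "a \<in> pverts T" using a leaf_verts_subset by blast
  define T' where "T' = \<lparr>pverts = pverts T \<union> {b, c}, parcs = parcs T \<union> {(a, b), (b, a), (a, c), (c, a)}\<rparr>"
  have V: "pverts T' = pverts T \<union> {b, c}" and E: "parcs T' = parcs T \<union> {(a, b), (b, a), (a, c), (c, a)}"
    by (simp_all add: T'_def)
  have na: "(b, u) \<notin> parcs T" "(c, u) \<notin> parcs T" "(u, b) \<notin> parcs T" "(u, c) \<notin> parcs T" for u
    using bc arc_pverts by blast+
  have ne: "a \<noteq> b" "a \<noteq> c" using aV bc by auto
  have pg: "pair_graph T'"
    unfolding pair_graph_iff V E
    using pair_graph_T aV ne by (auto simp: pair_graph_iff)
  have "nbrs T' a = nbrs T a \<union> {b, c}" using ne by (auto simp: nbrs_def E)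
  moreover have "b \<notin> nbrs T a" "c \<notin> nbrs T a" using na by (auto simp: nbrs_def)
  ultimately have card_a: "card (nbrs T' a) = 3" using bc nbrs_leaf[OF a] by simp
  have "nbrs T' b = {a}" "nbrs T' c = {a}" using na ne bc(3) by (auto simp: nbrs_def E)
  hence card_bc: "card (nbrs T' b) = 1" "card (nbrs T' c) = 1" by simp_all
  have nbrs': "nbrs T' x = nbrs T x" if "x \<notin> {a, b, c}" for x using that by (auto simp: nbrs_def E)
  have "closed_connected T'" unfolding closed_connected_def
  proof (intro conjI allI impI)
    show "pverts T' \<noteq> {}" by (simp add: V)
    fix B assume B: "B \<subseteq> pverts T' \<and> B \<noteq> {} \<and> (\<forall>u v. (u, v) \<in> parcs T' \<and> u \<in> B \<longrightarrow> v \<in> B)"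
    have abc: "b \<in> B \<longleftrightarrow> a \<in> B" "c \<in> B \<longleftrightarrow> a \<in> B" using B unfolding E by blast+
    have "\<exists>u. u \<in> B \<inter> pverts T" using B abc aV unfolding V by blast
    then obtain u where "u \<in> B \<inter> pverts T" by blast
    hence "B \<inter> pverts T = pverts T"
      using B arc_pverts by (intro closed_connectedD[OF closed_connected_T, of _ u]) (auto simp: E)
    thus "B = pverts T'" using B abc aV unfolding V by blast
  qed
  moreover have "\<exists>B. cut T' x y B" if xy: "(x, y) \<in> parcs T'" for x y
  proof -
    consider "(x, y) \<in> parcs T" | "(x, y) = (a, b)" | "(x, y) = (a, c)" | "(y, x) = (a, b)" | "(y, x) = (a, c)"
      using xy unfolding E by blast
    thus ?thesis
    proof cases
      case 1
      let ?B = "side x y \<union> (if a \<in> side x y then {b, c} else {})"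
      have "cut T' x y ?B" unfolding cut_def
      proof (intro conjI allI impI)
        show "?B \<subseteq> pverts T'" using side_subset[OF 1] by (auto simp: V)
        show "y \<in> ?B" using side_mem[OF 1] by simp
        show "x \<notin> ?B" using side_not_mem[OF 1] arc_pverts[OF 1] bc by auto
        fix u v assume uv: "(u, v) \<in> parcs T' \<and> u \<in> ?B \<and> v \<notin> ?B"
        have "b \<notin> side x y" "c \<notin> side x y" using side_subset[OF 1] bc by auto
        hence "(u, v) \<in> parcs T \<and> u \<in> side x y \<and> v \<notin> side x y"
          using uv na unfolding E by (auto split: if_splits)
        thus "u = y" "v = x" using side_arc[OF 1] by blast+
      qed
      thus ?thesis by blast
    next
      case 2
      have "cut T' a b {b}" using na ne bc unfolding cut_def V E by auto
      thus ?thesis using 2 by blast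
    next
      case 3
      have "cut T' a c {c}" using na ne bc unfolding cut_def V E by auto
      thus ?thesis using 3 by blast
    next
      case 4
      have "cut T' a b {b}" using na ne bc unfolding cut_def V E by auto
      from cut_compl[OF pg _ this] show ?thesis using 4 E by blast
    next
      case 5
      have "cut T' a c {c}" using na ne bc unfolding cut_def V E by auto
      from cut_compl[OF pg _ this] show ?thesis using 5 E by blast
    qed
  qed
  moreover have card': "card (nbrs T' x) \<in> {1, 3}" if "x \<in> pverts T'" for x
    using that card_a card_bc nbrs'[of x] card_nbrs[of x] by (cases "x \<in> {a, b, c}") (auto simp: V)
  ultimately have T': "full_binary_tree T'" using pg by (simp add: full_binary_tree_iff)
  interpret t: binary_tree T' by unfold_locales (rule T')
  have "leaf_verts T' = leaf_verts T - {a} \<union> {b, c}"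
  proof (rule set_eqI)
    fix x
    show "x \<in> leaf_verts T' \<longleftrightarrow> x \<in> leaf_verts T - {a} \<union> {b, c}"
      using card_a card_bc nbrs'[of x] ne
      by (cases "x \<in> {a, b, c}") (auto simp: leaf_verts_iff t.leaf_verts_iff V)
  qed
  thus ?thesis using that T' V by blast
qed

text \<open>Start from a single edge and grow. The set \<open>U\<close> is a reservoir of vertices,
  which later keeps the trees at different vertices of the framework disjoint.\<close>

lemma ex_full_binary_tree:
  fixes U :: "'t set"
  assumes "infinite U" "2 \<le> k"
  shows "\<exists>T. full_binary_tree T \<and> pverts T \<subseteq> U \<and> card (leaf_verts T) = k"
  using assms(2)
proof (induct k rule: dec_induct)
  case base
  obtain a where a: "a \<in> U" using assms(1) infinite_imp_nonempty by blast
  have "infinite (U - {a})" using assms(1) by simp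
  then obtain b where b: "b \<in> U" "b \<noteq> a" using infinite_imp_nonempty by blast
  define T where "T = \<lparr>pverts = {a, b}, parcs = {(a, b), (b, a)}\<rparr>"
  have V: "pverts T = {a, b}" and E: "parcs T = {(a, b), (b, a)}" by (simp_all add: T_def)
  have n: "nbrs T a = {b}" "nbrs T b = {a}" using b by (auto simp: nbrs_def E)
  have "pair_graph T" unfolding pair_graph_iff V E using b by auto
  moreover have "closed_connected T" unfolding closed_connected_def V E by blast
  moreover have "cut T a b {b}" "cut T b a {a}" using b unfolding cut_def V E by auto
  ultimately have T: "full_binary_tree T"
    unfolding full_binary_tree_iff using n by (auto simp: V E)
  interpret binary_tree T by unfold_locales (rule T)
  have "leaf_verts T = {a, b}" using n by (auto simp: leaf_verts_iff V)
  thus ?case using T V a b by (intro exI[of _ T]) auto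
next
  case (step k)
  then obtain T where T: "full_binary_tree T" "pverts T \<subseteq> U" "card (leaf_verts T) = k" by blast
  interpret binary_tree T by unfold_locales (rule T)
  obtain a where a: "a \<in> leaf_verts T" using T(3) step(1) by fastforce
  have "infinite (U - pverts T)" using assms(1) by simp
  then obtain b where b: "b \<in> U" "b \<notin> pverts T" using infinite_imp_nonempty by blast
  have "infinite (U - insert b (pverts T))" using assms(1) by simp
  then obtain c where c: "c \<in> U" "c \<notin> pverts T" "b \<noteq> c" using infinite_imp_nonempty by blast
  obtain T' where T': "full_binary_tree T'" "pverts T' = pverts T \<union> {b, c}"
    "leaf_verts T' = leaf_verts T - {a} \<union> {b, c}" by (rule grow_leaf[OF T(1) a b(2) c(2,3)])
  have "b \<notin> leaf_verts T" "c \<notin> leaf_verts T" using b c leaf_verts_subset by auto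
  hence "card (leaf_verts T') = Suc k"
    unfolding T'(3) using a T(3) c(3) step(1) by (simp add: card_Diff_singleton)
  thus ?case using T' T b c by (intro exI[of _ T']) auto
qed

section \<open>Monodromy in coordinates\<close>

lemma det_zero:
  fixes a b c x :: "real^3"
  assumes "(a \<times> b) \<bullet> c \<noteq> 0" "x \<bullet> a = 0" "x \<bullet> b = 0" "x \<bullet> c = 0"
  shows "x = 0"
proof -
  have "a \<times> b \<noteq> 0" using assms(1) by auto
  then obtain k where k: "x = k *\<^sub>R (a \<times> b)" using orthogonal_to_independent assms(2,3) by blast
  hence "k * ((a \<times> b) \<bullet> c) = 0" using assms(4) by simp
  thus ?thesis using k assms(1) by simp
qed

text \<open>On the line with normal vector \<open>n1 - b1 n0\<close> the ratio of the functionals \<open>n1\<close> and \<open>\<nu>\<close> is a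
  coordinate, and one shift multiplies it by \<open>b2\<close>.\<close>

lemma shift_coordinates:
  fixes n0 n1 n2 \<nu> x :: "real^3"
  assumes d1: "(n1 \<times> n0) \<bullet> \<nu> \<noteq> 0" and d2: "(n2 \<times> n1) \<bullet> \<nu> \<noteq> 0" and b: "b1 \<noteq> 0"
    and x: "x \<noteq> 0" "(n1 - b1 *\<^sub>R n0) \<bullet> x = 0"
  obtains y D where "y \<noteq> 0" "(n2 - b2 *\<^sub>R n1) \<bullet> y = 0" "D \<noteq> 0"
    "n2 \<bullet> y = D * b2 * (n1 \<bullet> x)" "\<nu> \<bullet> y = D * (\<nu> \<bullet> x)"
    "meet (normal_line (n2 - b2 *\<^sub>R n1)) (join (proj_point x) (meet (normal_line n1) (normal_line \<nu>))) = proj_point y"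
proof -
  \<comment> \<open>Here \<open>a\<close> represents the point where the edge line meets the
    auxiliary line, \<open>\<mu>\<close> is a normal vector of the line joining it to
    \<open>x\<close>, \<open>m\<close> one of the next framing line, and \<open>y\<close> represents
    the image of \<open>x\<close> under the shift.\<close>
  define a where "a = n1 \<times> \<nu>"
  define \<mu> where "\<mu> = x \<times> a"
  define m where "m = n2 - b2 *\<^sub>R n1"
  define y where "y = m \<times> \<mu>"
  define D where "D = (n2 \<times> n1) \<bullet> \<nu>"
  have a0: "a \<noteq> 0"
  proof
    assume "a = 0"
    hence "(\<nu> \<times> n1) \<bullet> n0 = 0" using cross_skew[of \<nu> n1] by (simp add: a_def)
    thus False using d1 cross_triple[of \<nu> n1 n0] by simp
  qed
  \<comment> \<open>So \<open>x\<close> does not represent the same point as \<open>a\<close>, and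
    the join is defined: otherwise the framing equation would make \<open>n0\<close> vanish at
    \<open>x\<close> too, while \<open>n0\<close>, \<open>n1\<close>, \<open>\<nu>\<close> are
    independent.\<close>
  have nl: "\<not> (n1 \<bullet> x = 0 \<and> \<nu> \<bullet> x = 0)"
  proof
    assume z: "n1 \<bullet> x = 0 \<and> \<nu> \<bullet> x = 0"
    hence "n0 \<bullet> x = 0" using x(2) b by (simp add: inner_diff_left)
    hence "x = 0" using z by (intro det_zero[OF d1]) (simp_all add: inner_commute)
    thus False using x by simp
  qed
  have \<mu>: "\<mu> = (x \<bullet> \<nu>) *\<^sub>R n1 - (x \<bullet> n1) *\<^sub>R \<nu>" by (simp add: \<mu>_def a_def Lagrange)
  have mD: "(m \<times> n1) \<bullet> \<nu> = D"
    by (simp add: m_def D_def Cross3.left_diff_distrib cross_mult_left)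
  have yl: "\<nu> \<bullet> y = D * (\<nu> \<bullet> x)"
  proof -
    have "\<nu> \<bullet> y = (x \<bullet> \<nu>) * ((m \<times> n1) \<bullet> \<nu>) - (x \<bullet> n1) * ((m \<times> \<nu>) \<bullet> \<nu>)"
      unfolding y_def \<mu> by (simp add: Cross3.right_diff_distrib cross_mult_right inner_diff_right inner_commute)
    thus ?thesis by (simp add: mD dot_cross_self inner_commute[of x])
  qed
  have yn: "n1 \<bullet> y = D * (n1 \<bullet> x)"
  proof -
    have "n1 \<bullet> y = (x \<bullet> \<nu>) * ((m \<times> n1) \<bullet> n1) - (x \<bullet> n1) * ((m \<times> \<nu>) \<bullet> n1)"
      unfolding y_def \<mu> by (simp add: Cross3.right_diff_distrib cross_mult_right inner_diff_right inner_commute)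
    moreover have "(m \<times> \<nu>) \<bullet> n1 = - D"
      using cross_triple[of n1 m \<nu>] cross_skew[of n1 m] mD by simp
    ultimately show ?thesis by (simp add: dot_cross_self inner_commute[of x])
  qed
  have D: "D \<noteq> 0" using d2 by (simp add: D_def)
  have y0: "y \<noteq> 0" using yl yn nl D by auto
  have my: "m \<bullet> y = 0" by (simp add: y_def dot_cross_self)
  have y2: "n2 \<bullet> y = D * b2 * (n1 \<bullet> x)" using my yn by (simp add: m_def inner_diff_left)
  have "\<mu> \<noteq> 0" using y0 by (auto simp: y_def)
  hence "join (proj_point x) (proj_point a) = normal_line \<mu>" unfolding \<mu>_def by (rule join_proj_point)
  moreover have "meet (normal_line n1) (normal_line \<nu>) = proj_point a"
    using a0 unfolding a_def by (rule meet_normal_line)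
  moreover have "meet (normal_line m) (normal_line \<mu>) = proj_point y"
    using y0 unfolding y_def by (rule meet_normal_line)
  ultimately show ?thesis using that[OF y0 _ D y2 yl] my unfolding m_def by simp
qed

text \<open>A framing line passes through the common point of two consecutive edge lines, so its
  normal vector is a combination of theirs, scaled here to have the coefficients 1 and
  \<open>- b r\<close>. The determinant condition says that the auxiliary line misses the vertices
  of the polygon. The indices run over all natural numbers, with \<open>n\<close> and
  \<open>m\<close> periodic.\<close>

locale framed_polygon =
  fixes qs :: "rp2_point list" and ls :: "rp2_line list" and n m :: "nat \<Rightarrow> real^3"
    and b :: "nat \<Rightarrow> real" and \<nu> :: "real^3"
  assumes qs_nonempty: "qs \<noteq> []"
    and edge_line_n: "edge_line qs r = normal_line (n r)"
    and line_m: "ls ! (r mod length qs) = normal_line (m r)"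
    and m_eq: "m (Suc r) = n (Suc r) - b r *\<^sub>R n r"
    and b_nonzero: "b r \<noteq> 0"
    and det_nonzero: "(n (Suc r) \<times> n r) \<bullet> \<nu> \<noteq> 0"
    and periodic: "n (r + length qs) = n r" "m (r + length qs) = m r"
begin

lemma m_nonzero: "m r \<noteq> 0" and m_decomp: "\<exists>n' b'. m r = n r - b' *\<^sub>R n' \<and> b' \<noteq> 0 \<and> (n r \<times> n') \<bullet> \<nu> \<noteq> 0"
proof -
  \<comment> \<open>Shifting the index by a full period provides a predecessor also for
    \<open>r = 0\<close>.\<close>
  obtain k where k: "r + length qs = Suc k" using qs_nonempty by (cases "length qs") auto
  have "m r = n r - b k *\<^sub>R n k" using m_eq[of k] periodic[of r] k by simp
  moreover have d: "(n r \<times> n k) \<bullet> \<nu> \<noteq> 0" using det_nonzero[of k] periodic[of r] k by simp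
  ultimately show "\<exists>n' b'. m r = n r - b' *\<^sub>R n' \<and> b' \<noteq> 0 \<and> (n r \<times> n') \<bullet> \<nu> \<noteq> 0"
    using b_nonzero by blast
  show "m r \<noteq> 0"
  proof
    assume "m r = 0"
    hence "n r = b k *\<^sub>R n k" using \<open>m r = n r - b k *\<^sub>R n k\<close> by simp
    thus False using d by (simp add: cross_mult_left)
  qed
qed

text \<open>The factor \<open>K\<close> absorbs the choice of the representative \<open>y\<close>.
  It cancels in the ratio of the functionals \<open>n\<close> and \<open>\<nu>\<close>, which is
  multiplied by one \<open>b j\<close> in each shift.\<close>

lemma monodromy_coordinates:
  assumes "x \<noteq> 0" "m r \<bullet> x = 0"
  shows "\<exists>y K. y \<noteq> 0 \<and> m (r + k) \<bullet> y = 0 \<and> K \<noteq> 0 \<and> n (r + k) \<bullet> y = K * (\<Prod>j\<in>{r..<r+k}. b j) * (n r \<bullet> x) \<and>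
     \<nu> \<bullet> y = K * (\<nu> \<bullet> x) \<and> fold (shift qs ls (normal_line \<nu>)) [r..<r + k] (proj_point x) = proj_point y"
proof (induct k)
  case 0
  show ?case using assms by (intro exI[of _ x] exI[of _ 1]) simp
next
  case (Suc k)
  then obtain y K where y: "y \<noteq> 0" "m (r + k) \<bullet> y = 0" "K \<noteq> 0"
    "n (r + k) \<bullet> y = K * (\<Prod>j\<in>{r..<r+k}. b j) * (n r \<bullet> x)" "\<nu> \<bullet> y = K * (\<nu> \<bullet> x)"
    "fold (shift qs ls (normal_line \<nu>)) [r..<r + k] (proj_point x) = proj_point y" by blast
  obtain n' b' where m': "m (r + k) = n (r + k) - b' *\<^sub>R n'" "b' \<noteq> 0" "(n (r + k) \<times> n') \<bullet> \<nu> \<noteq> 0"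
    using m_decomp[of "r + k"] by blast
  obtain z D where z: "z \<noteq> 0" "(n (Suc (r + k)) - b (r + k) *\<^sub>R n (r + k)) \<bullet> z = 0" "D \<noteq> 0"
    "n (Suc (r + k)) \<bullet> z = D * b (r + k) * (n (r + k) \<bullet> y)" "\<nu> \<bullet> z = D * (\<nu> \<bullet> y)"
    "meet (normal_line (n (Suc (r + k)) - b (r + k) *\<^sub>R n (r + k)))
       (join (proj_point y) (meet (normal_line (n (r + k))) (normal_line \<nu>))) = proj_point z"
    by (rule shift_coordinates[OF m'(3) det_nonzero m'(2) y(1) y(2)[unfolded m'(1)]])
  have "shift qs ls (normal_line \<nu>) (r + k) (proj_point y) = proj_point z"
    unfolding shift_def line_m edge_line_n m_eq using z(6) .
  hence "fold (shift qs ls (normal_line \<nu>)) [r..<r + Suc k] (proj_point x) = proj_point z"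
    using y(6) by simp
  moreover have "n (r + Suc k) \<bullet> z = (D * K) * (\<Prod>j\<in>{r..<r + Suc k}. b j) * (n r \<bullet> x)"
    using z(4) y(4) by simp
  moreover have "\<nu> \<bullet> z = (D * K) * (\<nu> \<bullet> x)" using z(5) y(5) by simp
  moreover have "m (r + Suc k) \<bullet> z = 0" using z(2) m_eq[of "r + k"] by simp
  ultimately show ?case using z(1,3) y(3)
    by (intro exI[of _ z] exI[of _ "D * K"]) simp
qed

text \<open>After a full turn the functionals are the same again, so the monodromy multiplies their
  ratio by the product of all \<open>b j\<close>.\<close>

lemma monodromy_identity_iff:
  assumes r: "r < length qs"
  shows "(\<forall>p. lies_on p (ls ! r) \<longrightarrow> monodromy qs ls (normal_line \<nu>) r p = p)
    \<longleftrightarrow> (\<Prod>j\<in>{r..<r+length qs}. b j) = 1" (is "?id \<longleftrightarrow> ?P = 1")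
proof -
  have lr: "ls ! r = normal_line (m r)" using line_m[of r] r by simp
  obtain n' b' where m': "m r = n r - b' *\<^sub>R n'" "b' \<noteq> 0" "(n r \<times> n') \<bullet> \<nu> \<noteq> 0"
    using m_decomp[of r] by blast
  have n0: "n' \<bullet> x = 0" if "m r \<bullet> x = 0" "n r \<bullet> x = 0" for x
    using that m' by (simp add: inner_diff_left)
  show ?thesis
  proof
    assume id: ?id
    \<comment> \<open>The point of the framing line with coordinate 1, where \<open>n r\<close> and
      \<open>\<nu>\<close> take the same value. Already one fixed point at which neither functional
      vanishes forces the product to be 1.\<close>
    define x where "x = m r \<times> (n r - \<nu>)"
    have d: "(m r \<times> n r) \<bullet> \<nu> = b' * ((n r \<times> n') \<bullet> \<nu>)"
      using cross_skew[of n' "n r"] by (simp add: m' Cross3.left_diff_distrib cross_mult_left)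
    have "\<nu> \<bullet> x = (m r \<times> n r) \<bullet> \<nu>"
      by (simp add: x_def Cross3.right_diff_distrib inner_diff_right dot_cross_self inner_commute)
    hence l: "\<nu> \<bullet> x \<noteq> 0" using d m' by simp
    have "n r \<bullet> x = - ((m r \<times> \<nu>) \<bullet> n r)"
      by (simp add: x_def Cross3.right_diff_distrib inner_diff_right dot_cross_self inner_commute)
    also have "\<dots> = (m r \<times> n r) \<bullet> \<nu>"
      using cross_triple[of "n r" "m r" \<nu>] cross_skew[of "n r" "m r"] by simp
    finally have nx: "n r \<bullet> x \<noteq> 0" using d m' by simp
    have x0: "x \<noteq> 0" using l by auto
    have mx: "m r \<bullet> x = 0" by (simp add: x_def dot_cross_self)
    obtain y K where y: "y \<noteq> 0" "K \<noteq> 0" "n (r + length qs) \<bullet> y = K * ?P * (n r \<bullet> x)" "\<nu> \<bullet> y = K * (\<nu> \<bullet> x)"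
      "fold (shift qs ls (normal_line \<nu>)) [r..<r + length qs] (proj_point x) = proj_point y"
      using monodromy_coordinates[OF x0 mx, of "length qs"] by blast
    have "lies_on (proj_point x) (ls ! r)" unfolding lr using lies_on_iff[OF x0 m_nonzero] mx by simp
    hence "proj_point x = proj_point y" using id y(5) by (simp add: monodromy_def)
    hence "x \<times> y = 0" using proj_point_eq_iff x0 y(1) by blast
    then obtain c where c: "y = c *\<^sub>R x" using cross_eq_0_parallel x0 by blast
    have "c = K" using y(4) l unfolding c by simp
    hence "K * (n r \<bullet> x) = K * ?P * (n r \<bullet> x)" using y(3) unfolding c by (simp add: periodic)
    thus "?P = 1" using nx y(2) by simp
  next
    assume P: "?P = 1"
    show ?id
    proof (intro allI impI)
      fix p assume p: "lies_on p (ls ! r)"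
      obtain x where x: "x \<noteq> 0" "p = proj_point x" by (rule proj_point_cases)
      have mx: "m r \<bullet> x = 0" using p x lies_on_iff[OF x(1) m_nonzero] lr by simp
      obtain y K where y: "y \<noteq> 0" "m (r + length qs) \<bullet> y = 0" "K \<noteq> 0"
        "n (r + length qs) \<bullet> y = K * ?P * (n r \<bullet> x)" "\<nu> \<bullet> y = K * (\<nu> \<bullet> x)"
        "fold (shift qs ls (normal_line \<nu>)) [r..<r + length qs] (proj_point x) = proj_point y"
        using monodromy_coordinates[OF x(1) mx, of "length qs"] by blast
      \<comment> \<open>The independent functionals \<open>n r\<close>, \<open>n'\<close> and
        \<open>\<nu>\<close> all vanish at \<open>w\<close>, so \<open>y\<close> is a multiple of
        \<open>x\<close>.\<close>
      define w where "w = y - K *\<^sub>R x"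
      have w1: "n r \<bullet> w = 0" using y(4) P by (simp add: w_def inner_diff_right periodic)
      have w2: "\<nu> \<bullet> w = 0" using y(5) by (simp add: w_def inner_diff_right)
      have "m r \<bullet> w = 0" using y(2) mx by (simp add: w_def inner_diff_right periodic)
      hence "n' \<bullet> w = 0" using n0 w1 by blast
      hence "w = 0" using w1 w2 by (intro det_zero[OF m'(3)]) (simp_all add: inner_commute)
      hence "y = K *\<^sub>R x" by (simp add: w_def)
      thus "monodromy qs ls (normal_line \<nu>) r p = p"
        using y(6) proj_point_scaleR[OF y(3)] x by (simp add: monodromy_def)
    qed
  qed
qed

end

section \<open>Existence of an admissible line\<close>

lemma ex_inner_nonzero:
  fixes Y :: "'c::euclidean_space set"
  assumes "finite Y" "0 \<notin> Y"
  shows "\<exists>l. \<forall>y\<in>Y. l \<bullet> y \<noteq> 0"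
  using assms
proof (induct Y rule: finite_induct)
  case (insert y Y)
  then obtain l where l: "\<forall>z\<in>Y. l \<bullet> z \<noteq> 0" by auto
  \<comment> \<open>Perturb \<open>l\<close> in the direction of \<open>y\<close>. Each vector that
    is not orthogonal to \<open>y\<close> excludes one value of \<open>e\<close>; the others keep
    their inner product with \<open>l\<close>.\<close>
  have "finite (insert (- (l \<bullet> y) / (y \<bullet> y)) ((\<lambda>z. - (l \<bullet> z) / (y \<bullet> z)) ` Y))" using insert by simp
  then obtain e :: real where e: "e \<notin> insert (- (l \<bullet> y) / (y \<bullet> y)) ((\<lambda>z. - (l \<bullet> z) / (y \<bullet> z)) ` Y)"
    using infinite_UNIV_char_0 ex_new_if_finite by blast
  have "(l + e *\<^sub>R y) \<bullet> z \<noteq> 0" if "z \<in> insert y Y" for z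
  proof
    assume "(l + e *\<^sub>R y) \<bullet> z = 0"
    hence *: "e * (y \<bullet> z) = - (l \<bullet> z)" by (simp add: inner_add_left)
    show False
    proof (cases "y \<bullet> z = 0")
      case True
      hence "l \<bullet> z = 0" using * by simp
      thus False using that l True insert.prems by auto
    next
      case False
      hence "e = - (l \<bullet> z) / (y \<bullet> z)" using * by (simp add: field_simps)
      thus False using e that by auto
    qed
  qed
  thus ?case by blast
qed auto

text \<open>General position leaves finitely many intersection points, each of which excludes a
  plane of normal vectors.\<close>

lemma ex_admissible_line:
  assumes "lines_general_position (edge_lines qs)"
  obtains \<nu> where "\<nu> \<noteq> 0" "admissible_line qs (normal_line \<nu>)"
proof -
  define X where "X = {x. \<exists>i j. i < j \<and> j < length (edge_lines qs) \<and>
    lies_on x (edge_lines qs ! i) \<and> lies_on x (edge_lines qs ! j)}"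
  have fin: "finite X" using assms by (simp add: lines_general_position_def X_def Let_def)
  have "\<forall>x. \<exists>y. y \<noteq> 0 \<and> x = proj_point y"
  proof
    fix x show "\<exists>y. y \<noteq> 0 \<and> x = proj_point y" by (rule proj_point_cases[of x]) blast
  qed
  then obtain f where f: "\<And>x. f x \<noteq> 0" "\<And>x. x = proj_point (f x)" by (auto dest!: choice)
  \<comment> \<open>This additional vector ensures \<open>\<nu> \<noteq> 0\<close> even if there are
    no intersection points.\<close>
  have "axis 1 1 \<noteq> (0 :: real^3)" by (simp add: axis_eq_0_iff)
  hence "0 \<notin> insert (axis 1 1) (f ` X)" using f(1) by (metis imageE insertE)
  hence "\<exists>l. \<forall>y \<in> insert (axis 1 1) (f ` X). l \<bullet> y \<noteq> 0" using fin by (intro ex_inner_nonzero) simp_all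
  then obtain \<nu> :: "real^3" where l: "\<forall>y \<in> insert (axis 1 1) (f ` X). \<nu> \<bullet> y \<noteq> 0" by blast
  have "\<nu> \<noteq> 0" using l by auto
  moreover have "admissible_line qs (normal_line \<nu>)" unfolding admissible_line_def
  proof (intro allI impI)
    fix i j x assume a: "i < j \<and> j < length qs \<and> lies_on x (edge_line qs i) \<and> lies_on x (edge_line qs j)"
    hence "x \<in> X" unfolding X_def edge_lines_def mem_Collect_eq
      by (intro exI[of _ i] exI[of _ j]) simp
    hence "\<nu> \<bullet> f x \<noteq> 0" using l by blast
    thus "\<not> lies_on x (normal_line \<nu>)" using lies_on_iff[OF f(1) \<open>\<nu> \<noteq> 0\<close>, of x] f(2)[of x] by simp
  qed
  ultimately show ?thesis using that by blast
qed

section \<open>The monodromy of a cycle of forces\<close>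

text \<open>Among at least three forces a pair is a proper subset, so conditions (1) and (2) apply
  to \<open>{j, k}\<close> and to the singletons. If \<open>F j\<close> and \<open>F k\<close> were
  parallel, their sum would have the line of \<open>F j\<close>.\<close>

lemma non_parallel_pair:
  assumes np: "non_parallel I F" and c: "3 \<le> card I" and jk: "j \<in> I" "k \<in> I" "j \<noteq> k"
  shows "F j + F k \<noteq> 0" "line_of_force (F j + F k) \<noteq> line_of_force (F j)"
    "line_of_force (F j + F k) \<noteq> line_of_force (F k)" "force_vec (F j) \<times> force_vec (F k) \<noteq> 0"
proof -
  have "card {j, k} < card I" "card {j} < card I" "card {k} < card I" using c jk by auto
  hence ne: "{j, k} \<noteq> I" "{j} \<noteq> I" "{k} \<noteq> I" by auto
  have j: "F j \<noteq> 0" using c jk by (intro non_parallel_member_nonzero[OF np]) auto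
  show jk0: "F j + F k \<noteq> 0" using non_parallel_nonzero[OF np, of "{j, k}"] ne jk by simp
  show lj: "line_of_force (F j + F k) \<noteq> line_of_force (F j)"
    using non_parallel_line_neq[OF np, of "{j, k}" "{j}"] ne jk by auto
  show "line_of_force (F j + F k) \<noteq> line_of_force (F k)"
    using non_parallel_line_neq[OF np, of "{j, k}" "{k}"] ne jk by auto
  show "force_vec (F j) \<times> force_vec (F k) \<noteq> 0"
  proof
    assume "force_vec (F j) \<times> force_vec (F k) = 0"
    hence "force_vec (F j + F k) \<times> force_vec (F j) = 0"
      using cross_skew[of "force_vec (F k)" "force_vec (F j)"] by (simp add: cross_add_left)
    thus False using lj j jk0 by (simp add: line_of_force_eq normal_line_eq_iff del: force_vec_add)
  qed
qed

lemma prod_periodic: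
  fixes b :: "nat \<Rightarrow> 'c::field"
  assumes "\<And>j. b (j + s) = b j" "\<And>j. b j \<noteq> 0"
  shows "(\<Prod>j\<in>{r..<r+s}. b j) = (\<Prod>j<s. b j)"
proof (induct r)
  case 0
  show ?case by (simp add: lessThan_atLeast0)
next
  case (Suc r)
  have "(\<Prod>j\<in>{Suc r..<Suc r+s}. b j) * b r = (\<Prod>j\<in>{r..<Suc (r + s)}. b j)"
    by (simp add: prod.atLeast_Suc_lessThan[of r] mult.commute)
  also have "\<dots> = (\<Prod>j\<in>{r..<r+s}. b j) * b r" by (simp add: assms(1))
  finally show ?case using Suc assms(2) by simp
qed

text \<open>The sign makes gain 1 the balance of the two forces at an edge. Rescaling the forces at
  each \<open>i\<close> by \<open>c i\<close> turns \<open>g i j\<close> into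
  \<open>c j * g i j / c i\<close>, which leaves the products along cycles unchanged.\<close>

locale gain_framework =
  fixes G :: "'v pair_pre_digraph" and P :: "'v \<Rightarrow> rp2_point" and \<phi> :: "'v \<Rightarrow> 'v \<Rightarrow> force"
    and g :: "'v \<Rightarrow> 'v \<Rightarrow> real"
  assumes pair_graph_G: "pair_graph G"
    and framework: "framework G P"
    and degree: "i \<in> pverts G \<Longrightarrow> 3 \<le> card (nbrs G i)"
    and non_parallel: "i \<in> pverts G \<Longrightarrow> non_parallel (nbrs G i) (\<phi> i)"
    and line: "(i, j) \<in> parcs G \<Longrightarrow> line_of_force (\<phi> i j) = join (P i) (P j)"
    and gain: "(i, j) \<in> parcs G \<Longrightarrow> \<phi> j i = - g i j *\<^sub>R \<phi> i j"
begin

lemma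
  assumes "(i, j) \<in> parcs G" "(i, k) \<in> parcs G" "j \<noteq> k"
  shows sum_nonzero: "\<phi> i j + \<phi> i k \<noteq> 0"
    and sum_line: "line_of_force (\<phi> i j + \<phi> i k) \<noteq> join (P i) (P j)"
      "line_of_force (\<phi> i j + \<phi> i k) \<noteq> join (P i) (P k)"
    and cross_nonzero: "force_vec (\<phi> i j) \<times> force_vec (\<phi> i k) \<noteq> 0"
proof -
  have i: "i \<in> pverts G" using parcs_pverts[OF pair_graph_G assms(1)] by simp
  have "j \<in> nbrs G i" "k \<in> nbrs G i" using assms by (auto simp: nbrs_def)
  note * = non_parallel_pair[OF non_parallel[OF i] degree[OF i] this assms(3)]
  show "\<phi> i j + \<phi> i k \<noteq> 0" "force_vec (\<phi> i j) \<times> force_vec (\<phi> i k) \<noteq> 0" by (fact *)+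
  show "line_of_force (\<phi> i j + \<phi> i k) \<noteq> join (P i) (P j)"
    "line_of_force (\<phi> i j + \<phi> i k) \<noteq> join (P i) (P k)" using * line assms by auto
qed

lemma force_nonzero: assumes "(i, j) \<in> parcs G" shows "\<phi> i j \<noteq> 0"
proof -
  have i: "i \<in> pverts G" using parcs_pverts[OF pair_graph_G assms] by simp
  thus ?thesis
    using degree[OF i] assms by (intro non_parallel_member_nonzero[OF non_parallel[OF i]]) (auto simp: nbrs_def)
qed

lemma gain_nonzero: assumes "(i, j) \<in> parcs G" shows "g i j \<noteq> 0"
proof
  assume "g i j = 0"
  hence "\<phi> j i = 0" using gain[OF assms] by simp
  thus False using force_nonzero assms parcs_sym[OF pair_graph_G] by blast
qed

lemma gain_inverse: assumes ij: "(i, j) \<in> parcs G" shows "g i j * g j i = 1"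
proof -
  have "(j, i) \<in> parcs G" using ij parcs_sym[OF pair_graph_G] by blast
  hence "\<phi> i j = - g j i *\<^sub>R (- g i j *\<^sub>R \<phi> i j)" using gain[OF ij] gain[of j i] by simp
  hence "(g i j * g j i) *\<^sub>R \<phi> i j = 1 *\<^sub>R \<phi> i j" by (simp add: mult.commute)
  thus ?thesis using force_nonzero[OF ij] unfolding scaleR_cancel_right by simp
qed

lemma vertices_distinct: "(i, j) \<in> parcs G \<Longrightarrow> P i \<noteq> P j"
  using framework by (auto simp: framework_def)

lemma passes_force: assumes "(i, j) \<in> parcs G" shows "passes (P i) (\<phi> i j)"
  using line[OF assms] lies_on_join(1)[OF vertices_distinct[OF assms]] by (simp add: passes_def)

text \<open>By the gain relation the sum of the two forces along the cycle at a vertex has the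
  vector \<open>n (Suc r) - b r *\<^sub>R n r\<close>, where \<open>b\<close> are the gains. This is
  the shape required in \<open>framed_polygon\<close>.\<close>

lemma cycle_condition_iff:
  assumes q: "simple_cycle G q" and gp: "lines_general_position (edge_lines (map P q))"
    and ls: "length ls = length q"
      "\<And>r. r < length q \<Longrightarrow> ls ! r = line_of_force
        (\<phi> (q ! r) (q ! ((r + length q - 1) mod length q)) + \<phi> (q ! r) (q ! (Suc r mod length q)))"
  shows "monodromy_cycle_condition (map P q) ls \<longleftrightarrow> walk_gain g (q @ [hd q]) = 1"
proof -
  define s where "s = length q"
  \<comment> \<open>With indices modulo \<open>s\<close> the predecessor of \<open>r\<close> is
    \<open>r + s - 1\<close>, and the ends of the list need no separate treatment.\<close>
  define v where "v r = q ! (r mod s)" for r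
  have s3: "3 \<le> s" and d: "distinct q" using q by (auto simp: simple_cycle_def s_def)
  have lt: "k mod s < s" for k using s3 by simp
  have arc: "(v r, v (Suc r)) \<in> parcs G" for r
  proof -
    have "(q ! (r mod s), q ! (Suc (r mod s) mod s)) \<in> parcs G"
      using q lt[of r] unfolding simple_cycle_def s_def by blast
    thus ?thesis by (simp add: v_def mod_Suc_eq)
  qed
  have arc': "(v (Suc r), v r) \<in> parcs G" for r using arc[of r] parcs_sym[OF pair_graph_G] by blast
  have vs: "v (r + s) = v r" for r by (simp add: v_def)
  have mod_neq: "r mod s \<noteq> Suc r mod s" "r mod s \<noteq> Suc (Suc r) mod s" for r
    using s3 by (auto simp: mod_Suc split: if_splits)
  have v_neq: "v r \<noteq> v (Suc (Suc r))" for r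
    using nth_eq_iff_index_eq[OF d lt[unfolded s_def] lt[unfolded s_def]] mod_neq(2)[of r]
    unfolding v_def s_def by blast
  define n where "n r = force_vec (\<phi> (v r) (v (Suc r)))" for r
  define b where "b r = g (v r) (v (Suc r))" for r
  define m where "m r = force_vec (\<phi> (v r) (v (r + s - 1)) + \<phi> (v r) (v (Suc r)))" for r
  have n_edge: "edge_line (map P q) r = normal_line (n r)" for r
  proof -
    have "edge_line (map P q) r = join (P (v r)) (P (v (Suc r)))"
      using lt[of r] lt[of "Suc r"] by (simp add: edge_line_def v_def s_def)
    also have "\<dots> = line_of_force (\<phi> (v r) (v (Suc r)))" using line[OF arc] by simp
    finally show ?thesis using force_nonzero[OF arc] by (simp add: line_of_force_eq n_def)
  qed
  have n_nonzero: "n r \<noteq> 0" for r using force_nonzero[OF arc] by (simp add: n_def)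
  have m_nonzero: "\<phi> (v r) (v (r + s - 1)) + \<phi> (v r) (v (Suc r)) \<noteq> 0"
    and m_line: "line_of_force (\<phi> (v r) (v (r + s - 1)) + \<phi> (v r) (v (Suc r))) \<noteq> join (P (v r)) (P (v (r + s - 1)))"
      "line_of_force (\<phi> (v r) (v (r + s - 1)) + \<phi> (v r) (v (Suc r))) \<noteq> join (P (v r)) (P (v (Suc r)))"
    and arc_pred: "(v r, v (r + s - 1)) \<in> parcs G" for r
  proof -
    obtain k where k: "r + s = Suc k" using s3 by (cases "r + s") auto
    have vk: "v r = v (Suc k)" "v (Suc r) = v (Suc (Suc k))" "v (r + s - 1) = v k"
      using vs[of r] vs[of "Suc r"] k by simp_all
    show "(v r, v (r + s - 1)) \<in> parcs G" unfolding vk by (rule arc')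
    show "\<phi> (v r) (v (r + s - 1)) + \<phi> (v r) (v (Suc r)) \<noteq> 0" unfolding vk
      by (rule sum_nonzero[OF arc' arc v_neq])
    show "line_of_force (\<phi> (v r) (v (r + s - 1)) + \<phi> (v r) (v (Suc r))) \<noteq> join (P (v r)) (P (v (r + s - 1)))"
      "line_of_force (\<phi> (v r) (v (r + s - 1)) + \<phi> (v r) (v (Suc r))) \<noteq> join (P (v r)) (P (v (Suc r)))"
      unfolding vk by (rule sum_line[OF arc' arc v_neq])+
  qed
  have ls_r: "ls ! r = line_of_force (\<phi> (v r) (v (r + s - 1)) + \<phi> (v r) (v (Suc r)))" if "r < s" for r
    using ls(2)[of r] that unfolding v_def s_def by simp
  have ls_m: "ls ! (r mod s) = normal_line (m r)" for r
  proof -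
    have "r mod s < s" using s3 by simp
    moreover have "v (r mod s) = v r" "v (Suc (r mod s)) = v (Suc r)" by (simp_all add: v_def mod_Suc_eq)
    moreover have "v (r mod s + s - 1) = v (r + s - 1)"
    proof -
      have "(r mod s + (s - 1)) mod s = (r + (s - 1)) mod s" by (rule mod_add_left_eq)
      thus ?thesis using s3 by (simp add: v_def)
    qed
    ultimately show ?thesis using ls_r[of "r mod s"] m_nonzero[of r] by (simp add: m_def line_of_force_eq)
  qed
  have cross: "n (Suc r) \<times> n r \<noteq> 0" for r
  proof -
    have "force_vec (\<phi> (v (Suc r)) (v (Suc (Suc r)))) \<times> force_vec (\<phi> (v (Suc r)) (v r)) \<noteq> 0"
      using cross_nonzero[OF arc arc' v_neq[symmetric]] .
    moreover have "force_vec (\<phi> (v (Suc r)) (v r)) = - b r *\<^sub>R n r"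
      using gain[OF arc[of r]] by (simp add: n_def b_def)
    ultimately show ?thesis by (auto simp: n_def[of "Suc r"] cross_mult_right)
  qed
  have polygon: "framed_polygon (map P q) ls n m b \<nu>" if \<nu>: "\<nu> \<noteq> 0" and adm: "admissible_line (map P q) (normal_line \<nu>)" for \<nu>
  proof
    show "map P q \<noteq> []" using s3 by (auto simp: s_def)
    fix r
    show "edge_line (map P q) r = normal_line (n r)" by (rule n_edge)
    show "ls ! (r mod length (map P q)) = normal_line (m r)" using ls_m[of r] by (simp add: s_def)
    have "v (Suc r + s - 1) = v r" using vs[of r] by simp
    thus "m (Suc r) = n (Suc r) - b r *\<^sub>R n r"
      using gain[OF arc[of r]] unfolding m_def n_def b_def by simp
    show "b r \<noteq> 0" unfolding b_def by (rule gain_nonzero[OF arc])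
    show "n (r + length (map P q)) = n r" "m (r + length (map P q)) = m r"
    proof -
      have 1: "v (Suc (r + s)) = v (Suc r)" using vs[of "Suc r"] by simp
      show "n (r + length (map P q)) = n r" using vs[of r] 1 unfolding n_def by (simp add: s_def)
      have "r + s + s - 1 = (r + s - 1) + s" using s3 by simp
      hence "v (r + s + s - 1) = v (r + s - 1)" using vs[of "r + s - 1"] by simp
      thus "m (r + length (map P q)) = m r" using vs[of r] 1 unfolding m_def by (simp add: s_def)
    qed
    \<comment> \<open>Otherwise the auxiliary line would contain the common point of two consecutive
      edge lines, against admissibility.\<close>
    show "(n (Suc r) \<times> n r) \<bullet> \<nu> \<noteq> 0"
    proof
      assume z: "(n (Suc r) \<times> n r) \<bullet> \<nu> = 0"
      let ?x = "proj_point (n (Suc r) \<times> n r)"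
      have 1: "lies_on ?x (edge_line (map P q) (r mod s))" "lies_on ?x (edge_line (map P q) (Suc r mod s))"
      proof -
        have "edge_line (map P q) (k mod s) = normal_line (n k)" for k
          using n_edge[of k] by (simp add: edge_line_def s_def mod_Suc_eq)
        thus "lies_on ?x (edge_line (map P q) (r mod s))" "lies_on ?x (edge_line (map P q) (Suc r mod s))"
          using lies_on_iff[OF cross n_nonzero] by (simp_all add: dot_cross_self)
      qed
      have 2: "lies_on ?x (normal_line \<nu>)" using lies_on_iff[OF cross \<nu>] z by (simp add: inner_commute)
      show False
        using adm 1 2 lt[of r] lt[of "Suc r"] mod_neq(1)[of r] unfolding admissible_line_def s_def
        by (metis length_map linorder_neqE_nat)
    qed
  qed
  have prod: "(\<Prod>j\<in>{r..<r + s}. b j) = walk_gain g (q @ [hd q])" for r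
  proof -
    have "q \<noteq> []" using s3 unfolding s_def by (cases q) auto
    have "(\<Prod>j\<in>{r..<r + s}. b j) = (\<Prod>j<s. b j)"
    proof (rule prod_periodic)
      show "b (j + s) = b j" for j using vs[of j] vs[of "Suc j"] by (simp add: b_def)
      show "b j \<noteq> 0" for j unfolding b_def by (rule gain_nonzero[OF arc])
    qed
    also have "\<dots> = (\<Prod>r<length q. g (q ! r) (q ! (Suc r mod length q)))"
      unfolding b_def v_def s_def by (rule prod.cong) auto
    also have "\<dots> = walk_gain g (q @ [hd q])" by (rule walk_gain_cycle[OF \<open>q \<noteq> []\<close>, symmetric])
    finally show ?thesis .
  qed
  have fgp: "framed_cycle_general_position (map P q) ls"
    unfolding framed_cycle_general_position_def
  proof (intro conjI allI impI)
    show "length ls = length (map P q)" using ls by simp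
    show "lines_general_position (edge_lines (map P q))" by (rule gp)
    fix r assume "r < length (map P q)"
    hence r: "r < s" by (simp add: s_def)
    have Pr: "map P q ! r = P (v r)" using r by (simp add: v_def s_def)
    have Pn: "map P q ! (Suc r mod length (map P q)) = P (v (Suc r))"
      using lt[of "Suc r"] by (simp add: v_def s_def)
    have Pp: "map P q ! ((r + length (map P q) - 1) mod length (map P q)) = P (v (r + s - 1))"
      using lt[of "r + s - 1"] by (simp add: v_def s_def)
    let ?m = "\<phi> (v r) (v (r + s - 1)) + \<phi> (v r) (v (Suc r))"
    have on: "lies_on (P (v r)) (line_of_force ?m)"
      using passes_add[OF passes_force[OF arc_pred[of r]] passes_force[OF arc[of r]]] m_nonzero[of r]
      unfolding passes_def by blast
    show "lies_on (map P q ! r) (ls ! r)" unfolding Pr ls_r[OF r] by (rule on)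
    show "\<not> lies_on (map P q ! ((r + length (map P q) - 1) mod length (map P q))) (ls ! r)"
      unfolding Pp ls_r[OF r] using join_eq[OF vertices_distinct[OF arc_pred[of r]] on] m_line(1)[of r] by auto
    show "\<not> lies_on (map P q ! (Suc r mod length (map P q))) (ls ! r)"
      unfolding Pn ls_r[OF r] using join_eq[OF vertices_distinct[OF arc[of r]] on] m_line(2)[of r] by auto
  qed
  show ?thesis
  proof
    assume "monodromy_cycle_condition (map P q) ls"
    \<comment> \<open>The starting index and the admissible line are arbitrary here; the product of
      the gains over a period is the same for all of them.\<close>
    then obtain r l where r: "r < length (map P q)" "admissible_line (map P q) l"
      "\<forall>p. lies_on p (ls ! r) \<longrightarrow> monodromy (map P q) ls l r p = p"
      unfolding monodromy_cycle_condition_def by blast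
    obtain \<nu> where \<nu>: "\<nu> \<noteq> 0" "l = normal_line \<nu>" by (rule normal_line_cases)
    interpret framed_polygon "map P q" ls n m b \<nu> using polygon[OF \<nu>(1)] r(2) \<nu>(2) by simp
    show "walk_gain g (q @ [hd q]) = 1"
      using monodromy_identity_iff[OF r(1)] r(3) prod[of r] \<nu>(2) by (simp add: s_def)
  next
    assume w: "walk_gain g (q @ [hd q]) = 1"
    obtain \<nu> where \<nu>: "\<nu> \<noteq> 0" "admissible_line (map P q) (normal_line \<nu>)" by (rule ex_admissible_line[OF gp])
    interpret framed_polygon "map P q" ls n m b \<nu> using polygon[OF \<nu>] .
    have 0: "0 < length (map P q)" using lt[of 0] unfolding s_def by (cases q) auto
    have "\<forall>p. lies_on p (ls ! 0) \<longrightarrow> monodromy (map P q) ls (normal_line \<nu>) 0 p = p"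
      using monodromy_identity_iff[OF 0] prod[of 0] w by (simp add: s_def)
    thus "monodromy_cycle_condition (map P q) ls"
      unfolding monodromy_cycle_condition_def using fgp 0 \<nu>(2) by blast
  qed
qed

end

section \<open>Quantizations carrying forces\<close>

lemma non_parallel_reindex:
  assumes h: "inj_on h I" and np: "non_parallel (h ` I) F"
  shows "non_parallel I (\<lambda>i. F (h i))"
proof -
  have s: "(\<Sum>i\<in>A. F (h i)) = sum F (h ` A)" if "A \<subseteq> I" for A
    using sum.reindex[OF inj_on_subset[OF h that], of F] by simp
  have im: "h ` A = h ` B \<longleftrightarrow> A = B" if "A \<subseteq> I" "B \<subseteq> I" for A B
    using inj_on_image_eq_iff[OF h that] .
  show ?thesis unfolding non_parallel_def
  proof (intro conjI ballI allI impI)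
    fix A assume A: "A \<subseteq> I" "(\<Sum>i\<in>A. F (h i)) = 0"
    have "h ` A \<subseteq> h ` I" "sum F (h ` A) = 0" using A s[OF A(1)] by auto
    hence "h ` A = {} \<or> h ` A = h ` I" using non_parallel_nonzero[OF np, of "h ` A"] by argo
    thus "A = {} \<or> A = I" using im[OF A(1) subset_refl] by simp
  next
    fix r assume r: "r \<in> I"
    show "inj_on (\<lambda>A. line_of_force (\<Sum>i\<in>A. F (h i))) {A. r \<in> A \<and> A \<subset> I}"
    proof (rule inj_onI)
      fix A B assume A: "A \<in> {A. r \<in> A \<and> A \<subset> I}" and B: "B \<in> {A. r \<in> A \<and> A \<subset> I}"
        and e: "line_of_force (\<Sum>i\<in>A. F (h i)) = line_of_force (\<Sum>i\<in>B. F (h i))"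
      have sub: "A \<subseteq> I" "B \<subseteq> I" using A B by auto
      have "h ` A \<noteq> h ` I" "h ` B \<noteq> h ` I"
        using A B im[OF sub(1) subset_refl] im[OF sub(2) subset_refl] by auto
      hence "h ` A \<subset> h ` I" "h ` B \<subset> h ` I"
        using image_mono[OF sub(1), of h] image_mono[OF sub(2), of h] unfolding psubset_eq by auto
      moreover have "h ` A \<inter> h ` B \<noteq> {}" using A B by blast
      moreover have "line_of_force (sum F (h ` A)) = line_of_force (sum F (h ` B))"
        using e s[OF sub(1)] s[OF sub(2)] by simp
      ultimately have "h ` A = h ` B" using non_parallel_line_neq[OF np, of "h ` A" "h ` B"] by metis
      thus "A = B" using im[OF sub] by simp
    qed
  qed
qed

lemma non_parallelizable_scaleR:
  assumes "non_parallelizable G F" "\<And>i. i \<in> pverts G \<Longrightarrow> c i \<noteq> 0"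
    and "\<And>i j. i \<in> pverts G \<Longrightarrow> j \<in> nbrs G i \<Longrightarrow> F' i j = c i *\<^sub>R F i j"
  shows "non_parallelizable G F'"
  unfolding non_parallelizable_def
proof
  fix i assume i: "i \<in> pverts G"
  have "non_parallel (nbrs G i) (\<lambda>j. c i *\<^sub>R F i j)"
    using assms(1) i unfolding non_parallelizable_def by (intro non_parallel_scaleR assms(2)) auto
  moreover have "non_parallel (nbrs G i) (F' i) \<longleftrightarrow> non_parallel (nbrs G i) (\<lambda>j. c i *\<^sub>R F i j)"
    by (rule non_parallel_cong) (rule assms(3)[OF i])
  ultimately show "non_parallel (nbrs G i) (F' i)" by simp
qed

section \<open>Frameworks and their resolution trees\<close>

locale general_framework =
  fixes G :: "'v pair_pre_digraph" and P :: "'v \<Rightarrow> rp2_point"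
  assumes pair_graph_G: "pair_graph G"
    and degree: "i \<in> pverts G \<Longrightarrow> 3 \<le> card (nbrs G i)"
    and framework: "framework G P"
    and general_position: "framework_general_position G P"
begin

lemmas arc_sym = parcs_sym[OF pair_graph_G]
lemmas arc_pverts = parcs_pverts[OF pair_graph_G]

lemma finite_pverts: "finite (pverts G)"
  using pair_graph_G by (simp add: pair_graph_iff)

lemma simple_cycle_pverts:
  assumes "simple_cycle G q" shows "set q \<subseteq> pverts G"
  using assms arc_pverts unfolding simple_cycle_def by (metis in_set_conv_nth subsetI)

lemma cycle_general_position:
  assumes q: "simple_cycle G q" "set q \<noteq> pverts G"
  shows "lines_general_position (edge_lines (map P q))"
proof -
  have "set q \<subset> pverts G" using simple_cycle_pverts[OF q(1)] q(2) by blast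
  hence "card (set q) < card (pverts G)" by (rule psubset_card_mono[OF finite_pverts])
  moreover have "card (set q) = length q" using q(1) by (simp add: simple_cycle_def distinct_card)
  ultimately show ?thesis using general_position q(1) by (simp add: framework_general_position_def)
qed

lemma sum_pverts_nbrs:
  assumes "\<And>j. (i, j) \<notin> parcs G \<Longrightarrow> F i j = 0"
  shows "(\<Sum>j \<in> pverts G - {i}. F i j) = (\<Sum>j \<in> nbrs G i. F i j :: force)"
proof (rule sum.mono_neutral_right)
  show "nbrs G i \<subseteq> pverts G - {i}"
    using arc_pverts parcs_irrefl[OF pair_graph_G] by (auto simp: nbrs_def)
qed (use assms finite_pverts in \<open>auto simp: nbrs_def\<close>)

end

locale framework_trees = general_framework G P for G :: "'v pair_pre_digraph" and P +
  fixes T :: "'v \<Rightarrow> 't pair_pre_digraph" and lf :: "'v \<Rightarrow> 'v \<Rightarrow> 't"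
  assumes resolution_trees: "resolution_trees G T lf"
begin

lemma binary_tree: "i \<in> pverts G \<Longrightarrow> binary_tree (T i)"
  using resolution_trees by (intro binary_tree.intro) (simp add: resolution_trees_def)

lemma lf_bij: "i \<in> pverts G \<Longrightarrow> bij_betw (lf i) (nbrs G i) (leaf_verts (T i))"
  using resolution_trees by (simp add: resolution_trees_def)

lemma card_leaf_verts: "i \<in> pverts G \<Longrightarrow> 3 \<le> card (leaf_verts (T i))"
  using bij_betw_same_card[OF lf_bij] degree by metis

lemma lf_leaf: "i \<in> pverts G \<Longrightarrow> (i, j) \<in> parcs G \<Longrightarrow> lf i j \<in> leaf_verts (T i)"
  using lf_bij by (auto simp: bij_betw_def nbrs_def)

lemma lf_inj: "i \<in> pverts G \<Longrightarrow> (i, j) \<in> parcs G \<Longrightarrow> (i, k) \<in> parcs G \<Longrightarrow> lf i j = lf i k \<Longrightarrow> j = k"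
  using lf_bij by (auto simp: bij_betw_def nbrs_def inj_on_def)

lemma leaf_cases:
  assumes "i \<in> pverts G" "l \<in> leaf_verts (T i)"
  obtains j where "(i, j) \<in> parcs G" "l = lf i j"
  using lf_bij[OF assms(1)] assms(2) that unfolding bij_betw_def nbrs_def by blast

lemma stem_not_leaf:
  assumes ij: "(i, j) \<in> parcs G" shows "stem (T i) (lf i j) \<notin> leaf_verts (T i)"
proof -
  have i: "i \<in> pverts G" using arc_pverts[OF ij] by simp
  interpret binary_tree "T i" by (rule binary_tree[OF i])
  show ?thesis
    using leaf_not_adjacent[OF card_leaf_verts[OF i] lf_leaf[OF i ij]] stem_arc[OF lf_leaf[OF i ij]] by blast
qed

text \<open>With at least three leaves, no edge contains two leaf vertices, so the definite
  description in \<open>glue\<close> picks \<open>j\<close>.\<close>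

lemma glue_leaf:
  assumes ij: "(i, j) \<in> parcs G"
  shows "glue G T lf i {stem (T i) (lf i j), lf i j} = leaf_edge T lf i j"
proof -
  have i: "i \<in> pverts G" using arc_pverts[OF ij] by simp
  have u: "k = j" if "k \<in> nbrs G i \<and> lf i k \<in> {stem (T i) (lf i j), lf i j}" for k
  proof -
    have k: "(i, k) \<in> parcs G" using that by (simp add: nbrs_def)
    hence "lf i k \<in> leaf_verts (T i)" by (rule lf_leaf[OF i])
    hence "lf i k = lf i j" using that stem_not_leaf[OF ij] by auto
    thus "k = j" using lf_inj[OF i k ij] by simp
  qed
  have j: "j \<in> nbrs G i \<and> lf i j \<in> {stem (T i) (lf i j), lf i j}" using ij by (simp add: nbrs_def)
  have "(THE k. k \<in> nbrs G i \<and> lf i k \<in> {stem (T i) (lf i j), lf i j}) = j"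
    using j u by (rule the_equality)
  moreover have "\<exists>k \<in> nbrs G i. lf i k \<in> {stem (T i) (lf i j), lf i j}" using j by blast
  ultimately show ?thesis unfolding glue_def by simp
qed

lemma glue_interior:
  assumes i: "i \<in> pverts G" and xy: "(x, y) \<in> interior_arcs (T i)"
  shows "glue G T lf i {x, y} = {x, y}"
proof -
  have "lf i j \<notin> {x, y}" if "j \<in> nbrs G i" for j
    using lf_leaf[OF i, of j] that xy by (auto simp: interior_arcs_def nbrs_def)
  thus ?thesis unfolding glue_def by auto
qed

lemma leaf_edge_eq: "leaf_edge T lf i j = {stem (T i) (lf i j), stem (T j) (lf j i)}"
  by (simp add: leaf_edge_def glued_leaf_def)

lemma stem_pverts:
  assumes ij: "(i, j) \<in> parcs G" shows "stem (T i) (lf i j) \<in> pverts (T i)"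
proof -
  have i: "i \<in> pverts G" using arc_pverts[OF ij] by simp
  interpret binary_tree "T i" by (rule binary_tree[OF i])
  show ?thesis using stem_arc[OF lf_leaf[OF i ij]] arc_pverts by blast
qed

lemma tree_disjoint: "i \<in> pverts G \<Longrightarrow> j \<in> pverts G \<Longrightarrow> x \<in> pverts (T i) \<Longrightarrow> x \<in> pverts (T j) \<Longrightarrow> i = j"
  using resolution_trees unfolding resolution_trees_def by blast

text \<open>The ends of a glued edge lie in the trees at \<open>i\<close> and \<open>j\<close>, and
  disjoint trees reveal their indices.\<close>

lemma leaf_edge_inj:
  assumes ij: "(i, j) \<in> parcs G" and kl: "(k, l) \<in> parcs G" and e: "leaf_edge T lf i j = leaf_edge T lf k l"
  shows "{i, j} = {k, l}"
proof -
  have ji: "(j, i) \<in> parcs G" and lk: "(l, k) \<in> parcs G" using ij kl arc_sym by blast+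
  note V = arc_pverts[OF ij] arc_pverts[OF kl]
  note S = stem_pverts[OF ij] stem_pverts[OF ji] stem_pverts[OF kl] stem_pverts[OF lk]
  from e have "stem (T i) (lf i j) = stem (T k) (lf k l) \<and> stem (T j) (lf j i) = stem (T l) (lf l k) \<or>
      stem (T i) (lf i j) = stem (T l) (lf l k) \<and> stem (T j) (lf j i) = stem (T k) (lf k l)"
    unfolding leaf_edge_eq doubleton_eq_iff .
  thus ?thesis
  proof
    assume "stem (T i) (lf i j) = stem (T k) (lf k l) \<and> stem (T j) (lf j i) = stem (T l) (lf l k)"
    hence "i = k" "j = l" using tree_disjoint V S by metis+
    thus ?thesis by simp
  next
    assume "stem (T i) (lf i j) = stem (T l) (lf l k) \<and> stem (T j) (lf j i) = stem (T k) (lf k l)"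
    hence "i = l" "j = k" using tree_disjoint V S by metis+
    thus ?thesis by auto
  qed
qed

lemma leaf_edge_not_interior:
  assumes i: "i \<in> pverts G" and kl: "(k, l) \<in> parcs G"
  shows "\<not> leaf_edge T lf k l \<subseteq> pverts (T i)"
proof
  assume "leaf_edge T lf k l \<subseteq> pverts (T i)"
  hence s: "stem (T k) (lf k l) \<in> pverts (T i)" "stem (T l) (lf l k) \<in> pverts (T i)"
    unfolding leaf_edge_eq by auto
  have lk: "(l, k) \<in> parcs G" using kl arc_sym by blast
  have "k = i" "l = i"
    using tree_disjoint[OF _ i stem_pverts[OF kl] s(1)] tree_disjoint[OF _ i stem_pverts[OF lk] s(2)]
      arc_pverts[OF kl] by auto
  thus False using kl parcs_irrefl[OF pair_graph_G] by blast
qed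

end

section \<open>Quantizations together with leaf forces\<close>

locale loaded_quantization = framework_trees G P T lf for G :: "'v pair_pre_digraph" and P
    and T :: "'v \<Rightarrow> nat pair_pre_digraph" and lf :: "'v \<Rightarrow> 'v \<Rightarrow> nat" +
  fixes L and \<psi> :: "'v \<Rightarrow> nat \<Rightarrow> force"
  assumes quantization: "quantization G P T lf L"
    and loaded: "i \<in> pverts G \<Longrightarrow> loaded_scheme (T i) (\<psi> i) (P i) (restrict_to_tree G T lf L i)"
begin

definition \<phi> :: "'v \<Rightarrow> 'v \<Rightarrow> force" where "\<phi> i j = \<psi> i (lf i j)"

lemma non_parallel_\<phi>:
  assumes i: "i \<in> pverts G" shows "non_parallel (nbrs G i) (\<phi> i)"
proof -
  interpret loaded_scheme "T i" "\<psi> i" "P i" "restrict_to_tree G T lf L i" by (rule loaded[OF i])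
  have "inj_on (lf i) (nbrs G i)" "lf i ` nbrs G i = leaf_verts (T i)"
    using lf_bij[OF i] by (auto simp: bij_betw_def)
  thus ?thesis using non_parallel_reindex[of "lf i" "nbrs G i" "\<psi> i"] non_parallel
    unfolding \<phi>_def by simp
qed

lemma sum_\<phi>:
  assumes i: "i \<in> pverts G" shows "(\<Sum>j\<in>nbrs G i. \<phi> i j) = 0"
proof -
  interpret loaded_scheme "T i" "\<psi> i" "P i" "restrict_to_tree G T lf L i" by (rule loaded[OF i])
  show ?thesis using sum.reindex_bij_betw[OF lf_bij[OF i], of "\<psi> i"] sum_zero unfolding \<phi>_def by simp
qed

lemma line_\<phi>:
  assumes ij: "(i, j) \<in> parcs G" shows "line_of_force (\<phi> i j) = join (P i) (P j)"
proof -
  have i: "i \<in> pverts G" using arc_pverts[OF ij] by simp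
  interpret loaded_scheme "T i" "\<psi> i" "P i" "restrict_to_tree G T lf L i" by (rule loaded[OF i])
  have l: "lf i j \<in> leaf_verts (T i)" by (rule lf_leaf[OF i ij])
  have a: "(stem (T i) (lf i j), lf i j) \<in> parcs (T i)" using stem_arc[OF l] by (subst binary_tree.arc_sym[OF binary_tree_axioms])
  have "restrict_to_tree G T lf L i {stem (T i) (lf i j), lf i j} = L (leaf_edge T lf i j)"
    using glue_leaf[OF ij] by (simp add: restrict_to_tree_def)
  also have "\<dots> = join (P i) (P j)" using quantization ij by (auto simp: quantization_def)
  finally show ?thesis using line_flux[OF a] flux_leaf[OF l] by (simp add: \<phi>_def)
qed

lemma generic_quantization: "generic_quantization G P T lf L"
proof -
  have "strongly_generic (P i) (T i) (restrict_to_tree G T lf L i)" if "i \<in> pverts G" for i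
    using card_leaf_verts[OF that] by (intro loaded_scheme_strongly_generic[OF loaded[OF that]]) auto
  thus ?thesis using quantization by (simp add: generic_quantization_def)
qed

lemma quantization_framing_eq:
  assumes "(i, j) \<in> parcs G" "(i, k) \<in> parcs G" "j \<noteq> k"
  shows "quantization_framing G P T lf L j i k = line_of_force (\<phi> i j + \<phi> i k)"
proof -
  have i: "i \<in> pverts G" using arc_pverts[OF assms(1)] by simp
  have "lf i j \<noteq> lf i k" using lf_inj[OF i assms(1,2)] assms(3) by blast
  thus ?thesis unfolding quantization_framing_def \<phi>_def
    using framing_line_eq[OF infinite_UNIV_nat loaded[OF i] card_leaf_verts[OF i]
        lf_leaf[OF i assms(1)] lf_leaf[OF i assms(2)]] by simp
qed

text \<open>Genericity is automatic for loaded schemes, and the framing lines are lines of sums of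
  two forces, so \<open>cycle_condition_iff\<close> applies. Any numbers that relate
  \<open>\<phi> i j\<close> and \<open>\<phi> j i\<close> may serve as gains; this covers both
  directions of the theorem.\<close>

lemma consistent_iff:
  assumes gain: "\<And>i j. (i, j) \<in> parcs G \<Longrightarrow> \<phi> j i = - g i j *\<^sub>R \<phi> i j"
  shows "consistent_quantization G P T lf L \<longleftrightarrow>
    (\<forall>q. simple_cycle G q \<and> set q \<noteq> pverts G \<longrightarrow> walk_gain g (q @ [hd q]) = 1)"
proof -
  interpret gain_framework G P \<phi> g
    by (rule gain_framework.intro) (fact pair_graph_G framework degree non_parallel_\<phi> line_\<phi> gain)+
  have "monodromy_cycle_condition (map P q) (cycle_framing G P T lf L q) \<longleftrightarrow> walk_gain g (q @ [hd q]) = 1"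
    if q: "simple_cycle G q" "set q \<noteq> pverts G" for q
  proof (rule cycle_condition_iff[OF q(1) cycle_general_position[OF q]])
    show "length (cycle_framing G P T lf L q) = length q" by (simp add: cycle_framing_def Let_def)
    fix r assume r: "r < length q"
    let ?s = "length q" and ?p = "(r + length q - 1) mod length q"
    have s3: "3 \<le> ?s" and d: "distinct q"
      and arc: "\<And>k. k < ?s \<Longrightarrow> (q ! k, q ! (Suc k mod ?s)) \<in> parcs G" using q(1) by (auto simp: simple_cycle_def)
    have lt: "k mod ?s < ?s" for k using r by (intro mod_less_divisor) linarith
    have sp: "Suc ?p mod ?s = r"
    proof -
      have "Suc (r + ?s - 1) = r + ?s" using r by linarith
      thus ?thesis using r by (metis mod_Suc_eq mod_add_self2 mod_less)
    qed
    have "(q ! ?p, q ! r) \<in> parcs G" using arc[OF lt[of "r + ?s - 1"]] unfolding sp .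
    hence a1: "(q ! r, q ! ?p) \<in> parcs G" using arc_sym by blast
    have a2: "(q ! r, q ! (Suc r mod ?s)) \<in> parcs G" by (rule arc[OF r])
    \<comment> \<open>In a cycle of length at least 3 the predecessor differs from the successor, so
      the framing line belongs to two different leaves.\<close>
    have "?p \<noteq> Suc r mod ?s"
    proof
      assume "?p = Suc r mod ?s"
      hence "r = Suc (Suc r mod ?s) mod ?s" using sp by simp
      thus False using r s3 by (auto simp: mod_Suc split: if_splits)
    qed
    hence "q ! ?p \<noteq> q ! (Suc r mod ?s)" using nth_eq_iff_index_eq[OF d lt lt] by blast
    from quantization_framing_eq[OF a1 a2 this]
    show "cycle_framing G P T lf L q ! r = line_of_force (\<phi> (q ! r) (q ! ?p) + \<phi> (q ! r) (q ! (Suc r mod ?s)))"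
      using r by (simp add: cycle_framing_def Let_def)
  qed
  thus ?thesis unfolding consistent_quantization_def using generic_quantization by blast
qed

end

section \<open>From consistent quantizations to tensegrities\<close>

lemma (in general_framework) tensegrity_of_quantization:
  fixes T :: "'v \<Rightarrow> nat pair_pre_digraph"
  assumes conn: "closed_connected G" and cq: "consistent_quantization G P T lf L"
  obtains F where "tensegrity G P F" "non_parallelizable G F"
proof -
  have q: "quantization G P T lf L"
    and sg: "\<And>i. i \<in> pverts G \<Longrightarrow> strongly_generic (P i) (T i) (restrict_to_tree G T lf L i)"
    using cq by (auto simp: consistent_quantization_def generic_quantization_def)
  have "\<forall>i\<in>pverts G. \<exists>\<psi>. loaded_scheme (T i) \<psi> (P i) (restrict_to_tree G T lf L i)"
  proof
    fix i assume "i \<in> pverts G"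
    from sg[OF this] show "\<exists>\<psi>. loaded_scheme (T i) \<psi> (P i) (restrict_to_tree G T lf L i)"
      by (rule strongly_generic_loaded_scheme) blast
  qed
  then obtain \<psi> where \<psi>: "\<forall>i\<in>pverts G. loaded_scheme (T i) (\<psi> i) (P i) (restrict_to_tree G T lf L i)"
    using bchoice[of "pverts G" "\<lambda>i \<psi>. loaded_scheme (T i) \<psi> (P i) (restrict_to_tree G T lf L i)"] by blast
  interpret loaded_quantization G P T lf L \<psi>
  proof (intro loaded_quantization.intro framework_trees.intro general_framework_axioms
        framework_trees_axioms.intro loaded_quantization_axioms.intro)
    show "resolution_trees G T lf" using q by (simp add: quantization_def)
  qed (use q \<psi> in blast)+
  have nz: "\<phi> i j \<noteq> 0" if ij: "(i, j) \<in> parcs G" for i j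
  proof -
    have i: "i \<in> pverts G" using arc_pverts[OF ij] by simp
    thus ?thesis
      using degree[OF i] ij by (intro non_parallel_member_nonzero[OF non_parallel_\<phi>[OF i]]) (auto simp: nbrs_def)
  qed
  \<comment> \<open>Gains exist because both forces are nonzero and have the line through
    \<open>P i\<close> and \<open>P j\<close>.\<close>
  have "\<exists>k. \<phi> j i = - k *\<^sub>R \<phi> i j" if ij: "(i, j) \<in> parcs G" for i j
  proof -
    have ji: "(j, i) \<in> parcs G" using ij arc_sym by blast
    have "line_of_force (\<phi> i j) = line_of_force (\<phi> j i)"
      using line_\<phi>[OF ij] line_\<phi>[OF ji] join_commute by simp
    then obtain c where "\<phi> j i = c *\<^sub>R \<phi> i j" using line_of_force_eq_iff[OF nz[OF ij] nz[OF ji]] by blast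
    thus ?thesis by (intro exI[of _ "- c"]) simp
  qed
  note ex_gain = this
  define g where "g i j = (SOME k. \<phi> j i = - k *\<^sub>R \<phi> i j)" for i j
  have g: "\<phi> j i = - g i j *\<^sub>R \<phi> i j" if "(i, j) \<in> parcs G" for i j
    unfolding g_def using ex_gain[OF that] by (rule someI_ex)
  interpret f: gain_framework G P \<phi> g
    by (rule gain_framework.intro) (fact pair_graph_G framework degree non_parallel_\<phi> line_\<phi> g)+
  interpret gain_graph G g
    by (rule gain_graph.intro) (fact pair_graph_G f.gain_inverse)+
  have short: "walk_gain g (q @ [hd q]) = 1" if "simple_cycle G q" "set q \<noteq> pverts G" for q
    using iffD1[OF consistent_iff[of g, OF g] cq] that by blast
  have cycles: "walk_gain g (q @ [hd q]) = 1" if "simple_cycle G q" for q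
    using degree short that by (rule cycle_gain)
  obtain c where c: "\<And>i. i \<in> pverts G \<Longrightarrow> c i \<noteq> 0" "\<And>i j. (i, j) \<in> parcs G \<Longrightarrow> c j * g i j = c i"
    using ex_potential[OF conn cycles] by metis
  define F where "F i j = (if (i, j) \<in> parcs G then c i *\<^sub>R \<phi> i j else 0)" for i j
  have "force_along (F i j) (join (P i) (P j)) \<and> F i j + F j i = 0" if ij: "(i, j) \<in> parcs G" for i j
  proof
    have ji: "(j, i) \<in> parcs G" using ij arc_sym by blast
    have "force_along (\<phi> i j) (join (P i) (P j))" using line_\<phi>[OF ij] by (simp add: force_along_def)
    thus "force_along (F i j) (join (P i) (P j))" using ij by (simp add: F_def force_along_scaleR)
    \<comment> \<open>The potential equation replaces \<open>c j * g i j\<close> by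
      \<open>c i\<close>, and the two forces at the edge cancel.\<close>
    have "F j i = - (c j * g i j) *\<^sub>R \<phi> i j" using ji g[OF ij] by (simp add: F_def)
    thus "F i j + F j i = 0" unfolding c(2)[OF ij] using ij by (simp add: F_def)
  qed
  hence load: "force_load G P F" by (simp add: force_load_def F_def)
  have "(\<Sum>j \<in> pverts G - {i}. F i j) = 0" if i: "i \<in> pverts G" for i
  proof -
    have "(\<Sum>j \<in> pverts G - {i}. F i j) = (\<Sum>j \<in> nbrs G i. F i j)"
      by (rule sum_pverts_nbrs) (simp add: F_def)
    also have "\<dots> = (\<Sum>j \<in> nbrs G i. c i *\<^sub>R \<phi> i j)"
      by (rule sum.cong) (auto simp: F_def nbrs_def)
    also have "\<dots> = c i *\<^sub>R (\<Sum>j \<in> nbrs G i. \<phi> i j)" by (simp add: scaleR_sum_right)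
    finally show ?thesis using sum_\<phi>[OF i] by simp
  qed
  hence "tensegrity G P F" using framework load by (simp add: tensegrity_def)
  moreover have "non_parallelizable G \<phi>"
    unfolding non_parallelizable_def using non_parallel_\<phi> by blast
  hence "non_parallelizable G F"
    by (rule non_parallelizable_scaleR[where c = c]) (use c in \<open>auto simp: F_def nbrs_def\<close>)
  ultimately show ?thesis by (rule that)
qed

section \<open>From tensegrities to consistent quantizations\<close>

lemma (in general_framework) ex_resolution_trees:
  obtains T :: "'v \<Rightarrow> nat pair_pre_digraph" and lf where "resolution_trees G T lf"
proof -
  obtain ix :: "'v \<Rightarrow> nat" where ix: "inj_on ix (pverts G)"
    using finite_imp_inj_to_nat_seg[OF finite_pverts] by metis
  \<comment> \<open>Disjoint infinite sets of natural numbers, one for each vertex of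
    \<open>G\<close>, in which the trees are built.\<close>
  define U where "U i = range (\<lambda>k. prod_encode (ix i, k))" for i
  have inf: "infinite (U i)" for i
    unfolding U_def by (rule range_inj_infinite) (simp add: inj_def prod_encode_eq)
  have "\<forall>i\<in>pverts G. \<exists>t. full_binary_tree t \<and> pverts t \<subseteq> U i \<and> card (leaf_verts t) = card (nbrs G i)"
  proof
    fix i assume "i \<in> pverts G"
    hence "2 \<le> card (nbrs G i)" using degree[of i] by simp
    thus "\<exists>t. full_binary_tree t \<and> pverts t \<subseteq> U i \<and> card (leaf_verts t) = card (nbrs G i)"
      by (rule ex_full_binary_tree[OF inf])
  qed
  from bchoice[OF this] obtain T where T: "\<forall>i \<in> pverts G. full_binary_tree (T i) \<and>
      pverts (T i) \<subseteq> U i \<and> card (leaf_verts (T i)) = card (nbrs G i)" ..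
  have "\<forall>i\<in>pverts G. \<exists>h. bij_betw h (nbrs G i) (leaf_verts (T i))"
  proof
    fix i assume i: "i \<in> pverts G"
    have Ti: "full_binary_tree (T i)" "card (leaf_verts (T i)) = card (nbrs G i)" using T i by auto
    interpret binary_tree "T i" by (rule binary_tree.intro[OF Ti(1)])
    show "\<exists>h. bij_betw h (nbrs G i) (leaf_verts (T i))"
      by (rule finite_same_card_bij[OF finite_nbrs[OF pair_graph_G] finite_leaf_verts Ti(2)[symmetric]])
  qed
  from bchoice[OF this] obtain lf where lf: "\<forall>i \<in> pverts G. bij_betw (lf i) (nbrs G i) (leaf_verts (T i))" ..
  have "pverts (T i) \<inter> pverts (T j) = {}" if "i \<in> pverts G" "j \<in> pverts G" "i \<noteq> j" for i j
  proof -
    have "ix i \<noteq> ix j" using ix that by (auto simp: inj_on_def)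
    hence "U i \<inter> U j = {}" by (auto simp: U_def prod_encode_eq)
    moreover have "pverts (T i) \<subseteq> U i" "pverts (T j) \<subseteq> U j" using T that by auto
    ultimately show ?thesis by blast
  qed
  hence "resolution_trees G T lf" using T lf unfolding resolution_trees_def by simp
  thus ?thesis by (rule that)
qed

section \<open>The quantization of a tensegrity\<close>

locale tensegrity_trees = framework_trees G P T lf for G :: "'v pair_pre_digraph" and P
    and T :: "'v \<Rightarrow> nat pair_pre_digraph" and lf :: "'v \<Rightarrow> 'v \<Rightarrow> nat" +
  fixes F :: "'v \<Rightarrow> 'v \<Rightarrow> force"
  assumes tensegrity: "tensegrity G P F" and non_parallelizable: "non_parallelizable G F"
begin

lemma force_along: "(i, j) \<in> parcs G \<Longrightarrow> force_along (F i j) (join (P i) (P j))"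
  and force_anti: "(i, j) \<in> parcs G \<Longrightarrow> F j i = - F i j"
  and force_sum: "i \<in> pverts G \<Longrightarrow> (\<Sum>j \<in> nbrs G i. F i j) = 0"
proof -
  have load: "force_load G P F" using tensegrity by (simp add: tensegrity_def)
  have z: "(i, j) \<notin> parcs G \<Longrightarrow> F i j = 0" for i j using load by (simp add: force_load_def)
  show "(i, j) \<in> parcs G \<Longrightarrow> force_along (F i j) (join (P i) (P j))"
    using load by (simp add: force_load_def)
  show "F j i = - F i j" if "(i, j) \<in> parcs G"
  proof -
    have "F i j + F j i = 0" using load that unfolding force_load_def by blast
    from minus_unique[OF this] show ?thesis by simp
  qed
  show "(\<Sum>j \<in> nbrs G i. F i j) = 0" if "i \<in> pverts G"
  proof -
    have "(\<Sum>j \<in> pverts G - {i}. F i j) = 0" using tensegrity that unfolding tensegrity_def by blast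
    thus ?thesis using sum_pverts_nbrs[of i F] z by simp
  qed
qed

lemma force_nonzero:
  assumes ij: "(i, j) \<in> parcs G" shows "F i j \<noteq> 0"
proof -
  have i: "i \<in> pverts G" using arc_pverts[OF ij] by simp
  have np: "non_parallel (nbrs G i) (F i)" using non_parallelizable i unfolding non_parallelizable_def by blast
  show ?thesis using degree[OF i] ij by (intro non_parallel_member_nonzero[OF np]) (auto simp: nbrs_def)
qed

lemma force_line: "(i, j) \<in> parcs G \<Longrightarrow> line_of_force (F i j) = join (P i) (P j)"
  using force_along force_nonzero unfolding force_along_def by blast

definition leaf_force :: "'v \<Rightarrow> nat \<Rightarrow> force" where
  "leaf_force i l = F i (inv_into (nbrs G i) (lf i) l)"

lemma leaf_force_lf:
  assumes "(i, j) \<in> parcs G" shows "leaf_force i (lf i j) = F i j"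
proof -
  have "i \<in> pverts G" using arc_pverts[OF assms] by simp
  hence "inv_into (nbrs G i) (lf i) (lf i j) = j"
    using lf_bij assms by (intro inv_into_f_f) (auto simp: bij_betw_def nbrs_def)
  thus ?thesis by (simp add: leaf_force_def)
qed

lemma load_tree:
  assumes i: "i \<in> pverts G" shows "load_tree (T i) (leaf_force i)"
proof (intro load_tree.intro load_tree_axioms.intro binary_tree[OF i])
  have b: "bij_betw (inv_into (nbrs G i) (lf i)) (leaf_verts (T i)) (nbrs G i)"
    by (rule bij_betw_inv_into[OF lf_bij[OF i]])
  have "non_parallel (nbrs G i) (F i)" using non_parallelizable i unfolding non_parallelizable_def by blast
  thus "non_parallel (leaf_verts (T i)) (leaf_force i)"
    using non_parallel_reindex[of "inv_into (nbrs G i) (lf i)" "leaf_verts (T i)" "F i"] b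
    unfolding leaf_force_def bij_betw_def by simp
  show "sum (leaf_force i) (leaf_verts (T i)) = 0"
    unfolding leaf_force_def sum.reindex_bij_betw[OF b] by (rule force_sum[OF i])
qed

lemma passes_leaf_force:
  assumes i: "i \<in> pverts G" and l: "l \<in> leaf_verts (T i)" shows "passes (P i) (leaf_force i l)"
proof -
  obtain j where j: "(i, j) \<in> parcs G" "l = lf i j" by (rule leaf_cases[OF i l])
  have "P i \<noteq> P j" using framework j by (auto simp: framework_def)
  hence "lies_on (P i) (line_of_force (F i j))" using force_line[OF j(1)] lies_on_join by simp
  thus ?thesis using leaf_force_lf[OF j(1)] j(2) by (simp add: passes_def)
qed

abbreviation tree_flux :: "'v \<Rightarrow> nat \<Rightarrow> nat \<Rightarrow> force" where
  "tree_flux i \<equiv> load_tree.flux (T i) (leaf_force i)"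

text \<open>A relation at first, because an edge of the resolution graph has several descriptions:
  interior edges have two orientations, and a glued edge can be named from either of its
  trees.\<close>

definition edge_rel :: "nat set \<Rightarrow> rp2_line \<Rightarrow> bool" where
  "edge_rel e l \<longleftrightarrow>
    (\<exists>i x y. i \<in> pverts G \<and> (x, y) \<in> interior_arcs (T i) \<and> e = {x, y} \<and> l = line_of_force (tree_flux i x y)) \<or>
    (\<exists>i j. (i, j) \<in> parcs G \<and> e = leaf_edge T lf i j \<and> l = join (P i) (P j))"

lemma interior_arcs_pverts:
  assumes i: "i \<in> pverts G" and xy: "(x, y) \<in> interior_arcs (T i)"
  shows "(x, y) \<in> parcs (T i)" "x \<in> pverts (T i)" "y \<in> pverts (T i)"
proof -
  interpret binary_tree "T i" by (rule binary_tree[OF i])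
  show a: "(x, y) \<in> parcs (T i)" using xy by (simp add: interior_arcs_def)
  show "x \<in> pverts (T i)" "y \<in> pverts (T i)" using arc_pverts[OF a] by auto
qed

lemma line_tree_flux_commute:
  assumes i: "i \<in> pverts G" and xy: "(x, y) \<in> parcs (T i)"
  shows "line_of_force (tree_flux i y x) = line_of_force (tree_flux i x y)"
proof -
  interpret load_tree "T i" "leaf_force i" by (rule load_tree[OF i])
  have yx: "(y, x) \<in> parcs (T i)" using xy binary_tree.arc_sym[OF binary_tree_axioms] by blast
  show ?thesis using flux_anti[OF yx] line_of_force_minus[OF flux_nonzero[OF xy]] by simp
qed

text \<open>The trees are disjoint: an interior edge lies in a single tree and a glued edge in none,
  and both orientations give the same line.\<close>

lemma edge_rel_unique:
  assumes "edge_rel e l" "edge_rel e l'" shows "l = l'"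
proof -
  have ii: "l = l'" if a: "i \<in> pverts G" "(x, y) \<in> interior_arcs (T i)" "e = {x, y}" "l = line_of_force (tree_flux i x y)"
    "j \<in> pverts G" "(z, w) \<in> interior_arcs (T j)" "e = {z, w}" "l' = line_of_force (tree_flux j z w)"
    for i j x y z w and l l' :: rp2_line
  proof -
    have "x \<in> {z, w}" using a(3,7) by blast
    hence "x \<in> pverts (T j)" using interior_arcs_pverts[OF a(5,6)] by auto
    hence ij: "i = j" using tree_disjoint[OF a(1,5)] interior_arcs_pverts[OF a(1,2)] by blast
    have "{x, y} = {z, w}" using a(3,7) by simp
    thus ?thesis using a(4,8) line_tree_flux_commute[OF a(1) interior_arcs_pverts(1)[OF a(1,2)]] ij
      unfolding doubleton_eq_iff by auto
  qed
  have il: False if a: "i \<in> pverts G" "(x, y) \<in> interior_arcs (T i)" "e = {x, y}" "(k, m) \<in> parcs G" "e = leaf_edge T lf k m"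
    for i x y k m
    using leaf_edge_not_interior[OF a(1,4)] interior_arcs_pverts[OF a(1,2)] a(3,5) by auto
  have ll: "l = l'" if a: "(i, j) \<in> parcs G" "e = leaf_edge T lf i j" "l = join (P i) (P j)"
    "(k, m) \<in> parcs G" "e = leaf_edge T lf k m" "l' = join (P k) (P m)" for i j k m and l l' :: rp2_line
  proof -
    have "{i, j} = {k, m}" using leaf_edge_inj[OF a(1,4)] a(2,5) by simp
    thus ?thesis using a(3,6) join_commute unfolding doubleton_eq_iff by auto
  qed
  from assms(1) show ?thesis unfolding edge_rel_def
  proof (elim disjE exE conjE)
    fix i x y assume a: "i \<in> pverts G" "(x, y) \<in> interior_arcs (T i)" "e = {x, y}" "l = line_of_force (tree_flux i x y)"
    from assms(2) show ?thesis unfolding edge_rel_def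
    proof (elim disjE exE conjE)
      fix j z w assume "j \<in> pverts G" "(z, w) \<in> interior_arcs (T j)" "e = {z, w}" "l' = line_of_force (tree_flux j z w)"
      thus ?thesis by (rule ii[OF a])
    next
      fix k m assume "(k, m) \<in> parcs G" "e = leaf_edge T lf k m"
      hence False by (rule il[OF a(1-3)])
      thus ?thesis ..
    qed
  next
    fix i j assume a: "(i, j) \<in> parcs G" "e = leaf_edge T lf i j" "l = join (P i) (P j)"
    from assms(2) show ?thesis unfolding edge_rel_def
    proof (elim disjE exE conjE)
      fix k x y assume "k \<in> pverts G" "(x, y) \<in> interior_arcs (T k)" "e = {x, y}"
      hence False by (rule il[OF _ _ _ a(1,2)])
      thus ?thesis ..
    next
      fix k m assume "(k, m) \<in> parcs G" "e = leaf_edge T lf k m" "l' = join (P k) (P m)"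
      thus ?thesis by (rule ll[OF a])
    qed
  qed
qed

text \<open>The restriction makes the map extensional, as \<open>quantization\<close>
  demands.\<close>

definition edge_map :: "nat set \<Rightarrow> rp2_line" where
  "edge_map = restrict (\<lambda>e. SOME l. edge_rel e l) (uedges (resolution_graph G T lf))"

lemma edge_map_eq:
  assumes "e \<in> uedges (resolution_graph G T lf)" "edge_rel e l" shows "edge_map e = l"
  using someI[of "edge_rel e" l] edge_rel_unique assms unfolding edge_map_def by simp

lemma edge_map_leaf:
  assumes ij: "(i, j) \<in> parcs G" shows "edge_map (leaf_edge T lf i j) = join (P i) (P j)"
proof (rule edge_map_eq)
  have "glued_leaf T lf i j \<in> parcs (resolution_graph G T lf)"
    using ij unfolding resolution_graph_def by auto
  thus "leaf_edge T lf i j \<in> uedges (resolution_graph G T lf)"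
    unfolding uedges_def leaf_edge_def mem_Collect_eq
    by (intro exI[of _ "fst (glued_leaf T lf i j)"] exI[of _ "snd (glued_leaf T lf i j)"]) simp
  show "edge_rel (leaf_edge T lf i j) (join (P i) (P j))" using ij unfolding edge_rel_def by blast
qed

lemma edge_map_interior:
  assumes i: "i \<in> pverts G" and xy: "(x, y) \<in> interior_arcs (T i)"
  shows "edge_map {x, y} = line_of_force (tree_flux i x y)"
proof (rule edge_map_eq)
  have "(x, y) \<in> parcs (resolution_graph G T lf)" using i xy unfolding resolution_graph_def by auto
  thus "{x, y} \<in> uedges (resolution_graph G T lf)" unfolding uedges_def by blast
  show "edge_rel {x, y} (line_of_force (tree_flux i x y))" using i xy unfolding edge_rel_def by blast
qed

text \<open>Interior edges carry the line of their flux by construction. At a leaf the flux is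
  \<open>F i j\<close> itself, whose line is the one through \<open>P i\<close> and
  \<open>P j\<close>.\<close>

lemma loaded_scheme_edge_map:
  assumes i: "i \<in> pverts G"
  shows "loaded_scheme (T i) (leaf_force i) (P i) (restrict_to_tree G T lf edge_map i)"
proof (intro loaded_scheme.intro loaded_scheme_axioms.intro load_tree[OF i] passes_leaf_force[OF i])
  interpret t: load_tree "T i" "leaf_force i" by (rule load_tree[OF i])
  have leaf: "restrict_to_tree G T lf edge_map i {x, l} = line_of_force (tree_flux i x l)"
    if xl: "(x, l) \<in> parcs (T i)" and l: "l \<in> leaf_verts (T i)" for x l
  proof -
    obtain j where j: "(i, j) \<in> parcs G" "l = lf i j" by (rule leaf_cases[OF i l])
    have "(l, x) \<in> parcs (T i)" using xl t.arc_sym by blast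
    hence x: "x = stem (T i) l" by (rule t.leaf_arc[OF l])
    have "tree_flux i x l = F i j"
      using t.flux_leaf[OF l] leaf_force_lf[OF j(1)] unfolding x j(2)[symmetric] by simp
    moreover have "restrict_to_tree G T lf edge_map i {x, l} = join (P i) (P j)"
      using glue_leaf[OF j(1)] edge_map_leaf[OF j(1)] by (simp add: restrict_to_tree_def x j(2))
    ultimately show ?thesis using force_line[OF j(1)] by simp
  qed
  fix x y assume xy: "(x, y) \<in> parcs (T i)"
  have yx: "(y, x) \<in> parcs (T i)" using xy t.arc_sym by blast
  consider "y \<in> leaf_verts (T i)" | "x \<in> leaf_verts (T i)" | "(x, y) \<in> interior_arcs (T i)"
    using xy by (auto simp: interior_arcs_def)
  thus "restrict_to_tree G T lf edge_map i {x, y} = line_of_force (tree_flux i x y)"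
  proof cases
    case 1
    thus ?thesis by (rule leaf[OF xy])
  next
    case 2
    thus ?thesis using leaf[OF yx] line_tree_flux_commute[OF i xy] by (simp add: insert_commute[of y x "{}"])
  next
    case 3
    thus ?thesis using glue_interior[OF i 3] edge_map_interior[OF i 3] by (simp add: restrict_to_tree_def)
  qed
qed simp_all

lemma quantization_edge_map: "quantization G P T lf edge_map"
  unfolding quantization_def
proof (intro conjI ballI)
  show "resolution_trees G T lf" by (rule resolution_trees)
  show "edge_map \<in> uedges (resolution_graph G T lf) \<rightarrow>\<^sub>E UNIV" unfolding edge_map_def by simp
  show "case a of (i, j) \<Rightarrow> edge_map (leaf_edge T lf i j) = join (P i) (P j)" if "a \<in> parcs G" for a
    using edge_map_leaf that by (cases a) simp
  show "case a of (x, y) \<Rightarrow> lies_on (P i) (edge_map {x, y})"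
    if i: "i \<in> pverts G" and a: "a \<in> interior_arcs (T i)" for i a
  proof -
    obtain x y where xy: "a = (x, y)" by (cases a)
    interpret loaded_scheme "T i" "leaf_force i" "P i" "restrict_to_tree G T lf edge_map i"
      by (rule loaded_scheme_edge_map[OF i])
    have int: "(x, y) \<in> interior_arcs (T i)" using a xy by simp
    have arc: "(x, y) \<in> parcs (T i)" by (rule interior_arcs_pverts(1)[OF i int])
    have "{x, y} \<in> uedges (T i)" using arc by (auto simp: uedges_def)
    hence "lies_on (P i) (restrict_to_tree G T lf edge_map i {x, y})"
      using weakly_generic unfolding weakly_generic_def resolution_scheme_def by blast
    thus ?thesis using glue_interior[OF i int] xy by (simp add: restrict_to_tree_def)
  qed
qed

text \<open>The two forces of a tensegrity at an edge are opposite, so all gains may be taken to be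
  1.\<close>

lemma consistent_edge_map: "consistent_quantization G P T lf edge_map"
proof -
  interpret loaded_quantization G P T lf edge_map leaf_force
    by (intro loaded_quantization.intro framework_trees_axioms loaded_quantization_axioms.intro
        quantization_edge_map loaded_scheme_edge_map)
  have "\<phi> j i = - 1 *\<^sub>R \<phi> i j" if ij: "(i, j) \<in> parcs G" for i j
  proof -
    have ji: "(j, i) \<in> parcs G" using ij arc_sym by blast
    show ?thesis using force_anti[OF ij] leaf_force_lf[OF ij] leaf_force_lf[OF ji] by (simp add: \<phi>_def)
  qed
  hence "consistent_quantization G P T lf edge_map \<longleftrightarrow>
      (\<forall>q. simple_cycle G q \<and> set q \<noteq> pverts G \<longrightarrow> walk_gain (\<lambda>_ _. 1) (q @ [hd q]) = 1)"
    by (rule consistent_iff[of "\<lambda>_ _. 1"])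
  thus ?thesis by (simp add: walk_gain_prod)
qed

end

theorem theorem5p20:
  fixes G :: "'v pair_pre_digraph" and P :: "'v \<Rightarrow> rp2_point"
  assumes "pair_graph G"
    and "Digraph_Component.connected (with_proj G)"
    and "\<forall>v \<in> pverts G. 3 \<le> out_degree (with_proj G) v"
    and "framework G P"
    and "framework_general_position G P"
  shows "(\<exists>F. tensegrity G P F \<and> non_parallelizable G F) \<longleftrightarrow>
    (\<exists>(T :: 'v \<Rightarrow> nat pair_pre_digraph) lf L. consistent_quantization G P T lf L)"
proof -
  interpret general_framework G P
    by (rule general_framework.intro) (use assms in \<open>simp_all add: out_degree_card_nbrs\<close>)
  show ?thesis
  proof
    assume "\<exists>F. tensegrity G P F \<and> non_parallelizable G F"
    then obtain F where F: "tensegrity G P F" "non_parallelizable G F" by blast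
    obtain T :: "'v \<Rightarrow> nat pair_pre_digraph" and lf where T: "resolution_trees G T lf"
      by (rule ex_resolution_trees)
    interpret tensegrity_trees G P T lf F
      by (intro tensegrity_trees.intro framework_trees.intro general_framework_axioms
          framework_trees_axioms.intro tensegrity_trees_axioms.intro T F)
    show "\<exists>(T :: 'v \<Rightarrow> nat pair_pre_digraph) lf L. consistent_quantization G P T lf L"
      using consistent_edge_map by blast
  next
    assume "\<exists>(T :: 'v \<Rightarrow> nat pair_pre_digraph) lf L. consistent_quantization G P T lf L"
    then obtain T :: "'v \<Rightarrow> nat pair_pre_digraph" and lf L where cq: "consistent_quantization G P T lf L" by blast
    have "closed_connected G" using connected_iff_closed[OF assms(1)] assms(2) by blast
    from tensegrity_of_quantization[OF this cq] show "\<exists>F. tensegrity G P F \<and> non_parallelizable G F" by blast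
  qed
qed

end
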